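(* Let $n = 3$ or $n=4$. Then, for each integer $d \geq 3$, there are non-full harmonic maps $\phi : S^2 \to S^n$ of degree $d$ which admit non-integrable Jacobi fields.
   Context: $S^n$ denotes the unit sphere in $\mathbb{R}^{n+1}$ with its induced metric. A smooth map $\phi:(M,g)\to(N,h)$ between compact Riemannian manifolds is harmonic if it is a critical point of the energy $E(\phi)=\frac12\int_M|d\phi|^2\,\omega_g$ with respect to all smooth one-parameter variations. A smooth variation of $\phi$ is a smooth map $(x,t)\mapsto\phi_t(x)$, $M\times(-\epsilon,\epsilon)\to N$, with $\phi_0=\phi$; it is tangent to $v\in\Gamma(\phi^{-1}TN)$ if $\partial\phi_t/\partial t|_{t=0}=v$. A Jacobi field along a harmonic map $\phi$ is a $v\in\Gamma(\phi^{-1}TN)$ with $J_\phi(v)=0$, where $J_\phi$ is the Jacobi operator, i.e. the self-adjoint linear elliptic operator determined by $\frac{\partial^2E(\phi_{t,s})}{\partial t\,\partial s}\big|_{(0,0)}=\int_M\langle J_\phi(v),w\rangle\,\omega_g$ for two-parameter variations $\phi_{t,s}$ of $\phi$ with $\partial\phi_{t,s}/\partial t=v$, $\partial\phi_{t,s}/\partial s=w$ at $(0,0)$. A Jacobi field $v$ along $\phi$ is integrable if it is tangent to a smooth variation $\{\phi_t\}$ of $\phi$ through harmonic maps. A map $S^2\to S^n$ is full if its image does not lie in a totally geodesic (equatorial) $S^{n-1}\subset S^n$, and non-full otherwise. The degree here is the twistor degree: for a harmonic map $\phi:S^2\to S^4$ it is the integer $d\ge0$ such that $E(\phi)=4\pi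 d$ (the degree of the horizontal holomorphic twistor lift $S^2\to\mathbb{C}P^3$ of $\phi$ or $-\phi$); for a harmonic map into $S^3$ it is the twistor degree of its composition with a totally geodesic inclusion $S^3\hookrightarrow S^4$. *)

theory Defs
  imports "HOL-Analysis.Analysis"
begin

section \<open>Smooth maps between subsets of Euclidean spaces\<close>

text \<open>The predicate \<open>C_on k U f\<close> is meant for open \<open>U\<close>.\<close>

primrec C_on :: "nat \<Rightarrow> 'a::euclidean_space set \<Rightarrow> ('a \<Rightarrow> 'b::real_normed_vector) \<Rightarrow> bool" where
  "C_on 0 U f \<longleftrightarrow> continuous_on U f"
| "C_on (Suc k) U f \<longleftrightarrow>
     (\<forall>x\<in>U. f differentiable at x) \<and> (\<forall>v. C_on k U (\<lambda>x. frechet_derivative f (at x) v))"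

text \<open>A map on an arbitrary subset is smooth if it extends locally to a smooth map on an open subset
  of the ambient space. On an embedded submanifold this is the intrinsic notion of smoothness.\<close>

definition smooth_on :: "'a::euclidean_space set \<Rightarrow> ('a \<Rightarrow> 'b::real_normed_vector) \<Rightarrow> bool" where
  "smooth_on S f \<longleftrightarrow>
     (\<forall>x\<in>S. \<exists>U F. open U \<and> x \<in> U \<and> (\<forall>k. C_on k U F) \<and> (\<forall>y\<in>S \<inter> U. F y = f y))"

definition smooth_map ::
  "'a::euclidean_space set \<Rightarrow> 'b::real_normed_vector set \<Rightarrow> ('a \<Rightarrow> 'b) \<Rightarrow> bool" where
  "smooth_map M N f \<longleftrightarrow> f ` M \<subseteq> N \<and> smooth_on M f"


section \<open>Energy of maps from the round 2-sphere\<close>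

text \<open>The sphere $S^n$ is the set \<open>sphere 0 1\<close> in \<open>real ^ 'm\<close> with \<open>CARD('m) = n + 1\<close>. Maps on $S^2$
  are represented by functions on \<open>real ^ 3\<close>; their values off \<open>S2\<close> play no role.\<close>

abbreviation S2 :: "(real ^ 3) set" where
  "S2 \<equiv> sphere 0 1"

text \<open>Inverse stereographic projection from the north pole. It is a bijection onto $S^2$ minus that
  pole, and it pulls the induced metric back to $4|dz|^2/(1+|z|^2)^2$, whose area form is
  $4\,dx\,dy/(1+|z|^2)^2$.\<close>

definition stereo_inv :: "complex \<Rightarrow> real ^ 3" where
  "stereo_inv z =
     (1 / (1 + (cmod z)\<^sup>2)) *\<^sub>R vector [2 * Re z, 2 * Im z, (cmod z)\<^sup>2 - 1]"

definition S2_integral :: "(real ^ 3 \<Rightarrow> real) \<Rightarrow> real" where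
  "S2_integral f = (\<integral>z. f (stereo_inv z) * (4 / (1 + (cmod z)\<^sup>2)\<^sup>2) \<partial>lborel)"

definition tangent_frame :: "real ^ 3 \<Rightarrow> (real ^ 3) set \<Rightarrow> bool" where
  "tangent_frame x B \<longleftrightarrow>
     pairwise orthogonal B \<and> (\<forall>e\<in>B. norm e = 1) \<and> span B = {v. x \<bullet> v = 0}"

text \<open>The derivative within \<open>S2\<close> is a linear map on all of \<open>real ^ 3\<close>, but only its restriction to
  the tangent space of $S^2$ at \<open>x\<close> is determined by \<open>\<phi>\<close>; it is evaluated only there.\<close>

definition differential :: "(real ^ 3 \<Rightarrow> real ^ 'm) \<Rightarrow> real ^ 3 \<Rightarrow> real ^ 3 \<Rightarrow> real ^ 'm" where
  "differential \<phi> x = frechet_derivative \<phi> (at x within S2)"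

text \<open>The value does not depend on the chosen orthonormal frame.\<close>

definition norm_differential_sq :: "(real ^ 3 \<Rightarrow> real ^ 'm) \<Rightarrow> real ^ 3 \<Rightarrow> real" where
  "norm_differential_sq \<phi> x = (\<Sum>e \<in> (SOME B. tangent_frame x B). (norm (differential \<phi> x e))\<^sup>2)"

definition energy :: "(real ^ 3 \<Rightarrow> real ^ 'm) \<Rightarrow> real" where
  "energy \<phi> = 1 / 2 * S2_integral (norm_differential_sq \<phi>)"


section \<open>Harmonic maps from the 2-sphere to a sphere\<close>

definition smooth_variation ::
  "real \<Rightarrow> (real ^ 3 \<Rightarrow> real ^ 'm) \<Rightarrow> (real \<Rightarrow> real ^ 3 \<Rightarrow> real ^ 'm) \<Rightarrow> bool" where
  "smooth_variation \<epsilon> \<phi> \<Phi> \<longleftrightarrow>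
     \<epsilon> > 0 \<and> smooth_map (S2 \<times> {-\<epsilon><..<\<epsilon>}) (sphere 0 1) (\<lambda>(x, t). \<Phi> t x) \<and>
     (\<forall>x\<in>S2. \<Phi> 0 x = \<phi> x)"

definition harmonic_map :: "(real ^ 3 \<Rightarrow> real ^ 'm) \<Rightarrow> bool" where
  "harmonic_map \<phi> \<longleftrightarrow>
     smooth_map S2 (sphere 0 1) \<phi> \<and>
     (\<forall>\<epsilon> \<Phi>. smooth_variation \<epsilon> \<phi> \<Phi> \<longrightarrow>
        ((\<lambda>t. energy (\<Phi> t)) has_real_derivative 0) (at 0))"

definition full_map :: "(real ^ 3 \<Rightarrow> real ^ 'm) \<Rightarrow> bool" where
  "full_map \<phi> \<longleftrightarrow> \<not> (\<exists>a. a \<noteq> 0 \<and> \<phi> ` S2 \<subseteq> {y \<in> sphere 0 1. a \<bullet> y = 0})"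

text \<open>The degree is that of the composition with a totally geodesic inclusion into $S^4$, that is, with
  the restriction of a linear isometric embedding into \<open>real ^ 5\<close>. For \<open>CARD('m) = 5\<close> this is
  an isometry of $S^4$, which does not affect the energy.\<close>

definition has_twistor_degree :: "(real ^ 3 \<Rightarrow> real ^ 'm) \<Rightarrow> nat \<Rightarrow> bool" where
  "has_twistor_degree \<phi> d \<longleftrightarrow>
     (\<exists>\<iota> :: real ^ 'm \<Rightarrow> real ^ 5. linear \<iota> \<and> (\<forall>y. norm (\<iota> y) = norm y) \<and>
        energy (\<iota> \<circ> \<phi>) = 4 * pi * real d)"


section \<open>Jacobi fields\<close>

text \<open>Smooth sections of the pullback of the tangent bundle of the sphere. They are extended by \<open>0\<close>
  off \<open>S2\<close>, so that equal sections are equal functions.\<close>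

definition pullback_sections :: "(real ^ 3 \<Rightarrow> real ^ 'm) \<Rightarrow> (real ^ 3 \<Rightarrow> real ^ 'm) set" where
  "pullback_sections \<phi> =
     {v. smooth_on S2 v \<and> (\<forall>x\<in>S2. \<phi> x \<bullet> v x = 0) \<and> (\<forall>x. x \<notin> S2 \<longrightarrow> v x = 0)}"

definition tangent_to ::
  "(real \<Rightarrow> real ^ 3 \<Rightarrow> real ^ 'm) \<Rightarrow> (real ^ 3 \<Rightarrow> real ^ 'm) \<Rightarrow> bool" where
  "tangent_to \<Phi> v \<longleftrightarrow> (\<forall>x\<in>S2. ((\<lambda>t. \<Phi> t x) has_vector_derivative v x) (at 0))"

definition smooth_variation2 ::
  "real \<Rightarrow> (real ^ 3 \<Rightarrow> real ^ 'm) \<Rightarrow> (real \<Rightarrow> real \<Rightarrow> real ^ 3 \<Rightarrow> real ^ 'm) \<Rightarrow> bool" where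
  "smooth_variation2 \<epsilon> \<phi> \<Phi> \<longleftrightarrow>
     \<epsilon> > 0 \<and>
     smooth_map (S2 \<times> {-\<epsilon><..<\<epsilon>} \<times> {-\<epsilon><..<\<epsilon>}) (sphere 0 1) (\<lambda>(x, t, s). \<Phi> t s x) \<and>
     (\<forall>x\<in>S2. \<Phi> 0 0 x = \<phi> x)"

text \<open>The Jacobi operator along a harmonic map: \<open>jacobi_operator \<phi> v\<close> is the section determined by
  the second variation of the energy.\<close>

definition jacobi_operator :: 
  "(real ^ 3 \<Rightarrow> real ^ 'm) \<Rightarrow> (real ^ 3 \<Rightarrow> real ^ 'm) \<Rightarrow> (real ^ 3 \<Rightarrow> real ^ 'm)" where
  "jacobi_operator \<phi> v = (THE u. u \<in> pullback_sections \<phi> \<and>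
     (\<forall>w \<in> pullback_sections \<phi>. \<forall>\<epsilon> \<Phi>.
        smooth_variation2 \<epsilon> \<phi> \<Phi> \<and> tangent_to (\<lambda>t. \<Phi> t 0) v \<and> tangent_to (\<lambda>s. \<Phi> 0 s) w \<longrightarrow>
        ((\<lambda>t. deriv (\<lambda>s. energy (\<Phi> t s)) 0) has_real_derivative
           S2_integral (\<lambda>x. u x \<bullet> w x)) (at 0)))"

definition jacobi_field :: "(real ^ 3 \<Rightarrow> real ^ 'm) \<Rightarrow> (real ^ 3 \<Rightarrow> real ^ 'm) \<Rightarrow> bool" where
  "jacobi_field \<phi> v \<longleftrightarrow> v \<in> pullback_sections \<phi> \<and> jacobi_operator \<phi> v = (\<lambda>x. 0)"

definition integrable_jacobi_field ::
  "(real ^ 3 \<Rightarrow> real ^ 'm) \<Rightarrow> (real ^ 3 \<Rightarrow> real ^ 'm) \<Rightarrow> bool" where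
  "integrable_jacobi_field \<phi> v \<longleftrightarrow>
     jacobi_field \<phi> v \<and>
     (\<exists>\<epsilon> \<Phi>. smooth_variation \<epsilon> \<phi> \<Phi> \<and> tangent_to \<Phi> v \<and> (\<forall>t\<in>{-\<epsilon><..<\<epsilon>}. harmonic_map (\<Phi> t)))"

end

theory Submission
  imports Defs "HOL-Complex_Analysis.Complex_Analysis" "HOL-Real_Asymp.Real_Asymp"
begin

text \<open>The map is a holomorphic map \<open>f : S\<^sup>2 \<rightarrow> S\<^sup>2\<close> of degree \<open>d\<close>, namely \<open>f = (z\<^sup>d + 1) / z\<close>, followed by a
  totally geodesic inclusion. The field is \<open>u e\<close>, where \<open>e\<close> is a constant unit vector normal to the image
  and \<open>\<Delta>u + |df|\<^sup>2 u = 0\<close>; for this \<open>f\<close> and \<open>d \<ge> 3\<close> there is a solution \<open>u\<close> outside the span of the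
  components of \<open>f\<close>.

  Harmonic maps \<open>\<phi>\<close> of the 2-sphere into spheres satisfy
  \<open>\<langle>\<phi>\<^sub>z, \<phi>\<^sub>z\<rangle> = \<langle>\<phi>\<^sub>z, \<phi>\<^sub>z\<^sub>z\<rangle> = \<langle>\<phi>\<^sub>z\<^sub>z, \<phi>\<^sub>z\<^sub>z\<rangle> = 0\<close>, because holomorphic differentials on the sphere vanish. For the given map,
  \<open>\<phi>\<^sub>z\<^sub>z = \<mu> \<phi>\<^sub>z\<close> for a function \<open>\<mu>\<close>. Along a variation \<open>\<phi>\<^sub>t\<close> through harmonic maps, \<open>\<partial>\<^sub>z\<^sub>z \<phi>\<^sub>t - \<mu> \<partial>\<^sub>z \<phi>\<^sub>t\<close> is therefore
  isotropic for all \<open>t\<close> and zero at \<open>t = 0\<close>, so its \<open>t\<close>-derivative at \<open>0\<close> is isotropic as well. If the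
  variation is tangent to \<open>u e\<close> this says \<open>(u\<^sub>z\<^sub>z - \<mu> u\<^sub>z)\<^sup>2 = 0\<close>, which fails at \<open>z = 1\<close>.

  All analysis on the sphere is done with extensions to \<open>\<real>\<^sup>3 - {0}\<close> that are constant along rays: for these
  the Laplacian and the energy density of the sphere are the Euclidean ones.\<close>

text \<open>For holomorphic f and k with h' = k f', the function w = k - 2 cnj(f) h / (1 + |f|^2)
  satisfies the linear equation of the field away from poles, and so does Re w; constant k gives
  back combinations of the components of f. With k = 1/z and f = z^(d-1) + 1/z the poles at 0
  cancel, and h' = (d-1) z^(d-3) - z^(-3) has a single-valued primitive because d >= 3; for d = 2 a
  logarithm would appear. The relation phi_zz = mu phi_z holds because phi_z is the scalar f' / (1 +
  |f|^2)^2 times an antiholomorphic vector; mu is the logarithmic z-derivative of that scalar. For u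
  = Re w one finds u_zz - mu u_z = f' (k' / f')' / 2, which here is d (d-1) z^(d-3) / (2 ((d-1) z^d
  - 1)) and does not vanish at z = 1. Since the Jacobi operator is given by a definite description,
  certifying the field takes two arguments: the zero section fits the description, and no other
  section does.\<close>

section \<open>Smoothness through iterated directional derivatives\<close>

definition dderiv :: "'a::euclidean_space \<Rightarrow> ('a \<Rightarrow> 'b::real_normed_vector) \<Rightarrow> 'a \<Rightarrow> 'b" where
  "dderiv v f x = frechet_derivative f (at x) v"

definition Cinf :: "'a::euclidean_space set \<Rightarrow> ('a \<Rightarrow> 'b::real_normed_vector) \<Rightarrow> bool" where
  "Cinf U f \<longleftrightarrow> (\<forall>k. C_on k U f)"

lemma dderiv_eqI: "(f has_derivative f') (at x) \<Longrightarrow> dderiv v f x = f' v"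
  unfolding dderiv_def by (metis frechet_derivative_at)

lemma C_on_Suc: "C_on (Suc k) U f \<longleftrightarrow> (\<forall>x\<in>U. f differentiable at x) \<and> (\<forall>v. C_on k U (dderiv v f))"
  by (simp add: dderiv_def[abs_def])

text \<open>The defining equation would unfold into \<open>frechet_derivative\<close>;
  \<open>C_on_Suc\<close> keeps iterated derivatives in the form \<open>dderiv v f\<close>.\<close>

declare C_on.simps(2) [simp del]

lemma C_on_SucI:
  assumes "\<And>x. x \<in> U \<Longrightarrow> f differentiable at x" "\<And>v. C_on k U (dderiv v f)"
  shows "C_on (Suc k) U f"
  using assms by (simp add: C_on_Suc)

lemma C_on_SucD: "C_on (Suc k) U f \<Longrightarrow> C_on k U f"
proof (induction k arbitrary: f)
  case 0
  then show ?case
    by (auto simp: C_on_Suc intro!: continuous_at_imp_continuous_on differentiable_imp_continuous_within)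
next
  case (Suc k)
  then show ?case
    by (metis C_on_Suc)
qed

lemma C_on_subset: "C_on k U f \<Longrightarrow> V \<subseteq> U \<Longrightarrow> C_on k V f"
proof (induction k arbitrary: f)
  case 0
  then show ?case by (auto intro: continuous_on_subset)
next
  case (Suc k)
  then show ?case
    unfolding C_on_Suc by blast
qed

lemma C_on_cong:
  assumes "open U" "C_on k U f" "\<And>x. x \<in> U \<Longrightarrow> f x = g x"
  shows "C_on k U g"
  using assms(2,3)
proof (induction k arbitrary: f g)
  case 0
  then show ?case by (simp cong: continuous_on_cong)
next
  case (Suc k)
  have d: "(g has_derivative frechet_derivative f (at x)) (at x)" if "x \<in> U" for x
    using Suc.prems that \<open>open U\<close>
    by (auto simp: C_on_Suc frechet_derivative_works intro: has_derivative_transform_within_open)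
  have "dderiv v f x = dderiv v g x" if "x \<in> U" for x v
    using dderiv_eqI[OF d[OF that]] by (simp add: dderiv_def)
  then have "C_on k U (dderiv v g)" for v
    using Suc.IH[of "dderiv v f" "dderiv v g"] Suc.prems by (simp add: C_on_Suc)
  then show ?case
    using d differentiableI by (intro C_on_SucI) blast+
qed

lemma C_on_local:
  assumes "\<And>x. x \<in> U \<Longrightarrow> \<exists>V. open V \<and> x \<in> V \<and> C_on k V f"
  shows "C_on k U f"
  using assms
proof (induction k arbitrary: f)
  case 0
  show ?case
    unfolding C_on.simps(1)
  proof (rule continuous_at_imp_continuous_on, rule ballI)
    fix x assume "x \<in> U"
    then show "isCont f x" using 0 by (metis C_on.simps(1) continuous_on_eq_continuous_at)
  qed
next
  case (Suc k)
  show ?case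
  proof (rule C_on_SucI)
    show "f differentiable at x" if "x \<in> U" for x
      using Suc.prems[OF that] by (auto simp: C_on_Suc)
    show "C_on k U (dderiv v f)" for v
      using Suc.prems by (intro Suc.IH) (meson C_on_Suc)
  qed
qed

lemma C_on_const [simp]: "C_on k U (\<lambda>x. c)"
proof (induction k arbitrary: c)
  case (Suc k)
  have "dderiv v (\<lambda>x. c) = (\<lambda>x. 0)" for v :: 'a
    by (auto simp: dderiv_def)
  then show ?case using Suc by (auto intro!: C_on_SucI)
qed simp

lemma C_on_bounded_linear:
  assumes "bounded_linear T"
  shows "C_on k U T"
proof (cases k)
  case 0
  then show ?thesis using assms by (simp add: linear_continuous_on)
next
  case (Suc k')
  have "(T has_derivative T) (at x)" for x
    by (rule bounded_linear_imp_has_derivative[OF assms])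
  then have "dderiv v T = (\<lambda>x. T v)" for v
    using dderiv_eqI by blast
  then show ?thesis
    using Suc bounded_linear_imp_differentiable[OF assms] by (auto intro!: C_on_SucI)
qed

text \<open>Inductions on the order need the derivative as an explicit expression. Such an
  expression agrees with \<open>dderiv v f\<close> only on \<open>U\<close>, which suffices by
  \<open>C_on_cong\<close>.\<close>

lemma C_on_Suc_via:
  assumes "open U" "\<And>x. x \<in> U \<Longrightarrow> (f has_derivative (\<lambda>v. f' v x)) (at x)" "\<And>v. C_on k U (f' v)"
  shows "C_on (Suc k) U f"
proof (rule C_on_SucI)
  show "f differentiable at x" if "x \<in> U" for x
    using assms(2)[OF that] by (auto simp: differentiable_def)
  show "C_on k U (dderiv v f)" for v
    using assms(2) by (intro C_on_cong[OF assms(1) assms(3)[of v]]) (metis dderiv_eqI)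
qed

lemma C_on_has_derivative:
  "C_on (Suc k) U f \<Longrightarrow> x \<in> U \<Longrightarrow> (f has_derivative (\<lambda>v. dderiv v f x)) (at x)"
  by (simp add: C_on_Suc frechet_derivative_works dderiv_def)

lemma C_on_add:
  assumes "open U" "C_on k U f" "C_on k U g"
  shows "C_on k U (\<lambda>x. f x + g x)"
  using assms(2,3)
proof (induction k arbitrary: f g)
  case (Suc k)
  show ?case
  proof (rule C_on_Suc_via[OF assms(1), where f' = "\<lambda>v x. dderiv v f x + dderiv v g x"])
    show "C_on k U (\<lambda>x. dderiv v f x + dderiv v g x)" for v
      using Suc by (simp add: C_on_Suc)
  qed (auto intro!: derivative_eq_intros C_on_has_derivative Suc.prems)
qed (auto intro: continuous_on_add)

lemma C_on_sum:
  assumes "open U" "\<And>i. i \<in> I \<Longrightarrow> C_on k U (f i)"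
  shows "C_on k U (\<lambda>x. \<Sum>i\<in>I. f i x)"
  using assms(2)
proof (induction I rule: infinite_finite_induct)
  case (insert i I)
  then show ?case using C_on_add[OF assms(1), of k "f i" "\<lambda>x. \<Sum>i\<in>I. f i x"] by simp
qed simp_all

lemma C_on_bounded_linear_compose:
  assumes T: "bounded_linear T" and "open U" "C_on k U f"
  shows "C_on k U (\<lambda>x. T (f x))"
  using assms(3)
proof (induction k arbitrary: f)
  case 0
  then show ?case by (auto intro: bounded_linear.continuous_on[OF T])
next
  case (Suc k)
  show ?case
  proof (rule C_on_Suc_via[OF assms(2), where f' = "\<lambda>v x. T (dderiv v f x)"])
    show "C_on k U (\<lambda>x. T (dderiv v f x))" for v
      using Suc by (simp add: C_on_Suc)
  qed (auto intro!: bounded_linear.has_derivative[OF T] C_on_has_derivative Suc.prems)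
qed

lemma C_on_bounded_bilinear:
  assumes B: "bounded_bilinear B" and "open U" "C_on k U f" "C_on k U g"
  shows "C_on k U (\<lambda>x. B (f x) (g x))"
  using assms(3,4)
proof (induction k arbitrary: f g)
  case 0
  then show ?case by (auto intro: bounded_bilinear.continuous_on[OF B])
next
  case (Suc k)
  show ?case
  proof (rule C_on_Suc_via[OF assms(2), where f' = "\<lambda>v x. B (f x) (dderiv v g x) + B (dderiv v f x) (g x)"])
    show "C_on k U (\<lambda>x. B (f x) (dderiv v g x) + B (dderiv v f x) (g x))" for v
      using Suc.prems C_on_SucD[OF Suc.prems(1)] C_on_SucD[OF Suc.prems(2)]
      by (intro C_on_add[OF assms(2)] Suc.IH) (auto simp: C_on_Suc)
  qed (auto intro!: bounded_bilinear.FDERIV[OF B] C_on_has_derivative Suc.prems)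
qed

lemma C_on_compose:
  fixes g :: "'a::euclidean_space \<Rightarrow> 'b::euclidean_space" and f :: "'b \<Rightarrow> 'c::real_normed_vector"
  assumes "open U" "open V" "g ` U \<subseteq> V" "C_on k V f" "C_on k U g"
  shows "C_on k U (\<lambda>x. f (g x))"
  using assms(4,5)
proof (induction k arbitrary: f)
  case 0
  then show ?case
    using assms(3) by (auto intro: continuous_on_compose2)
next
  case (Suc k)
  \<comment> \<open>The chain rule yields a derivative of \<open>f\<close> in the varying direction
    \<open>dderiv v g x\<close>. Expanding this direction in the basis leaves derivatives in fixed
    directions, composed with \<open>g\<close>, to which the induction hypothesis applies.\<close>
  let ?f' = "\<lambda>v x. \<Sum>b\<in>Basis. (dderiv v g x \<bullet> b) *\<^sub>R dderiv b f (g x)"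
  show ?case
  proof (rule C_on_Suc_via[OF assms(1), where f' = ?f'])
    show "C_on k U (?f' v)" for v
    proof (intro C_on_sum assms(1) C_on_bounded_bilinear[OF bounded_bilinear_scaleR])
      fix b :: 'b assume "b \<in> Basis"
      show "C_on k U (\<lambda>x. dderiv v g x \<bullet> b)"
        by (rule C_on_bounded_linear_compose[OF bounded_linear_inner_left assms(1)])
          (use Suc.prems in \<open>simp add: C_on_Suc\<close>)
      show "C_on k U (\<lambda>x. dderiv b f (g x))"
        by (rule Suc.IH) (use Suc.prems C_on_SucD in \<open>auto simp: C_on_Suc\<close>)
    qed
    fix x assume x: "x \<in> U"
    then have df: "(f has_derivative (\<lambda>w. dderiv w f (g x))) (at (g x))"
      using assms(3) Suc.prems by (auto intro: C_on_has_derivative)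
    have "((\<lambda>x. f (g x)) has_derivative (\<lambda>v. dderiv (dderiv v g x) f (g x))) (at x)"
      using has_derivative_compose[OF C_on_has_derivative[OF Suc.prems(2) x] df] by simp
    moreover have "dderiv w f (g x) = (\<Sum>b\<in>Basis. (w \<bullet> b) *\<^sub>R dderiv b f (g x))" for w
    proof -
      have "linear (\<lambda>w. dderiv w f (g x))"
        using df has_derivative_linear by blast
      then show ?thesis
        using linear_sum[of "\<lambda>w. dderiv w f (g x)" "\<lambda>b. (w \<bullet> b) *\<^sub>R b" Basis]
          linear_scale[of "\<lambda>w. dderiv w f (g x)"]
        by (simp add: euclidean_representation)
    qed
    then have "(\<lambda>v. dderiv (dderiv v g x) f (g x)) = (\<lambda>v. ?f' v x)" by blast
    ultimately show "((\<lambda>x. f (g x)) has_derivative (\<lambda>v. ?f' v x)) (at x)" by metis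
  qed
qed

text \<open>Real powers are closed under differentiation, so the induction runs over all exponents
  at once. Logarithm, inverse and \<open>sgn\<close> are reduced to this case.\<close>

lemma C_on_powr: "C_on k {0<..} (\<lambda>s::real. s powr p)"
proof (induction k arbitrary: p)
  case 0
  then show ?case by (auto intro!: continuous_intros)
next
  case (Suc k)
  show ?case
  proof (rule C_on_Suc_via[where f' = "\<lambda>v s. (v * p) * s powr (p - 1)"])
    show "C_on k {0<..} (\<lambda>s. (v * p) * s powr (p - 1))" for v
      by (rule C_on_bounded_linear_compose[OF bounded_linear_mult_right _ Suc]) simp
    show "((\<lambda>s. s powr p) has_derivative (\<lambda>v. (v * p) * x powr (p - 1))) (at x)" if "x \<in> {0<..}" for x
      by (rule has_derivative_eq_rhs[OF has_real_derivative_powr[unfolded has_field_derivative_def]])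
        (use that in auto)
  qed auto
qed

lemma C_on_ln: "C_on k {0<..} (ln :: real \<Rightarrow> real)"
proof (cases k)
  case 0
  then show ?thesis by (auto intro!: continuous_intros)
next
  case (Suc k)
  have "C_on (Suc k) {0<..} (ln :: real \<Rightarrow> real)"
  proof (rule C_on_Suc_via[where f' = "\<lambda>v s. v * s powr (- 1)"])
    show "C_on k {0<..} (\<lambda>s. v * s powr (- 1))" for v :: real
      by (rule C_on_bounded_linear_compose[OF bounded_linear_mult_right _ C_on_powr]) simp
    show "(ln has_derivative (\<lambda>v. v * x powr (- 1))) (at x)" if "x \<in> {0<..}" for x :: real
      by (rule has_derivative_eq_rhs[OF DERIV_ln[unfolded has_field_derivative_def]])
        (use that in \<open>auto simp: powr_minus\<close>)
  qed auto
  then show ?thesis using Suc by simp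
qed

lemma C_on_Pair:
  fixes f :: "'a::euclidean_space \<Rightarrow> 'b::real_normed_vector" and g :: "'a \<Rightarrow> 'c::real_normed_vector"
  assumes "open U" "C_on k U f" "C_on k U g"
  shows "C_on k U (\<lambda>x. (f x, g x))"
proof -
  have b: "bounded_linear (\<lambda>y::'b. (y, 0::'c))" "bounded_linear (\<lambda>y::'c. (0::'b, y))"
    by (intro bounded_linear_Pair bounded_linear_ident bounded_linear_zero)+
  have "C_on k U (\<lambda>x. (f x, 0) + (0, g x))"
    by (rule C_on_add[OF assms(1) C_on_bounded_linear_compose[OF b(1) assms(1,2)]
          C_on_bounded_linear_compose[OF b(2) assms(1,3)]])
  then show ?thesis by simp
qed


lemma Cinf_subset: "Cinf U f \<Longrightarrow> V \<subseteq> U \<Longrightarrow> Cinf V f"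
  unfolding Cinf_def using C_on_subset by blast

lemma Cinf_cong: "open U \<Longrightarrow> Cinf U f \<Longrightarrow> (\<And>x. x \<in> U \<Longrightarrow> f x = g x) \<Longrightarrow> Cinf U g"
  unfolding Cinf_def using C_on_cong by blast

lemma Cinf_local:
  "(\<And>x. x \<in> U \<Longrightarrow> \<exists>V. open V \<and> x \<in> V \<and> Cinf V f) \<Longrightarrow> Cinf U f"
  unfolding Cinf_def by (meson C_on_local)

lemma Cinf_dderiv: "Cinf U f \<Longrightarrow> Cinf U (dderiv v f)"
  unfolding Cinf_def by (meson C_on_Suc)

lemma Cinf_has_derivative:
  "Cinf U f \<Longrightarrow> x \<in> U \<Longrightarrow> (f has_derivative (\<lambda>v. dderiv v f x)) (at x)"
  unfolding Cinf_def using C_on_has_derivative by blast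

lemma Cinf_continuous_on: "Cinf U f \<Longrightarrow> continuous_on U f"
  unfolding Cinf_def using C_on.simps(1) by blast

named_theorems Cinf_intros

lemma Cinf_const [Cinf_intros, simp]: "Cinf U (\<lambda>x. c)"
  by (simp add: Cinf_def)

lemma Cinf_linear: "bounded_linear T \<Longrightarrow> Cinf U T"
  by (simp add: Cinf_def C_on_bounded_linear)

lemma Cinf_ident [Cinf_intros]: "Cinf U (\<lambda>x. x)"
  by (rule Cinf_linear) simp

lemma Cinf_linear_compose: "bounded_linear T \<Longrightarrow> open U \<Longrightarrow> Cinf U f \<Longrightarrow> Cinf U (\<lambda>x. T (f x))"
  by (simp add: Cinf_def C_on_bounded_linear_compose)

lemma Cinf_add [Cinf_intros]: "open U \<Longrightarrow> Cinf U f \<Longrightarrow> Cinf U g \<Longrightarrow> Cinf U (\<lambda>x. f x + g x)"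
  by (simp add: Cinf_def C_on_add)

lemma Cinf_minus [Cinf_intros]: "open U \<Longrightarrow> Cinf U f \<Longrightarrow> Cinf U (\<lambda>x. - f x)"
  by (rule Cinf_linear_compose[OF bounded_linear_minus[OF bounded_linear_ident]])

lemma Cinf_diff [Cinf_intros]: "open U \<Longrightarrow> Cinf U f \<Longrightarrow> Cinf U g \<Longrightarrow> Cinf U (\<lambda>x. f x - g x)"
  using Cinf_add[of U f "\<lambda>x. - g x"] Cinf_minus by auto

lemma Cinf_sum [Cinf_intros]:
  "open U \<Longrightarrow> (\<And>i. i \<in> I \<Longrightarrow> Cinf U (f i)) \<Longrightarrow> Cinf U (\<lambda>x. \<Sum>i\<in>I. f i x)"
  by (simp add: Cinf_def C_on_sum)

lemma Cinf_bilinear: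
  "bounded_bilinear B \<Longrightarrow> open U \<Longrightarrow> Cinf U f \<Longrightarrow> Cinf U g \<Longrightarrow> Cinf U (\<lambda>x. B (f x) (g x))"
  by (simp add: Cinf_def C_on_bounded_bilinear)

lemmas Cinf_scaleR [Cinf_intros] = Cinf_bilinear[OF bounded_bilinear_scaleR]
  and Cinf_mult [Cinf_intros] = Cinf_bilinear[OF bounded_bilinear_mult]
  and Cinf_inner [Cinf_intros] = Cinf_bilinear[OF bounded_bilinear_inner]

lemmas Cinf_fst [Cinf_intros] = Cinf_linear_compose[OF bounded_linear_fst]
  and Cinf_snd [Cinf_intros] = Cinf_linear_compose[OF bounded_linear_snd]
  and Cinf_cnj [Cinf_intros] = Cinf_linear_compose[OF bounded_linear_cnj]
  and Cinf_Re [Cinf_intros] = Cinf_linear_compose[OF bounded_linear_Re]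
  and Cinf_Im [Cinf_intros] = Cinf_linear_compose[OF bounded_linear_Im]
  and Cinf_of_real [Cinf_intros] = Cinf_linear_compose[OF bounded_linear_of_real]
  and Cinf_vec_nth [Cinf_intros] = Cinf_linear_compose[OF bounded_linear_vec_nth]

lemma Cinf_power [Cinf_intros]:
  fixes f :: "'a::euclidean_space \<Rightarrow> 'b::{real_normed_algebra_1}"
  shows "open U \<Longrightarrow> Cinf U f \<Longrightarrow> Cinf U (\<lambda>x. f x ^ n)"
  by (induction n) (simp_all add: Cinf_mult)

lemma Cinf_Pair [Cinf_intros]: "open U \<Longrightarrow> Cinf U f \<Longrightarrow> Cinf U g \<Longrightarrow> Cinf U (\<lambda>x. (f x, g x))"
  by (simp add: Cinf_def C_on_Pair)

lemma Cinf_compose: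
  fixes g :: "'a::euclidean_space \<Rightarrow> 'b::euclidean_space"
  assumes "open U" "open V" "g ` U \<subseteq> V" "Cinf V f" "Cinf U g"
  shows "Cinf U (\<lambda>x. f (g x))"
  unfolding Cinf_def
proof
  show "C_on k U (\<lambda>x. f (g x))" for k
    by (rule C_on_compose[OF assms(1-3)]) (use assms(4,5) in \<open>simp_all add: Cinf_def\<close>)
qed

lemma Cinf_powr [Cinf_intros]:
  assumes "open U" "Cinf U f" "\<And>x. x \<in> U \<Longrightarrow> (f x :: real) > 0"
  shows "Cinf U (\<lambda>x. f x powr p)"
  by (rule Cinf_compose[where V = "{0<..}" and f = "\<lambda>s. s powr p"])
    (use assms in \<open>auto simp: Cinf_def C_on_powr\<close>)

lemma Cinf_ln [Cinf_intros]:
  assumes "open U" "Cinf U f" "\<And>x. x \<in> U \<Longrightarrow> (f x :: real) > 0"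
  shows "Cinf U (\<lambda>x. ln (f x))"
  by (rule Cinf_compose[where V = "{0<..}" and f = ln]) (use assms in \<open>auto simp: Cinf_def C_on_ln\<close>)

lemma Cinf_inverse_pos [Cinf_intros]:
  assumes "open U" "Cinf U f" "\<And>x. x \<in> U \<Longrightarrow> (f x :: real) > 0"
  shows "Cinf U (\<lambda>x. inverse (f x))"
  by (rule Cinf_cong[OF assms(1) Cinf_powr[OF assms, of "- 1"]])
    (use assms(3) in \<open>auto simp: powr_minus less_imp_le\<close>)

lemma Cinf_sgn [Cinf_intros]:
  assumes "open U" "Cinf U f" "\<And>x. x \<in> U \<Longrightarrow> f x \<noteq> (0::'b::euclidean_space)"
  shows "Cinf U (\<lambda>x. sgn (f x))"
proof -
  have "Cinf U (\<lambda>x. ((f x \<bullet> f x) powr (- 1/2)) *\<^sub>R f x)"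
    using assms by (intro Cinf_intros) auto
  then show ?thesis
  proof (rule Cinf_cong[OF assms(1)])
    fix x assume "x \<in> U"
    have "(f x \<bullet> f x) powr (- 1/2) = inverse (norm (f x))"
      by (simp add: powr_minus powr_half_sqrt norm_eq_sqrt_inner)
    then show "((f x \<bullet> f x) powr (- 1/2)) *\<^sub>R f x = sgn (f x)"
      by (simp add: sgn_div_norm)
  qed
qed

section \<open>Smooth maps on arbitrary subsets\<close>

lemma smooth_on_Cinf:
  "smooth_on S f \<longleftrightarrow> (\<forall>x\<in>S. \<exists>U F. open U \<and> x \<in> U \<and> Cinf U F \<and> (\<forall>y\<in>S \<inter> U. F y = f y))"
  by (simp add: smooth_on_def Cinf_def)

lemma Cinf_imp_smooth_on: "open U \<Longrightarrow> S \<subseteq> U \<Longrightarrow> Cinf U f \<Longrightarrow> smooth_on S f"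
  unfolding smooth_on_Cinf by blast

text \<open>A map on \<open>S\<close> has only local extensions, but these agree with it on the
  values of \<open>g\<close>, so the composition is smooth on an open set outright. With
  \<open>g\<close> built from \<open>sgn\<close> or \<open>stereo_inv\<close>, smoothness on the
  sphere becomes smoothness on open sets.\<close>

lemma Cinf_smooth_on_compose:
  fixes g :: "'a::euclidean_space \<Rightarrow> 'b::euclidean_space"
  assumes "smooth_on S f" "open U" "Cinf U g" "g ` U \<subseteq> S"
  shows "Cinf U (\<lambda>x. f (g x))"
proof (rule Cinf_local)
  fix x assume x: "x \<in> U"
  then have "g x \<in> S" using assms(4) by blast
  then obtain V F where V: "open V" "g x \<in> V" "Cinf V F" "\<forall>y\<in>S \<inter> V. F y = f y"
    using bspec[OF assms(1)[unfolded smooth_on_Cinf]] by blast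
  define W where "W = U \<inter> g -` V"
  have W: "open W"
    unfolding W_def by (rule continuous_open_preimage[OF Cinf_continuous_on[OF assms(3)] assms(2) V(1)])
  have "Cinf W (\<lambda>x. F (g x))"
    by (rule Cinf_compose[OF W V(1) _ V(3) Cinf_subset[OF assms(3)]]) (auto simp: W_def)
  then have "Cinf W (\<lambda>x. f (g x))"
    by (rule Cinf_cong[OF W]) (use V(4) assms(4) in \<open>auto simp: W_def\<close>)
  then show "\<exists>V. open V \<and> x \<in> V \<and> Cinf V (\<lambda>x. f (g x))"
    using W x V(2) W_def by blast
qed

lemma smooth_on_transfer:
  assumes f: "smooth_on S f" and TS: "T \<subseteq> S" and eq: "\<And>x. x \<in> T \<Longrightarrow> f x = g x"
  shows "smooth_on T g"
  unfolding smooth_on_Cinf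
proof
  fix x assume "x \<in> T"
  with TS have "x \<in> S" by blast
  then obtain U F where U: "open U" "x \<in> U" "Cinf U F" "\<forall>y\<in>S \<inter> U. F y = f y"
    using bspec[OF f[unfolded smooth_on_Cinf]] by blast
  then have "\<forall>y\<in>T \<inter> U. F y = g y" using TS eq by auto
  with U(1-3) show "\<exists>U F. open U \<and> x \<in> U \<and> Cinf U F \<and> (\<forall>y\<in>T \<inter> U. F y = g y)"
    by blast
qed

lemmas smooth_on_cong = smooth_on_transfer[OF _ order_refl]

section \<open>Rules for directional derivatives\<close>

lemma linear_dderiv:
  assumes "Cinf U f" "x \<in> U"
  shows "linear (\<lambda>v. dderiv v f x)"
  using Cinf_has_derivative[OF assms] has_derivative_linear by blast

lemma dderiv_expand:
  assumes "Cinf U f" "x \<in> U"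
  shows "dderiv v f x = (\<Sum>b\<in>Basis. (v \<bullet> b) *\<^sub>R dderiv b f x)"
proof -
  have "dderiv v f x = dderiv (\<Sum>b\<in>Basis. (v \<bullet> b) *\<^sub>R b) f x"
    by (simp only: euclidean_representation)
  also have "\<dots> = (\<Sum>b\<in>Basis. dderiv ((v \<bullet> b) *\<^sub>R b) f x)"
    by (rule linear_sum[OF linear_dderiv[OF assms]])
  also have "\<dots> = (\<Sum>b\<in>Basis. (v \<bullet> b) *\<^sub>R dderiv b f x)"
    by (simp only: linear_scale[OF linear_dderiv[OF assms]])
  finally show ?thesis .
qed

lemma dderiv_cong:
  assumes "open U" "x \<in> U" "\<And>y. y \<in> U \<Longrightarrow> f y = g y" "f differentiable at x"
  shows "dderiv v f x = dderiv v g x"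
  unfolding dderiv_def
  by (subst frechet_derivative_transform_within_open[OF assms(4,1,2,3)]) simp_all

lemma dderiv_bounded_linear:
  assumes "bounded_linear T" "f differentiable at x"
  shows "dderiv v (\<lambda>x. T (f x)) x = T (dderiv v f x)"
  using assms bounded_linear.has_derivative[OF assms(1)]
  by (intro dderiv_eqI) (simp add: frechet_derivative_works dderiv_def)

lemma dderiv_compose:
  assumes "Cinf V f" "g x \<in> V" "g differentiable at x"
  shows "dderiv v (\<lambda>x. f (g x)) x = dderiv (dderiv v g x) f (g x)"
proof -
  have "(g has_derivative (\<lambda>v. dderiv v g x)) (at x)"
    using assms(3) by (simp add: frechet_derivative_works dderiv_def)
  from has_derivative_compose[OF this Cinf_has_derivative[OF assms(1,2)]]
  show ?thesis by (rule dderiv_eqI)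
qed

lemma Cinf_differentiable: "Cinf U f \<Longrightarrow> x \<in> U \<Longrightarrow> f differentiable at x"
  using Cinf_has_derivative differentiable_def by blast

lemma has_derivative_dderiv: "f differentiable at x \<Longrightarrow> (f has_derivative (\<lambda>v. dderiv v f x)) (at x)"
  by (simp add: frechet_derivative_works dderiv_def)

subsection \<open>Symmetry of second derivatives\<close>

lemma dderiv_along_line:
  fixes f :: "'a::euclidean_space \<Rightarrow> real"
  assumes "Cinf U f" "x + s *\<^sub>R a \<in> U"
  shows "((\<lambda>s. f (x + s *\<^sub>R a)) has_real_derivative dderiv a f (x + s *\<^sub>R a)) (at s)"
proof -
  have "((\<lambda>s. x + s *\<^sub>R a) has_derivative (\<lambda>h. h *\<^sub>R a)) (at s)"
    by (auto intro!: derivative_eq_intros)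
  from has_derivative_compose[OF this Cinf_has_derivative[OF assms]]
  have "((\<lambda>s. f (x + s *\<^sub>R a)) has_derivative (\<lambda>h. dderiv (h *\<^sub>R a) f (x + s *\<^sub>R a))) (at s)" .
  then show ?thesis
    unfolding has_field_derivative_def
    by (rule has_derivative_eq_rhs) (simp add: linear_scale[OF linear_dderiv[OF assms]] fun_eq_iff)
qed

text \<open>The mean value theorem is applied twice, first in direction \<open>a\<close> to the
  difference over \<open>h *\<^sub>R b\<close>, then in direction \<open>b\<close>. The left-hand
  side is symmetric in \<open>a\<close> and \<open>b\<close>, which is the point.\<close>

lemma second_difference:
  fixes f :: "'a::euclidean_space \<Rightarrow> real"
  assumes f: "Cinf U f" and "h > 0"
    and U: "\<And>s t. \<lbrakk>0 \<le> s; s \<le> h; 0 \<le> t; t \<le> h\<rbrakk> \<Longrightarrow> x + s *\<^sub>R a + t *\<^sub>R b \<in> U"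
  obtains s t where "0 < s" "s < h" "0 < t" "t < h"
    "f (x + h *\<^sub>R a + h *\<^sub>R b) - f (x + h *\<^sub>R a) - f (x + h *\<^sub>R b) + f x =
      h\<^sup>2 * dderiv b (dderiv a f) (x + s *\<^sub>R a + t *\<^sub>R b)"
proof -
  have "\<exists>s. 0 < s \<and> s < h \<and>
     (f ((x + h *\<^sub>R b) + h *\<^sub>R a) - f (x + h *\<^sub>R a)) - (f ((x + h *\<^sub>R b) + 0 *\<^sub>R a) - f (x + 0 *\<^sub>R a)) =
      (h - 0) * (dderiv a f ((x + h *\<^sub>R b) + s *\<^sub>R a) - dderiv a f (x + s *\<^sub>R a))"
  proof (rule MVT2[OF \<open>h > 0\<close>])
    fix s assume s: "0 \<le> s" "s \<le> h"
    have "(x + h *\<^sub>R b) + s *\<^sub>R a \<in> U" "x + s *\<^sub>R a \<in> U"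
      using U[OF s, of h] U[OF s, of 0] \<open>h > 0\<close> by (simp_all add: ac_simps)
    then show "((\<lambda>s. f ((x + h *\<^sub>R b) + s *\<^sub>R a) - f (x + s *\<^sub>R a)) has_real_derivative
        dderiv a f ((x + h *\<^sub>R b) + s *\<^sub>R a) - dderiv a f (x + s *\<^sub>R a)) (at s)"
      by (intro DERIV_diff dderiv_along_line[OF f])
  qed
  then obtain s where s: "0 < s" "s < h"
    and eq1: "(f ((x + h *\<^sub>R b) + h *\<^sub>R a) - f (x + h *\<^sub>R a)) - (f ((x + h *\<^sub>R b) + 0 *\<^sub>R a) - f (x + 0 *\<^sub>R a)) =
      (h - 0) * (dderiv a f ((x + h *\<^sub>R b) + s *\<^sub>R a) - dderiv a f (x + s *\<^sub>R a))"
    by blast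
  have "\<exists>t. 0 < t \<and> t < h \<and>
      dderiv a f ((x + s *\<^sub>R a) + h *\<^sub>R b) - dderiv a f ((x + s *\<^sub>R a) + 0 *\<^sub>R b) =
      (h - 0) * dderiv b (dderiv a f) ((x + s *\<^sub>R a) + t *\<^sub>R b)"
    using U s by (intro MVT2[OF \<open>h > 0\<close>] dderiv_along_line[OF Cinf_dderiv[OF f]]) auto
  then obtain t where t: "0 < t" "t < h" and eq2: "dderiv a f ((x + s *\<^sub>R a) + h *\<^sub>R b) - dderiv a f ((x + s *\<^sub>R a) + 0 *\<^sub>R b) =
      (h - 0) * dderiv b (dderiv a f) ((x + s *\<^sub>R a) + t *\<^sub>R b)"
    by blast
  show ?thesis
    by (rule that[OF s t]) (use eq1 eq2 in \<open>simp add: power2_eq_square ac_simps\<close>)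
qed

text \<open>The same second difference is \<open>h\<^sup>2\<close> times each mixed derivative,
  taken at points near \<open>x\<close>; continuity of both mixed derivatives at \<open>x\<close>
  forces them to agree there.\<close>

lemma dderiv_commute_real:
  fixes f :: "'a::euclidean_space \<Rightarrow> real"
  assumes "open U" and f: "Cinf U f" and x: "x \<in> U"
  shows "dderiv a (dderiv b f) x = dderiv b (dderiv a f) x"
proof (rule ccontr)
  assume neq: "dderiv a (dderiv b f) x \<noteq> dderiv b (dderiv a f) x"
  \<comment> \<open>Half the supposed gap: one common value cannot lie within \<open>e\<close> of
    both mixed derivatives.\<close>
  define e where "e = \<bar>dderiv a (dderiv b f) x - dderiv b (dderiv a f) x\<bar> / 2"
  have "e > 0" using neq by (simp add: e_def)
  have cont: "isCont (dderiv c (dderiv d f)) x" for c d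
    using Cinf_continuous_on[OF Cinf_dderiv[OF Cinf_dderiv[OF f]]] x \<open>open U\<close>
    by (simp add: continuous_on_eq_continuous_at)
  have near: "\<exists>\<delta>>0. \<forall>y. dist y x < \<delta> \<longrightarrow> dist (dderiv c (dderiv d f) y) (dderiv c (dderiv d f) x) < e" for c d
    using cont[of c d] \<open>e > 0\<close> unfolding continuous_at_eps_delta by blast
  obtain \<delta>1 where d1: "\<delta>1 > 0" "\<And>y. dist y x < \<delta>1 \<Longrightarrow> dist (dderiv a (dderiv b f) y) (dderiv a (dderiv b f) x) < e"
    using near[of a b] by blast
  obtain \<delta>2 where d2: "\<delta>2 > 0" "\<And>y. dist y x < \<delta>2 \<Longrightarrow> dist (dderiv b (dderiv a f) y) (dderiv b (dderiv a f) x) < e"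
    using near[of b a] by blast
  obtain r where r: "r > 0" "ball x r \<subseteq> U"
    using \<open>open U\<close> x openE by blast
  define m where "m = min r (min \<delta>1 \<delta>2)"
  \<comment> \<open>With this \<open>h\<close> the whole parallelogram stays within \<open>m\<close>
    of \<open>x\<close>, since h (|a| + |b|) < 2 h N = m. The summand 1 keeps \<open>N\<close>
    positive when \<open>a\<close> and \<open>b\<close> are both 0.\<close>
  define N where "N = norm a + norm b + 1"
  define h where "h = m / (2 * N)"
  have "m > 0" using d1 d2 r by (simp add: m_def)
  have pos: "N > 0" by (simp add: N_def add_nonneg_pos)
  have "h > 0" using \<open>m > 0\<close> pos by (simp add: h_def)
  have dist: "dist (x + s *\<^sub>R c + t *\<^sub>R d) x < m"
    if "0 \<le> s" "s \<le> h" "0 \<le> t" "t \<le> h" "{c, d} = {a, b}" for s t c d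
  proof -
    have "norm c + norm d = norm a + norm b"
      using that(5) by (auto simp: doubleton_eq_iff)
    have "dist (x + s *\<^sub>R c + t *\<^sub>R d) x \<le> s * norm c + t * norm d"
      using norm_triangle_ineq[of "s *\<^sub>R c" "t *\<^sub>R d"] that by (simp add: dist_norm)
    also have "\<dots> \<le> h * norm c + h * norm d"
      using that by (intro add_mono mult_right_mono) auto
    also have "\<dots> = h * (norm a + norm b)"
      using \<open>norm c + norm d = norm a + norm b\<close> by (simp add: distrib_left[symmetric])
    also have "\<dots> < 2 * (h * N)"
      using \<open>h > 0\<close> mult_nonneg_nonneg[OF less_imp_le[OF \<open>h > 0\<close>] norm_ge_zero[of a]]
        mult_nonneg_nonneg[OF less_imp_le[OF \<open>h > 0\<close>] norm_ge_zero[of b]]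
      unfolding N_def distrib_left by linarith
    also have "\<dots> = m"
      using pos by (simp add: h_def)
    finally show ?thesis .
  qed
  have inU: "x + s *\<^sub>R c + t *\<^sub>R d \<in> U"
    if "0 \<le> s" "s \<le> h" "0 \<le> t" "t \<le> h" "{c, d} = {a, b}" for s t c d
    using dist[OF that] r(2) by (auto simp: m_def dist_commute subset_iff)
  obtain s t where st: "0 < s" "s < h" "0 < t" "t < h"
    and 1: "f (x + h *\<^sub>R a + h *\<^sub>R b) - f (x + h *\<^sub>R a) - f (x + h *\<^sub>R b) + f x =
      h\<^sup>2 * dderiv b (dderiv a f) (x + s *\<^sub>R a + t *\<^sub>R b)"
    by (rule second_difference[OF f \<open>h > 0\<close> inU]) auto
  obtain s' t' where st': "0 < s'" "s' < h" "0 < t'" "t' < h"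
    and 2: "f (x + h *\<^sub>R b + h *\<^sub>R a) - f (x + h *\<^sub>R b) - f (x + h *\<^sub>R a) + f x =
      h\<^sup>2 * dderiv a (dderiv b f) (x + s' *\<^sub>R b + t' *\<^sub>R a)"
    by (rule second_difference[OF f \<open>h > 0\<close> inU, of b a]) auto
  have "h\<^sup>2 * dderiv b (dderiv a f) (x + s *\<^sub>R a + t *\<^sub>R b) =
      h\<^sup>2 * dderiv a (dderiv b f) (x + s' *\<^sub>R b + t' *\<^sub>R a)"
    using 1 2[unfolded add.assoc[of x] add.commute[of "h *\<^sub>R b"], folded add.assoc[of x]]
    unfolding add.assoc[of x] by linarith
  then have eq: "dderiv b (dderiv a f) (x + s *\<^sub>R a + t *\<^sub>R b) = dderiv a (dderiv b f) (x + s' *\<^sub>R b + t' *\<^sub>R a)"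
    using \<open>h > 0\<close> by simp
  have "dist (dderiv b (dderiv a f) (x + s *\<^sub>R a + t *\<^sub>R b)) (dderiv b (dderiv a f) x) < e"
    using dist[of s t a b] st by (intro d2(2)) (auto simp: m_def)
  moreover have "dist (dderiv a (dderiv b f) (x + s' *\<^sub>R b + t' *\<^sub>R a)) (dderiv a (dderiv b f) x) < e"
    using dist[of s' t' b a] st' by (intro d1(2)) (auto simp: m_def insert_commute)
  ultimately show False
    using eq dist_triangle3[of "dderiv a (dderiv b f) x" "dderiv b (dderiv a f) x"
        "dderiv b (dderiv a f) (x + s *\<^sub>R a + t *\<^sub>R b)"]
    by (simp add: e_def dist_real_def[of "dderiv a (dderiv b f) x" "dderiv b (dderiv a f) x", symmetric])
qed

lemma dderiv_commute:
  fixes f :: "'a::euclidean_space \<Rightarrow> 'b::euclidean_space"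
  assumes "open U" and f: "Cinf U f" and x: "x \<in> U"
  shows "dderiv a (dderiv b f) x = dderiv b (dderiv a f) x"
proof (rule euclidean_eqI)
  fix e :: 'b assume "e \<in> Basis"
  have 1: "dderiv c f y \<bullet> e = dderiv c (\<lambda>y. f y \<bullet> e) y" if "y \<in> U" for c y
    by (rule dderiv_bounded_linear[OF bounded_linear_inner_left, symmetric])
      (rule Cinf_differentiable[OF f that])
  have "dderiv c (dderiv d f) x \<bullet> e = dderiv c (dderiv d (\<lambda>y. f y \<bullet> e)) x" for c d
  proof -
    have df: "dderiv d f differentiable at x" by (rule Cinf_differentiable[OF Cinf_dderiv[OF f] x])
    have "dderiv c (dderiv d f) x \<bullet> e = dderiv c (\<lambda>y. dderiv d f y \<bullet> e) x"
      by (rule dderiv_bounded_linear[OF bounded_linear_inner_left df, symmetric])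
    also have "\<dots> = dderiv c (dderiv d (\<lambda>y. f y \<bullet> e)) x"
      by (rule dderiv_cong[OF \<open>open U\<close> x 1]) (use df in \<open>auto intro: differentiable_compose\<close>)
    finally show ?thesis .
  qed
  then show "dderiv a (dderiv b f) x \<bullet> e = dderiv b (dderiv a f) x \<bullet> e"
    using dderiv_commute_real[OF \<open>open U\<close> Cinf_linear_compose[OF bounded_linear_inner_left \<open>open U\<close> f] x]
    by simp
qed

subsection \<open>Stereographic coordinates\<close>

text \<open>Half the conformal factor: \<open>stereo_inv\<close> stretches lengths at
  \<open>z\<close> by \<open>2 * sw z\<close>, so the area density is
  \<open>4 * (sw z)\<^sup>2\<close>.\<close>

definition sw :: "complex \<Rightarrow> real" where
  "sw z = inverse (1 + (cmod z)\<^sup>2)"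

definition plane :: "complex \<Rightarrow> real ^ 3" where
  "plane h = Re h *\<^sub>R axis 1 1 + Im h *\<^sub>R axis 2 1"

abbreviation north :: "real ^ 3" where
  "north \<equiv> axis 3 1"

lemma sw_pos [simp]: "sw z > 0"
  by (simp add: sw_def add_pos_nonneg)

lemma sw_nz [simp]: "sw z \<noteq> 0"
  using sw_pos[of z] by linarith

lemma sw_le_1: "sw z \<le> 1"
  by (simp add: sw_def field_simps add_pos_nonneg)

lemma sw_norm: "sw z * (1 + z \<bullet> z) = 1"
  unfolding sw_def power2_norm_eq_inner by (metis inner_ge_zero add_pos_nonneg left_inverse less_irrefl zero_less_one)

text \<open>The image lies on the line from the north pole through the point of the equatorial
  plane. In this form derivatives become vector identities instead of computations in three
  coordinates.\<close>

lemma stereo_inv_eq: "stereo_inv z = north + (2 * sw z) *\<^sub>R (plane z - north)"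
proof -
  have "1 / (1 + (cmod z)\<^sup>2) = sw z" by (simp add: sw_def inverse_eq_divide)
  moreover have "sw z * (cmod z)\<^sup>2 = 1 - sw z"
    using sw_norm[of z] by (simp add: power2_norm_eq_inner algebra_simps)
  ultimately show ?thesis
    by (simp add: stereo_inv_def plane_def vec_eq_iff forall_3 axis_def right_diff_distrib)
qed

lemma plane_inner [simp]:
  "plane h \<bullet> plane k = h \<bullet> k" "plane h \<bullet> north = 0" "north \<bullet> plane h = 0" "north \<bullet> north = 1"
  by (auto simp: plane_def inner_add_left inner_add_right inner_axis_axis inner_complex_def)

lemma bounded_linear_plane: "bounded_linear plane"
  unfolding plane_def[abs_def]
  by (intro bounded_linear_add bounded_linear_compose[OF bounded_linear_scaleR_left] bounded_linear_Re bounded_linear_Im)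

lemma plane_has_derivative [derivative_intros]:
  "(f has_derivative f') F \<Longrightarrow> ((\<lambda>x. plane (f x)) has_derivative (\<lambda>x. plane (f' x))) F"
  by (rule bounded_linear.has_derivative[OF bounded_linear_plane])

lemma sw_has_derivative: "(sw has_derivative (\<lambda>h. - 2 * (sw z)\<^sup>2 * (z \<bullet> h))) (at z)"
  unfolding sw_def[abs_def] power2_norm_eq_inner
  by (auto intro!: derivative_eq_intros simp: inner_commute power2_eq_square algebra_simps)
    (metis inner_ge_zero add_pos_nonneg less_irrefl zero_less_one)

lemma sw_has_derivative' [derivative_intros]:
  "(f has_derivative f') (at x within S) \<Longrightarrow>
    ((\<lambda>x. sw (f x)) has_derivative (\<lambda>h. - 2 * (sw (f x))\<^sup>2 * (f x \<bullet> f' h))) (at x within S)"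
  using has_derivative_compose[OF _ sw_has_derivative] by blast

lemma stereo_inv_dderiv:
  "dderiv h stereo_inv z = (2 * sw z) *\<^sub>R plane h - (4 * (sw z)\<^sup>2 * (z \<bullet> h)) *\<^sub>R (plane z - north)"
  unfolding stereo_inv_eq[abs_def]
  by (rule dderiv_eqI[OF has_derivative_eq_rhs])
    (auto intro!: derivative_eq_intros simp: fun_eq_iff algebra_simps)

lemma stereo_inv_dderiv2:
  "dderiv k (dderiv h stereo_inv) z =
     - ((4 * (sw z)\<^sup>2 * (z \<bullet> k)) *\<^sub>R plane h) - (4 * (sw z)\<^sup>2 * (z \<bullet> h)) *\<^sub>R plane k
     + (16 * (sw z)^3 * (z \<bullet> k) * (z \<bullet> h) - 4 * (sw z)\<^sup>2 * (k \<bullet> h)) *\<^sub>R (plane z - north)"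
  unfolding stereo_inv_dderiv[abs_def]
  by (rule dderiv_eqI[OF has_derivative_eq_rhs])
    (auto intro!: derivative_eq_intros simp: fun_eq_iff algebra_simps power2_eq_square power3_eq_cube)

lemma Cinf_sw: "Cinf UNIV sw"
  unfolding sw_def[abs_def] power2_norm_eq_inner by (intro Cinf_intros) (auto simp: add_pos_nonneg)

lemma Cinf_stereo_inv: "Cinf UNIV stereo_inv"
  unfolding stereo_inv_eq[abs_def]
  by (intro Cinf_intros Cinf_sw Cinf_linear_compose[OF bounded_linear_plane]) auto

lemma stereo_inv_inner:
  "stereo_inv z \<bullet> stereo_inv z = 1"
  "stereo_inv z \<bullet> dderiv h stereo_inv z = 0"
  "dderiv h stereo_inv z \<bullet> dderiv k stereo_inv z = 4 * (sw z)\<^sup>2 * (h \<bullet> k)"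
proof -
  have *: "z \<bullet> z = inverse (sw z) - 1"
    using sw_norm[of z] by (simp add: field_simps)
  show "stereo_inv z \<bullet> stereo_inv z = 1" "stereo_inv z \<bullet> dderiv h stereo_inv z = 0"
    "dderiv h stereo_inv z \<bullet> dderiv k stereo_inv z = 4 * (sw z)\<^sup>2 * (h \<bullet> k)"
    unfolding stereo_inv_dderiv stereo_inv_eq
    by (simp_all add: inner_add_left inner_add_right inner_diff_left inner_diff_right * inner_commute)
      (simp_all add: field_simps power2_eq_square)
qed

text \<open>The inclusion of the sphere is harmonic, so the flat Laplacian of the chart is normal to
  the sphere. It therefore drops out against tangential fields and against functions that are
  constant along rays.\<close>

lemma stereo_inv_laplace:
  "dderiv 1 (dderiv 1 stereo_inv) z + dderiv \<i> (dderiv \<i> stereo_inv) z = - (8 * (sw z)\<^sup>2) *\<^sub>R stereo_inv z"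
proof -
  have *: "Re z * Re z + Im z * Im z = inverse (sw z) - 1"
    using sw_norm[of z] by (simp add: field_simps inner_complex_def)
  have "16 * (sw z)^3 * (Re z * Re z) + 16 * (sw z)^3 * (Im z * Im z) = 16 * (sw z)^3 * (inverse (sw z) - 1)"
    unfolding *[symmetric] by (simp add: algebra_simps)
  also have "\<dots> = 16 * (sw z)\<^sup>2 - 16 * (sw z)^3"
    by (simp add: field_simps power2_eq_square power3_eq_cube)
  finally have eq: "16 * (sw z)^3 * (Re z * Re z) + 16 * (sw z)^3 * (Im z * Im z) = 16 * (sw z)\<^sup>2 - 16 * (sw z)^3" .
  have P: "plane z = Re z *\<^sub>R plane 1 + Im z *\<^sub>R plane \<i>"
    by (simp add: plane_def)
  have "dderiv 1 (dderiv 1 stereo_inv) z + dderiv \<i> (dderiv \<i> stereo_inv) z =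
      (- 8 * (sw z)\<^sup>2) *\<^sub>R (Re z *\<^sub>R plane 1 + Im z *\<^sub>R plane \<i>) +
      (16 * (sw z)^3 * (Re z * Re z) + 16 * (sw z)^3 * (Im z * Im z) - 8 * (sw z)\<^sup>2) *\<^sub>R (plane z - north)"
    unfolding stereo_inv_dderiv2
    by (simp add: vec_eq_iff inner_complex_def algebra_simps)
  also have "\<dots> = (- 8 * (sw z)\<^sup>2) *\<^sub>R plane z + (8 * (sw z)\<^sup>2 - 16 * (sw z)^3) *\<^sub>R (plane z - north)"
    unfolding P[symmetric] eq by simp
  also have "\<dots> = - (8 * (sw z)\<^sup>2) *\<^sub>R stereo_inv z"
    unfolding stereo_inv_eq by (simp add: algebra_simps power2_eq_square power3_eq_cube)
  finally show ?thesis .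
qed

text \<open>With r = sqrt (sw z), both |z| and the distance from \<open>plane z\<close> to the pole
  are at most 1/r, so every term is of order r^3. This is decay like |z|^(-3), which is integrable
  over the plane.\<close>

lemma stereo_inv_dderiv2_bound:
  assumes "norm h = 1" "norm k = 1"
  shows "norm (dderiv k (dderiv h stereo_inv) z) \<le> 28 * (sw z * sqrt (sw z))"
proof -
  define r where "r = sqrt (sw z)"
  have r: "r > 0" "sw z = r\<^sup>2" by (simp_all add: r_def real_sqrt_pow2 less_imp_le)
  have n: "norm (plane z - north) = 1 / r"
  proof -
    have "(plane z - north) \<bullet> (plane z - north) = 1 / sw z"
      using sw_norm[of z] by (simp add: inner_diff_left inner_diff_right field_simps)
    then show ?thesis by (simp add: norm_eq_sqrt_inner r_def real_sqrt_divide)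
  qed
  have p: "norm (plane c) = norm c" for c by (simp add: norm_eq_sqrt_inner)
  have zr: "norm z \<le> 1 / r"
  proof -
    have "sw z * (norm z)\<^sup>2 \<le> 1"
      using sw_norm[of z] sw_pos[of z] unfolding power2_norm_eq_inner distrib_left by linarith
    then have "(r * norm z)\<^sup>2 \<le> 1" by (simp add: r power_mult_distrib)
    then have "r * norm z \<le> 1" by (rule power2_le_imp_le[where y=1, simplified])
    then show ?thesis using r by (simp add: field_simps)
  qed
  have zh: "\<bar>z \<bullet> c\<bar> \<le> 1 / r" if "norm c = 1" for c
    using Cauchy_Schwarz_ineq2[of z c] zr that by simp
  have kh: "\<bar>k \<bullet> h\<bar> \<le> 1" using Cauchy_Schwarz_ineq2[of k h] assms by simp
  have a: "norm ((4 * (sw z)\<^sup>2 * (z \<bullet> c)) *\<^sub>R plane d) \<le> 4 * r^3" if "norm c = 1" "norm d = 1" for c d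
  proof -
    have "norm ((4 * (sw z)\<^sup>2 * (z \<bullet> c)) *\<^sub>R plane d) = 4 * r^4 * \<bar>z \<bullet> c\<bar>"
      using that by (simp add: p abs_mult r)
    also have "\<dots> \<le> 4 * r^4 * (1 / r)" using zh[OF that(1)] r by (intro mult_left_mono) auto
    also have "\<dots> = 4 * r^3" using r by (simp add: field_simps power_numeral_reduce)
    finally show ?thesis .
  qed
  have b: "norm ((16 * (sw z)^3 * (z \<bullet> k) * (z \<bullet> h) - 4 * (sw z)\<^sup>2 * (k \<bullet> h)) *\<^sub>R (plane z - north)) \<le> 20 * r^3"
  proof -
    have "\<bar>16 * (sw z)^3 * (z \<bullet> k) * (z \<bullet> h) - 4 * (sw z)\<^sup>2 * (k \<bullet> h)\<bar>
        \<le> 16 * (r^6 * (\<bar>z \<bullet> k\<bar> * \<bar>z \<bullet> h\<bar>)) + 4 * (r^4 * \<bar>k \<bullet> h\<bar>)"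
      using abs_triangle_ineq4[of "16 * (sw z)^3 * (z \<bullet> k) * (z \<bullet> h)" "4 * (sw z)\<^sup>2 * (k \<bullet> h)"]
      by (simp add: abs_mult r mult.assoc)
    also have "\<dots> \<le> 16 * (r^6 * ((1/r) * (1/r))) + 4 * (r^4 * 1)"
      using zh[OF assms(1)] zh[OF assms(2)] kh r by (intro add_mono mult_left_mono mult_mono) auto
    also have "\<dots> = 20 * r^4" using r by (simp add: field_simps power_numeral_reduce)
    finally have "norm ((16 * (sw z)^3 * (z \<bullet> k) * (z \<bullet> h) - 4 * (sw z)\<^sup>2 * (k \<bullet> h)) *\<^sub>R (plane z - north)) \<le> 20 * r^4 * (1 / r)"
      unfolding norm_scaleR n using r by (intro mult_right_mono) auto
    also have "\<dots> = 20 * r^3" using r by (simp add: field_simps power_numeral_reduce)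
    finally show ?thesis .
  qed
  \<comment> \<open>The constant 28 is the sum of the bounds 4, 4 and 20 for the three terms of
    \<open>stereo_inv_dderiv2\<close>.\<close>
  have "norm (dderiv k (dderiv h stereo_inv) z) \<le> 4 * r^3 + 4 * r^3 + 20 * r^3"
    unfolding stereo_inv_dderiv2
    by (intro norm_triangle_le add_mono b order_trans[OF norm_triangle_ineq4])
      (use a assms in auto)
  then show ?thesis by (simp add: r(2)) (simp add: r_def[symmetric] r abs_of_pos power_numeral_reduce mult_ac)
qed

lemma norm_stereo_inv [simp]: "norm (stereo_inv z) = 1"
  using stereo_inv_inner(1) by (simp add: norm_eq_sqrt_inner)

lemma stereo_inv_in_S2 [simp]: "stereo_inv z \<in> S2"
  by simp

lemma norm_stereo_inv_dderiv: "norm h = 1 \<Longrightarrow> norm (dderiv h stereo_inv z) = 2 * sw z"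
  using stereo_inv_inner(3)[of h z h] by (simp add: norm_eq_sqrt_inner real_sqrt_mult less_imp_le)

lemma stereo_inv_surj:
  assumes "y \<in> S2" "y \<noteq> north"
  obtains z where "y = stereo_inv z"
proof -
  have n: "y$1 * y$1 + y$2 * y$2 + y$3 * y$3 = 1"
    using assms(1) by (simp add: norm_eq_1 inner_vec_def sum_3)
  have "y$3 \<noteq> 1"
  proof
    assume "y$3 = 1"
    then have "y$1 = 0" "y$2 = 0" using n by (auto simp: add_nonneg_eq_0_iff)
    with \<open>y$3 = 1\<close> assms(2) show False by (simp add: vec_eq_iff forall_3 axis_def)
  qed
  moreover have "y$3 \<le> 1"
    using component_le_norm_cart[of y 3] assms(1) by simp
  ultimately have lt: "1 - y$3 > 0" by simp
  define z where "z = Complex (y$1 / (1 - y$3)) (y$2 / (1 - y$3))"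
  have "1 + (cmod z)\<^sup>2 = 2 / (1 - y$3)"
  proof -
    have "(cmod z)\<^sup>2 = (y$1 * y$1 + y$2 * y$2) / (1 - y$3)\<^sup>2"
      by (simp add: z_def cmod_power2 power_divide add_divide_distrib) (simp add: power2_eq_square)
    also have "y$1 * y$1 + y$2 * y$2 = (1 - y$3) * (1 + y$3)" using n by (simp add: algebra_simps)
    also have "(1 - y$3) * (1 + y$3) / (1 - y$3)\<^sup>2 = (1 + y$3) / (1 - y$3)"
      using lt by (simp add: power2_eq_square)
    finally show ?thesis using lt by (simp add: field_simps)
  qed
  then have "2 * sw z = 1 - y$3" by (simp add: sw_def)
  moreover have "Re z = y$1 / (1 - y$3)" "Im z = y$2 / (1 - y$3)" by (simp_all add: z_def)
  ultimately have "stereo_inv z = y"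
    using lt by (simp add: stereo_inv_eq vec_eq_iff forall_3 plane_def axis_def)
  then show ?thesis using that by blast
qed

subsection \<open>Integration over the plane\<close>

lemma measurable_Complex [measurable]: "(\<lambda>(x, y). Complex x y) \<in> borel_measurable (lborel \<Otimes>\<^sub>M lborel)"
proof -
  have "(\<lambda>(x, y). Complex x y) = (\<lambda>p. of_real (fst p) + \<i> * of_real (snd p))"
    by (auto simp: complex_eq_iff)
  also have "\<dots> \<in> borel_measurable (borel \<Otimes>\<^sub>M borel)" by measurable
  finally show ?thesis by (simp cong: measurable_cong_sets)
qed

text \<open>Both measures agree on boxes. This opens the complex plane to Fubini over real and
  imaginary part.\<close>

lemma lborel_complex: "(lborel :: complex measure) = distr (lborel \<Otimes>\<^sub>M lborel) borel (\<lambda>(x, y). Complex x y)"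
proof (rule lborel_eqI)
  fix l u :: complex
  assume lu: "\<And>b. b \<in> Basis \<Longrightarrow> l \<bullet> b \<le> u \<bullet> b"
  then have le: "Re l \<le> Re u" "Im l \<le> Im u"
    using lu[of 1] lu[of \<i>] by (auto simp: Basis_complex_def)
  have "(\<lambda>(x, y). Complex x y) -` box l u \<inter> space (lborel \<Otimes>\<^sub>M lborel) = {Re l<..<Re u} \<times> {Im l<..<Im u}"
    by (auto simp: box_def Basis_complex_def space_pair_measure)
  then have "emeasure (distr (lborel \<Otimes>\<^sub>M lborel) borel (\<lambda>(x, y). Complex x y)) (box l u) =
      emeasure (lborel \<Otimes>\<^sub>M lborel) ({Re l<..<Re u} \<times> {Im l<..<Im u})"
    by (subst emeasure_distr) auto
  also have "\<dots> = ennreal ((Re u - Re l) * (Im u - Im l))"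
    using le by (simp add: lborel.emeasure_pair_measure_Times ennreal_mult)
  finally show "emeasure (distr (lborel \<Otimes>\<^sub>M lborel) borel (\<lambda>(x, y). Complex x y)) (box l u) =
      (\<Prod>b\<in>Basis. (u - l) \<bullet> b)"
    by (simp add: Basis_complex_def)
qed simp

lemma integrable_lborel_complex:
  fixes f :: "complex \<Rightarrow> real"
  assumes [measurable]: "f \<in> borel_measurable borel"
  shows "integrable lborel f \<longleftrightarrow> integrable (lborel \<Otimes>\<^sub>M lborel) (\<lambda>p. f (Complex (fst p) (snd p)))"
  by (subst lborel_complex, subst integrable_distr_eq) (auto simp: case_prod_unfold)

lemma integral_lborel_complex:
  fixes f :: "complex \<Rightarrow> real"
  assumes [measurable]: "f \<in> borel_measurable borel"
  shows "integral\<^sup>L lborel f = (\<integral>p. f (Complex (fst p) (snd p)) \<partial>(lborel \<Otimes>\<^sub>M lborel))"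
  by (subst lborel_complex, subst integral_distr) (auto simp: case_prod_unfold)

lemma integral_line_FTC:
  fixes F f :: "real \<Rightarrow> real"
  assumes "\<And>x. (F has_real_derivative f x) (at x)" "\<And>x. isCont f x" "integrable lborel f"
    and "(F \<longlongrightarrow> A) at_bot" "(F \<longlongrightarrow> B) at_top"
  shows "integral\<^sup>L lborel f = B - A"
proof -
  have "(LBINT x=-\<infinity>..\<infinity>. f x) = B - A"
    by (rule interval_integral_FTC_integrable[where F = F])
      (use assms in \<open>auto simp: has_real_derivative_iff_has_vector_derivative[symmetric] set_integrable_def ereal_tendsto_simps\<close>)
  then show ?thesis
    by (simp add: interval_lebesgue_integral_def set_lebesgue_integral_def)
qed

lemma integral_line_FTC_nonneg:
  fixes F f :: "real \<Rightarrow> real"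
  assumes "\<And>x. (F has_real_derivative f x) (at x)" "\<And>x. isCont f x" "\<And>x. f x \<ge> 0"
    and "(F \<longlongrightarrow> A) at_bot" "(F \<longlongrightarrow> B) at_top"
  shows "integrable lborel f" "integral\<^sup>L lborel f = B - A"
proof -
  have "set_integrable lborel (einterval (-\<infinity>) \<infinity>) f"
    by (rule interval_integral_FTC_nonneg[where F = F])
      (use assms in \<open>auto simp: ereal_tendsto_simps\<close>)
  then show "integrable lborel f" by (simp add: set_integrable_def)
  then show "integral\<^sup>L lborel f = B - A" by (rule integral_line_FTC[OF assms(1,2) _ assms(4,5)])
qed

text \<open>The antiderivative is y / (s sqrt (s + y^2)). With s = 1 + x^2 this is the inner
  integral for \<open>integrable_sw_three_halves\<close>; with s = 1 it is the outer one for the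
  area of the sphere.\<close>

lemma line_integral_three_halves:
  fixes s :: real
  assumes s: "s > 0"
  shows "integrable lborel (\<lambda>y. inverse ((s + y\<^sup>2) * sqrt (s + y\<^sup>2)))"
    "integral\<^sup>L lborel (\<lambda>y. inverse ((s + y\<^sup>2) * sqrt (s + y\<^sup>2))) = 2 / s"
proof -
  have pos: "s + y\<^sup>2 > 0" for y :: real using s by (simp add: add_pos_nonneg)
  have 1: "((\<lambda>y. y / (s * sqrt (s + y\<^sup>2))) has_real_derivative inverse ((s + y\<^sup>2) * sqrt (s + y\<^sup>2))) (at y)" for y
  proof -
    define r where "r = sqrt (s + y\<^sup>2)"
    have r: "r > 0" "s + y\<^sup>2 = r\<^sup>2" using pos[of y] by (simp_all add: r_def)
    then have s_eq: "s = r\<^sup>2 - y\<^sup>2" by simp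
    have "((\<lambda>y. y / (s * sqrt (s + y\<^sup>2))) has_real_derivative
        (s * r - y * (s * (inverse r / 2 * (2 * y)))) / (s * r * (s * r))) (at y)"
      using pos[of y] s r unfolding r_def by (auto intro!: derivative_eq_intros)
    also have "(s * r - y * (s * (inverse r / 2 * (2 * y)))) / (s * r * (s * r)) = inverse (r\<^sup>2 * r)"
    proof -
      have "s * r - y * (s * (inverse r / 2 * (2 * y))) = s * (r\<^sup>2 - y\<^sup>2) / r"
        using r(1) by (simp add: field_simps power2_eq_square)
      also have "\<dots> = s * s / r" by (simp add: s_eq)
      finally have num: "s * r - y * (s * (inverse r / 2 * (2 * y))) = s * s / r" .
      show ?thesis
        unfolding num using r(1) s by (simp add: divide_simps power2_eq_square)
    qed
    also have "\<dots> = inverse ((s + y\<^sup>2) * sqrt (s + y\<^sup>2))"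
      by (simp only: r(2)[symmetric] r_def[symmetric])
    finally show ?thesis .
  qed
  have 2: "((\<lambda>y. y / (s * sqrt (s + y\<^sup>2))) \<longlongrightarrow> - (1 / s)) at_bot"
    "((\<lambda>y. y / (s * sqrt (s + y\<^sup>2))) \<longlongrightarrow> 1 / s) at_top"
    using s by (real_asymp simp: field_simps)+
  have 3: "isCont (\<lambda>y. inverse ((s + y\<^sup>2) * sqrt (s + y\<^sup>2))) y" "inverse ((s + y\<^sup>2) * sqrt (s + y\<^sup>2)) \<ge> 0" for y
    using pos[of y] by (auto intro!: continuous_intros simp: less_imp_le)
  show "integrable lborel (\<lambda>y. inverse ((s + y\<^sup>2) * sqrt (s + y\<^sup>2)))"
    by (rule integral_line_FTC_nonneg(1)[OF 1 3 2])
  show "integral\<^sup>L lborel (\<lambda>y. inverse ((s + y\<^sup>2) * sqrt (s + y\<^sup>2))) = 2 / s"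
    using integral_line_FTC_nonneg(2)[OF 1 3 2] by simp
qed

lemma line_integral_square:
  fixes s :: real
  assumes s: "s > 0"
  shows "integrable lborel (\<lambda>y. inverse ((s + y\<^sup>2)\<^sup>2))"
    "integral\<^sup>L lborel (\<lambda>y. inverse ((s + y\<^sup>2)\<^sup>2)) = pi / 2 * inverse (s * sqrt s)"
proof -
  define r where "r = sqrt s"
  have r: "r > 0" "s = r\<^sup>2" using s by (simp_all add: r_def)
  have pos: "r\<^sup>2 + y\<^sup>2 > 0" for y :: real using r by (simp add: add_pos_nonneg)
  \<comment> \<open>The usual antiderivative of (r^2 + y^2)^(-2), obtained by reduction to the
    arctangent; writing s = r^2 keeps it free of square roots.\<close>
  let ?F = "\<lambda>y. y / (2 * r\<^sup>2 * (r\<^sup>2 + y\<^sup>2)) + arctan (y / r) / (2 * r^3)"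
  have 1: "(?F has_real_derivative inverse ((r\<^sup>2 + y\<^sup>2)\<^sup>2)) (at y)" for y
  proof -
    define Q where "Q = r\<^sup>2 + y\<^sup>2"
    have nz: "Q \<noteq> 0" "r \<noteq> 0" using pos[of y] r by (auto simp: Q_def)
    have "((\<lambda>y. 2 * r\<^sup>2 * (r\<^sup>2 + y\<^sup>2)) has_real_derivative 2 * r\<^sup>2 * (2 * y)) (at y)"
      by (auto intro!: derivative_eq_intros)
    from DERIV_divide[OF DERIV_ident this]
    have A: "((\<lambda>y. y / (2 * r\<^sup>2 * (r\<^sup>2 + y\<^sup>2))) has_real_derivative
        (1 * (2 * r\<^sup>2 * Q) - y * (2 * r\<^sup>2 * (2 * y))) / ((2 * r\<^sup>2 * Q) * (2 * r\<^sup>2 * Q))) (at y)"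
      using nz by (simp add: Q_def)
    have "((\<lambda>y. arctan (y / r) / (2 * r^3)) has_real_derivative
        (inverse (1 + (y / r)\<^sup>2) * (1 / r)) / (2 * r^3)) (at y)"
      by (intro DERIV_cdivide DERIV_chain2[OF DERIV_arctan] DERIV_ident)
    from DERIV_add[OF A this]
    have "(?F has_real_derivative
        (1 * (2 * r\<^sup>2 * Q) - y * (2 * r\<^sup>2 * (2 * y))) / ((2 * r\<^sup>2 * Q) * (2 * r\<^sup>2 * Q)) +
          (inverse (1 + (y / r)\<^sup>2) * (1 / r)) / (2 * r^3)) (at y)" .
    also have "inverse (1 + (y / r)\<^sup>2) = r\<^sup>2 / Q"
      using nz by (simp add: Q_def field_simps)
    also have "(1 * (2 * r\<^sup>2 * Q) - y * (2 * r\<^sup>2 * (2 * y))) / ((2 * r\<^sup>2 * Q) * (2 * r\<^sup>2 * Q)) +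
          (r\<^sup>2 / Q * (1 / r)) / (2 * r^3) = (Q - y\<^sup>2) / (r\<^sup>2 * Q\<^sup>2)"
      using nz by (simp add: divide_simps) (simp add: algebra_simps power_numeral_reduce)
    also have "\<dots> = inverse (Q\<^sup>2)"
      using nz by (simp add: Q_def divide_simps)
    finally show ?thesis by (simp add: Q_def)
  qed
  have 2: "(?F \<longlongrightarrow> - (pi / (4 * r^3))) at_bot" "(?F \<longlongrightarrow> pi / (4 * r^3)) at_top"
    using r(1) by (real_asymp simp: field_simps)+
  have 3: "isCont (\<lambda>y. inverse ((r\<^sup>2 + y\<^sup>2)\<^sup>2)) y" "inverse ((r\<^sup>2 + y\<^sup>2)\<^sup>2) \<ge> 0" for y
    using pos[of y] by (auto intro!: continuous_intros simp: less_imp_le)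
  show "integrable lborel (\<lambda>y. inverse ((s + y\<^sup>2)\<^sup>2))"
    unfolding r(2) by (rule integral_line_FTC_nonneg(1)[OF 1 3 2])
  show "integral\<^sup>L lborel (\<lambda>y. inverse ((s + y\<^sup>2)\<^sup>2)) = pi / 2 * inverse (s * sqrt s)"
    unfolding r(2) using integral_line_FTC_nonneg(2)[OF 1 3 2] r(1)
    by (simp add: field_simps power2_eq_square power3_eq_cube)
qed

lemma sw_Complex: "sw (Complex x y) = inverse ((1 + x\<^sup>2) + y\<^sup>2)"
  by (simp add: sw_def cmod_power2 add.assoc)

lemma borel_measurable_sw [measurable]: "sw \<in> borel_measurable borel"
  by (intro borel_measurable_continuous_onI Cinf_continuous_on Cinf_sw)

lemma integrable_inverse_1_square: "integrable lborel (\<lambda>x::real. inverse (1 + x\<^sup>2))"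
proof (rule integral_line_FTC_nonneg(1)[of arctan _ "- (pi / 2)" "pi / 2"])
  show "isCont (\<lambda>x::real. inverse (1 + x\<^sup>2)) x" for x
    by (auto intro!: continuous_intros) (metis add_pos_nonneg less_irrefl zero_le_power2 zero_less_one)
qed (auto intro!: DERIV_arctan tendsto_arctan_at_top tendsto_arctan_at_bot)

text \<open>The power 3/2 is the decay rate of the derivatives of chart components of tangent
  fields, hence the dominating function for the divergence theorem.\<close>

lemma integrable_sw_three_halves: "integrable lborel (\<lambda>z. sw z * sqrt (sw z))"
proof (subst integrable_lborel_complex)
  let ?f = "\<lambda>x y. inverse (((1 + x\<^sup>2) + y\<^sup>2) * sqrt ((1 + x\<^sup>2) + y\<^sup>2)) :: real"
  have pos: "1 + x\<^sup>2 > 0" for x :: real by (simp add: add_pos_nonneg)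
  have eq: "sw (Complex x y) * sqrt (sw (Complex x y)) = ?f x y" for x y
    by (simp add: sw_Complex real_sqrt_inverse)
  show "integrable (lborel \<Otimes>\<^sub>M lborel) (\<lambda>p. sw (Complex (fst p) (snd p)) * sqrt (sw (Complex (fst p) (snd p))))"
    unfolding eq
  proof (rule lborel_pair.Fubini_integrable)
    have "norm (?f x y) = ?f x y" for x y
      using pos[of x] by (simp add: abs_mult less_imp_le add_nonneg_nonneg)
    then have "(\<lambda>x. \<integral>y. norm (?f x y) \<partial>lborel) = (\<lambda>x. 2 * inverse (1 + x\<^sup>2))"
      using line_integral_three_halves(2)[OF pos] by (simp add: divide_inverse)
    then show "integrable lborel (\<lambda>x. \<integral>y. norm (inverse ((1 + (fst (x, y))\<^sup>2 + (snd (x, y))\<^sup>2) *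
         sqrt (1 + (fst (x, y))\<^sup>2 + (snd (x, y))\<^sup>2))) \<partial>lborel)"
      using integrable_inverse_1_square by simp
    show "AE x in lborel. integrable lborel (\<lambda>y. inverse ((1 + (fst (x, y))\<^sup>2 + (snd (x, y))\<^sup>2) *
         sqrt (1 + (fst (x, y))\<^sup>2 + (snd (x, y))\<^sup>2)))"
      using line_integral_three_halves(1)[OF pos] by simp
  qed measurable
qed measurable

lemma sw_sq_le: "(sw z)\<^sup>2 \<le> sw z * sqrt (sw z)"
proof -
  have "sw z \<le> sqrt (sw z)"
    using sw_le_1[of z] sw_pos[of z] by (simp add: real_le_rsqrt power2_eq_square mult_left_le)
  then show ?thesis by (simp add: power2_eq_square less_imp_le)
qed

lemma integrable_sw_sq: "integrable lborel (\<lambda>z. (sw z)\<^sup>2)"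
  by (rule Bochner_Integration.integrable_bound[OF integrable_sw_three_halves])
    (use sw_sq_le in \<open>auto simp: abs_mult less_imp_le\<close>)

lemma integral_sw_sq: "integral\<^sup>L lborel (\<lambda>z. (sw z)\<^sup>2) = pi"
proof -
  have pos: "1 + x\<^sup>2 > 0" for x :: real by (simp add: add_pos_nonneg)
  have eq: "(sw (Complex x y))\<^sup>2 = inverse (((1 + x\<^sup>2) + y\<^sup>2)\<^sup>2)" for x y
    by (simp add: sw_Complex power_inverse)
  have int: "integrable (lborel \<Otimes>\<^sub>M lborel) (\<lambda>p. (sw (Complex (fst p) (snd p)))\<^sup>2)"
    using integrable_sw_sq by (subst (asm) integrable_lborel_complex) auto
  have "integral\<^sup>L lborel (\<lambda>z. (sw z)\<^sup>2) = (\<integral>p. (sw (Complex (fst p) (snd p)))\<^sup>2 \<partial>(lborel \<Otimes>\<^sub>M lborel))"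
    by (rule integral_lborel_complex) measurable
  also have "\<dots> = (\<integral>x. \<integral>y. (sw (Complex x y))\<^sup>2 \<partial>lborel \<partial>lborel)"
    using lborel_pair.integral_fst'[OF int] by simp
  also have "\<dots> = (\<integral>x. pi / 2 * inverse ((1 + x\<^sup>2) * sqrt (1 + x\<^sup>2)) \<partial>lborel)"
    by (simp only: eq line_integral_square(2)[OF pos])
  also have "\<dots> = pi / 2 * (2 / 1)"
    using line_integral_three_halves(2)[of 1] by simp
  finally show ?thesis by simp
qed

lemma sw_Complex_tendsto:
  "((\<lambda>x. sw (Complex x y)) \<longlongrightarrow> 0) at_top" "((\<lambda>x. sw (Complex x y)) \<longlongrightarrow> 0) at_bot"
  "((\<lambda>x. sw (Complex y x)) \<longlongrightarrow> 0) at_top" "((\<lambda>x. sw (Complex y x)) \<longlongrightarrow> 0) at_bot"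
  unfolding sw_Complex by real_asymp+

text \<open>By Fubini the integral is taken along lines in direction \<open>h\<close>, where the
  fundamental theorem gives the difference of two zero limits. The first bound makes
  \<open>f\<close> vanish at the ends of each line, the second makes its derivative
  integrable.\<close>

lemma integral_dderiv_eq_0:
  fixes f :: "complex \<Rightarrow> real"
  assumes f: "Cinf UNIV f"
    and f0: "\<And>z. \<bar>f z\<bar> \<le> C * sw z"
    and f1: "\<And>z. \<bar>dderiv h f z\<bar> \<le> C * (sw z * sqrt (sw z))"
    and h: "h = 1 \<or> h = \<i>"
  shows "integrable lborel (dderiv h f)" "integral\<^sup>L lborel (dderiv h f) = 0"
proof -
  have cont: "continuous_on UNIV (dderiv h f)"
    by (rule Cinf_continuous_on[OF Cinf_dderiv[OF f]])
  have [measurable]: "dderiv h f \<in> borel_measurable borel"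
    by (rule borel_measurable_continuous_onI[OF cont])
  have "C \<ge> 0" using f0[of 0] sw_pos[of 0] by (smt (verit) zero_le_mult_iff)
  show int: "integrable lborel (dderiv h f)"
    by (rule Bochner_Integration.integrable_bound[OF integrable_mult_right[OF integrable_sw_three_halves, of C]])
      (use f1 \<open>C \<ge> 0\<close> in \<open>auto simp: abs_mult less_imp_le\<close>)
  then have int2: "integrable (lborel \<Otimes>\<^sub>M lborel) (\<lambda>p. dderiv h f (Complex (fst p) (snd p)))"
    by (subst (asm) integrable_lborel_complex) auto
  have eq: "integral\<^sup>L lborel (dderiv h f) = (\<integral>p. dderiv h f (Complex (fst p) (snd p)) \<partial>(lborel \<Otimes>\<^sub>M lborel))"
    by (rule integral_lborel_complex) measurable
  have line: "integral\<^sup>L lborel (\<lambda>x. dderiv h f (c + x *\<^sub>R h)) = 0"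
    if "integrable lborel (\<lambda>x. dderiv h f (c + x *\<^sub>R h))"
      "((\<lambda>x. sw (c + x *\<^sub>R h)) \<longlongrightarrow> 0) at_top" "((\<lambda>x. sw (c + x *\<^sub>R h)) \<longlongrightarrow> 0) at_bot" for c
  proof -
    have "integral\<^sup>L lborel (\<lambda>x. dderiv h f (c + x *\<^sub>R h)) = 0 - 0"
    proof (rule integral_line_FTC[where F = "\<lambda>x. f (c + x *\<^sub>R h)"])
      show "((\<lambda>x. f (c + x *\<^sub>R h)) has_real_derivative dderiv h f (c + x *\<^sub>R h)) (at x)" for x
        by (rule dderiv_along_line[OF f]) simp
      show "isCont (\<lambda>x. dderiv h f (c + x *\<^sub>R h)) x" for x
        using continuous_on_compose2[OF cont, of UNIV "\<lambda>x. c + x *\<^sub>R h"]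
        by (simp add: continuous_on_eq_continuous_at continuous_intros)
      have lim: "((\<lambda>x. f (c + x *\<^sub>R h)) \<longlongrightarrow> 0) F" if "((\<lambda>x. sw (c + x *\<^sub>R h)) \<longlongrightarrow> 0) F" for F
        by (rule Lim_null_comparison[OF _ tendsto_mult_right_zero[OF that, of C]]) (use f0 in auto)
      show "((\<lambda>x. f (c + x *\<^sub>R h)) \<longlongrightarrow> 0) at_bot" "((\<lambda>x. f (c + x *\<^sub>R h)) \<longlongrightarrow> 0) at_top"
        by (rule lim[OF that(3)], rule lim[OF that(2)])
    qed (rule that(1))
    then show ?thesis by simp
  qed
  show "integral\<^sup>L lborel (dderiv h f) = 0"
    using h
  proof
    assume h1: "h = 1"
    have c: "Complex x y = Complex 0 y + x *\<^sub>R h" for x y by (simp add: h1 complex_eq_iff)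
    have int3: "integrable (lborel \<Otimes>\<^sub>M lborel) (\<lambda>(x, y). dderiv h f (Complex x y))"
      using int2 by (simp add: case_prod_unfold)
    \<comment> \<open>Fubini guarantees integrability along almost every line only, which is enough
      for the iterated integral.\<close>
    have "AE y in lborel. (\<integral>x. dderiv h f (Complex x y) \<partial>lborel) = 0"
      using lborel_pair.AE_integrable_snd[OF int3]
    proof eventually_elim
      case (elim y)
      have A: "(\<lambda>x. sw (Complex x y)) = (\<lambda>x. sw (Complex 0 y + x *\<^sub>R h))"
        by (rule ext, subst c, rule refl)
      have B: "(\<lambda>x. dderiv h f (Complex x y)) = (\<lambda>x. dderiv h f (Complex 0 y + x *\<^sub>R h))"
        by (rule ext, subst c, rule refl)
      show ?case
        by (rule line[of "Complex 0 y", folded A B, OF elim sw_Complex_tendsto(1,2)])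
    qed
    then have "(\<integral>y. \<integral>x. dderiv h f (Complex x y) \<partial>lborel \<partial>lborel) = 0"
      by (rule integral_eq_zero_AE)
    then show ?thesis
      using lborel_pair.integral_snd[OF int3] eq by (simp add: case_prod_unfold)
  next
    assume hi: "h = \<i>"
    have c: "Complex x y = Complex x 0 + y *\<^sub>R h" for x y by (simp add: hi complex_eq_iff)
    have int3: "integrable (lborel \<Otimes>\<^sub>M lborel) (\<lambda>(x, y). dderiv h f (Complex x y))"
      using int2 by (simp add: case_prod_unfold)
    have "AE x in lborel. (\<integral>y. dderiv h f (Complex x y) \<partial>lborel) = 0"
      using lborel_pair.AE_integrable_fst[OF int3]
    proof eventually_elim
      case (elim x)
      have A: "(\<lambda>y. sw (Complex x y)) = (\<lambda>y. sw (Complex x 0 + y *\<^sub>R h))"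
        by (rule ext, subst c, rule refl)
      have B: "(\<lambda>y. dderiv h f (Complex x y)) = (\<lambda>y. dderiv h f (Complex x 0 + y *\<^sub>R h))"
        by (rule ext, subst c, rule refl)
      show ?case
        by (rule line[of "Complex x 0", folded A B, OF elim sw_Complex_tendsto(3,4)])
    qed
    then have "(\<integral>x. \<integral>y. dderiv h f (Complex x y) \<partial>lborel \<partial>lborel) = 0"
      by (rule integral_eq_zero_AE)
    then show ?thesis
      using lborel_pair.integral_fst[OF int3] eq by (simp add: case_prod_unfold)
  qed
qed

subsection \<open>Traces and derivatives\<close>

text \<open>Each standard basis vector is expanded in \<open>B\<close>; after exchanging the sums
  the coefficients are the inner products of \<open>B\<close>, that is, Kronecker deltas. This lets
  Euclidean traces be split into a radial and a tangential part.\<close>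

lemma trace_orthonormal:
  fixes \<beta> :: "'a::euclidean_space \<Rightarrow> 'a \<Rightarrow> 'b::real_vector"
  assumes \<beta>: "bilinear \<beta>" and B: "pairwise orthogonal B" "\<And>b. b \<in> B \<Longrightarrow> norm b = 1" "span B = UNIV"
  shows "(\<Sum>i\<in>Basis. \<beta> i i) = (\<Sum>b\<in>B. \<beta> b b)"
proof -
  have inner_Basis: "(\<Sum>i\<in>Basis. (i \<bullet> b) * (i \<bullet> c)) = b \<bullet> c" for b c :: 'a
    by (subst euclidean_inner[of b c]) (simp add: inner_commute)
  have fin: "finite B" using B(1) by (rule pairwise_orthogonal_imp_finite)
  have "\<beta> i i = (\<Sum>(b, c)\<in>B \<times> B. ((i \<bullet> b) * (i \<bullet> c)) *\<^sub>R \<beta> b c)" for i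
  proof -
    have i: "i = (\<Sum>b\<in>B. (i \<bullet> b) *\<^sub>R b)"
      using orthonormal_basis_expand[OF B(1,2) _ fin] B(3) by simp
    have "\<beta> i i = \<beta> (\<Sum>b\<in>B. (i \<bullet> b) *\<^sub>R b) (\<Sum>b\<in>B. (i \<bullet> b) *\<^sub>R b)" using i by simp
    also have "\<dots> = (\<Sum>(b, c)\<in>B \<times> B. \<beta> ((i \<bullet> b) *\<^sub>R b) ((i \<bullet> c) *\<^sub>R c))"
      by (rule bilinear_sum[OF \<beta>])
    finally show ?thesis
      by (simp add: bilinear_lmul[OF \<beta>] bilinear_rmul[OF \<beta>] case_prod_unfold mult.commute)
  qed
  then have "(\<Sum>i\<in>Basis. \<beta> i i) = (\<Sum>i\<in>Basis. \<Sum>(b, c)\<in>B \<times> B. ((i \<bullet> b) * (i \<bullet> c)) *\<^sub>R \<beta> b c)"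
    by (intro sum.cong) auto
  also have "\<dots> = (\<Sum>(b, c)\<in>B \<times> B. (\<Sum>i\<in>Basis. (i \<bullet> b) * (i \<bullet> c)) *\<^sub>R \<beta> b c)"
    by (subst sum.swap) (simp add: scaleR_sum_left case_prod_unfold)
  also have "\<dots> = (\<Sum>(b, c)\<in>B \<times> B. (b \<bullet> c) *\<^sub>R \<beta> b c)"
    unfolding inner_Basis ..
  also have "\<dots> = (\<Sum>b\<in>B. \<Sum>c\<in>B. (b \<bullet> c) *\<^sub>R \<beta> b c)"
    by (simp add: sum.cartesian_product)
  also have "\<dots> = (\<Sum>b\<in>B. \<Sum>c\<in>B. if c = b then \<beta> b b else 0)"
  proof (intro sum.cong refl)
    fix b c assume "b \<in> B" "c \<in> B"
    then show "(b \<bullet> c) *\<^sub>R \<beta> b c = (if c = b then \<beta> b b else 0)"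
      using B(1,2) by (auto simp: pairwise_def orthogonal_def norm_eq_1)
  qed
  also have "\<dots> = (\<Sum>b\<in>B. \<beta> b b)" using fin by simp
  finally show ?thesis .
qed

lemma trace_tangent_frame:
  fixes \<beta> :: "real ^ 3 \<Rightarrow> real ^ 3 \<Rightarrow> 'b::real_vector"
  assumes \<beta>: "bilinear \<beta>" and y: "y \<in> S2" and B: "tangent_frame y B"
  shows "(\<Sum>i\<in>Basis. \<beta> i i) = \<beta> y y + (\<Sum>b\<in>B. \<beta> b b)"
proof -
  have B': "pairwise orthogonal B" "\<And>e. e \<in> B \<Longrightarrow> norm e = 1" "span B = {v. y \<bullet> v = 0}"
    using B by (auto simp: tangent_frame_def)
  have perp: "y \<bullet> b = 0" if "b \<in> B" for b using B'(3) span_base[OF that] by blast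
  have "y \<notin> B" using perp[of y] y by auto
  have "x \<in> span (insert y B)" for x
  proof -
    have "y \<bullet> y = 1" using y by (simp add: norm_eq_1)
    then have "x - (y \<bullet> x) *\<^sub>R y \<in> span B"
      unfolding B'(3) by (simp add: inner_diff_right)
    then show ?thesis unfolding span_insert by blast
  qed
  then have "span (insert y B) = UNIV" by blast
  moreover have "pairwise orthogonal (insert y B)"
    using B'(1) perp by (auto simp: pairwise_insert orthogonal_def inner_commute)
  ultimately have "(\<Sum>i\<in>Basis. \<beta> i i) = (\<Sum>b\<in>insert y B. \<beta> b b)"
    using B'(2) y by (intro trace_orthonormal[OF \<beta>]) auto
  then show ?thesis
    using pairwise_orthogonal_imp_finite[OF B'(1)] \<open>y \<notin> B\<close> by simp
qed

lemma tangent_frame_exists: "\<exists>B. tangent_frame y B"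
proof -
  have "subspace {v. y \<bullet> v = 0}" by (rule subspace_hyperplane)
  from orthonormal_basis_subspace[OF this] show ?thesis
    unfolding tangent_frame_def by metis
qed

text \<open>By conformality, the two partial derivatives of the chart divided by
  \<open>2 * sw z\<close>, together with the position vector, form an orthonormal basis. Clearing
  the factors gives the stated form.\<close>

lemma trace_stereo:
  fixes \<beta> :: "real ^ 3 \<Rightarrow> real ^ 3 \<Rightarrow> 'b::real_vector"
  assumes \<beta>: "bilinear \<beta>"
  defines "s \<equiv> \<lambda>h z. dderiv h stereo_inv z"
  shows "(4 * (sw z)\<^sup>2) *\<^sub>R (\<Sum>i\<in>Basis. \<beta> i i) =
    \<beta> (s 1 z) (s 1 z) + \<beta> (s \<i> z) (s \<i> z) + (4 * (sw z)\<^sup>2) *\<^sub>R \<beta> (stereo_inv z) (stereo_inv z)"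
proof -
  define t where "t = inverse (2 * sw z)"
  define a where "a = t *\<^sub>R s 1 z"
  define b where "b = t *\<^sub>R s \<i> z"
  have sw: "sw z \<noteq> 0" by simp
  have t: "4 * (sw z)\<^sup>2 * (t * t) = 1"
    using sw by (simp add: t_def field_simps power2_eq_square)
  have in1: "a \<bullet> a = 1" "b \<bullet> b = 1" "a \<bullet> b = 0" "stereo_inv z \<bullet> a = 0" "stereo_inv z \<bullet> b = 0"
    using sw by (simp_all add: a_def b_def t_def s_def stereo_inv_inner inner_complex_def field_simps power2_eq_square)
  have ne: "a \<noteq> b" "a \<noteq> stereo_inv z" "b \<noteq> stereo_inv z"
    using in1 stereo_inv_inner(1)[of z] by auto
  let ?B = "{a, b, stereo_inv z}"
  have orth: "pairwise orthogonal ?B"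
    using in1 by (auto simp: pairwise_insert orthogonal_def inner_commute)
  have n1: "norm e = 1" if "e \<in> ?B" for e
    using that in1 norm_stereo_inv[of z] by (auto simp: norm_eq_1 simp del: norm_stereo_inv)
  have "independent ?B"
    using n1[of 0] by (intro pairwise_orthogonal_independent[OF orth]) (metis norm_zero zero_neq_one)
  moreover have "card ?B = 3" using ne by simp
  ultimately have sp: "span ?B = UNIV"
    using card_ge_dim_independent[of ?B UNIV] by (auto simp: dim_UNIV)
  have "(\<Sum>i\<in>Basis. \<beta> i i) = (\<Sum>e\<in>?B. \<beta> e e)"
    by (rule trace_orthonormal[OF \<beta> orth _ sp]) (rule n1)
  also have "\<dots> = \<beta> a a + \<beta> b b + \<beta> (stereo_inv z) (stereo_inv z)"
    using ne by (simp add: add.assoc)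
  finally have tr: "(\<Sum>i\<in>Basis. \<beta> i i) = \<beta> a a + \<beta> b b + \<beta> (stereo_inv z) (stereo_inv z)" .
  have sc: "(4 * (sw z)\<^sup>2) *\<^sub>R \<beta> (t *\<^sub>R v) (t *\<^sub>R v) = \<beta> v v" for v
  proof -
    have "(4 * (sw z)\<^sup>2) *\<^sub>R \<beta> (t *\<^sub>R v) (t *\<^sub>R v) = (4 * (sw z)\<^sup>2 * (t * t)) *\<^sub>R \<beta> v v"
      by (simp add: bilinear_lmul[OF \<beta>] bilinear_rmul[OF \<beta>] mult.assoc)
    then show ?thesis by (simp add: t)
  qed
  show ?thesis
    unfolding tr scaleR_add_right a_def b_def sc ..
qed

lemma dderiv_inner:
  "f differentiable at x \<Longrightarrow> g differentiable at x \<Longrightarrow>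
    dderiv v (\<lambda>x. f x \<bullet> g x) x = f x \<bullet> dderiv v g x + dderiv v f x \<bullet> g x"
  by (intro dderiv_eqI) (auto intro!: derivative_eq_intros has_derivative_dderiv)

lemma dderiv_scaleR:
  "f differentiable at x \<Longrightarrow> g differentiable at x \<Longrightarrow>
    dderiv v (\<lambda>x. f x *\<^sub>R g x) x = f x *\<^sub>R dderiv v g x + dderiv v f x *\<^sub>R g x"
  by (intro dderiv_eqI) (auto intro!: derivative_eq_intros has_derivative_dderiv)

lemma dderiv_add:
  "f differentiable at x \<Longrightarrow> g differentiable at x \<Longrightarrow>
    dderiv v (\<lambda>x. f x + g x) x = dderiv v f x + dderiv v g x"
  by (intro dderiv_eqI) (auto intro!: derivative_eq_intros has_derivative_dderiv)

lemma dderiv_sum: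
  "(\<And>i. i \<in> I \<Longrightarrow> f i differentiable at x) \<Longrightarrow>
    dderiv v (\<lambda>x. \<Sum>i\<in>I. f i x) x = (\<Sum>i\<in>I. dderiv v (f i) x)"
  by (intro dderiv_eqI has_derivative_sum has_derivative_dderiv)

lemma linear_dderiv2:
  assumes "open U" and F: "Cinf U F" and x: "x \<in> U"
  shows "linear (\<lambda>q. dderiv p (dderiv q F) x)"
proof (rule linearI)
  have d: "dderiv q F differentiable at x" for q
    by (rule Cinf_differentiable[OF Cinf_dderiv[OF F] x])
  show "dderiv p (dderiv (a + b) F) x = dderiv p (dderiv a F) x + dderiv p (dderiv b F) x" for a b
  proof -
    have "dderiv p (dderiv (a + b) F) x = dderiv p (\<lambda>x. dderiv a F x + dderiv b F x) x"
      by (rule dderiv_cong[OF \<open>open U\<close> x linear_add[OF linear_dderiv[OF F]] d])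
    then show ?thesis by (simp add: dderiv_add d)
  qed
  show "dderiv p (dderiv (c *\<^sub>R a) F) x = c *\<^sub>R dderiv p (dderiv a F) x" for c a
  proof -
    have "dderiv p (dderiv (c *\<^sub>R a) F) x = dderiv p (\<lambda>x. c *\<^sub>R dderiv a F x) x"
      by (rule dderiv_cong[OF \<open>open U\<close> x linear_scale[OF linear_dderiv[OF F]] d])
    also have "\<dots> = c *\<^sub>R dderiv p (dderiv a F) x"
      by (rule dderiv_bounded_linear[OF bounded_linear_scaleR_right d])
    finally show ?thesis .
  qed
qed

lemma bilinear_dderiv2:
  assumes "open U" "Cinf U F" "x \<in> U"
  shows "bilinear (\<lambda>p q. dderiv p (dderiv q F) x)"
  unfolding bilinear_def
  using linear_dderiv2[OF assms] linear_dderiv[OF Cinf_dderiv[OF assms(2)] assms(3)] by blast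

text \<open>The inner direction \<open>dderiv k g x\<close> varies with \<open>x\<close>, so it is
  expanded in the basis before differentiating again; the product rule then produces the Hessian
  term and the first-order term.\<close>

lemma dderiv2_compose:
  fixes g :: "'a::euclidean_space \<Rightarrow> 'b::euclidean_space"
  assumes "open U" "open V" "g ` U \<subseteq> V" and F: "Cinf V F" and g: "Cinf U g" and x: "x \<in> U"
  shows "dderiv h (dderiv k (\<lambda>x. F (g x))) x =
    dderiv (dderiv h g x) (dderiv (dderiv k g x) F) (g x) + dderiv (dderiv h (dderiv k g) x) F (g x)"
proof -
  have gV: "g y \<in> V" if "y \<in> U" for y using that assms(3) by blast
  have dg: "g differentiable at y" if "y \<in> U" for y by (rule Cinf_differentiable[OF g that])
  have Fg: "Cinf U (\<lambda>x. F (g x))" by (rule Cinf_compose[OF assms(1-3) F g])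
  have "dderiv k (\<lambda>x. F (g x)) y = (\<Sum>b\<in>Basis. (dderiv k g y \<bullet> b) *\<^sub>R dderiv b F (g y))" if "y \<in> U" for y
    unfolding dderiv_compose[OF F gV[OF that] dg[OF that]]
    by (rule dderiv_expand[OF F gV[OF that]])
  then have "dderiv h (dderiv k (\<lambda>x. F (g x))) x =
      dderiv h (\<lambda>y. \<Sum>b\<in>Basis. (dderiv k g y \<bullet> b) *\<^sub>R dderiv b F (g y)) x"
    by (rule dderiv_cong[OF assms(1) x _ Cinf_differentiable[OF Cinf_dderiv[OF Fg] x]])
  also have "\<dots> = (\<Sum>b\<in>Basis. dderiv h (\<lambda>y. (dderiv k g y \<bullet> b) *\<^sub>R dderiv b F (g y)) x)"
  proof (rule dderiv_sum)
    fix b :: 'b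
    have "Cinf U (\<lambda>y. (dderiv k g y \<bullet> b) *\<^sub>R dderiv b F (g y))"
      by (intro Cinf_scaleR Cinf_inner Cinf_const Cinf_dderiv[OF g] assms(1)
          Cinf_compose[OF assms(1-3) Cinf_dderiv[OF F] g])
    then show "(\<lambda>y. (dderiv k g y \<bullet> b) *\<^sub>R dderiv b F (g y)) differentiable at x"
      by (rule Cinf_differentiable[OF _ x])
  qed
  also have "\<dots> = (\<Sum>b\<in>Basis. (dderiv k g x \<bullet> b) *\<^sub>R dderiv (dderiv h g x) (dderiv b F) (g x) +
      (dderiv h (dderiv k g) x \<bullet> b) *\<^sub>R dderiv b F (g x))"
  proof (rule sum.cong[OF refl])
    fix b :: 'b
    have d1: "dderiv k g differentiable at x" by (rule Cinf_differentiable[OF Cinf_dderiv[OF g] x])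
    have d2: "(\<lambda>y. dderiv k g y \<bullet> b) differentiable at x"
      by (rule Cinf_differentiable[OF Cinf_linear_compose[OF bounded_linear_inner_left assms(1) Cinf_dderiv[OF g]] x])
    have d3: "(\<lambda>y. dderiv b F (g y)) differentiable at x"
      by (rule Cinf_differentiable[OF Cinf_compose[OF assms(1-3) Cinf_dderiv[OF F] g] x])
    show "dderiv h (\<lambda>y. (dderiv k g y \<bullet> b) *\<^sub>R dderiv b F (g y)) x =
      (dderiv k g x \<bullet> b) *\<^sub>R dderiv (dderiv h g x) (dderiv b F) (g x) +
      (dderiv h (dderiv k g) x \<bullet> b) *\<^sub>R dderiv b F (g x)"
      unfolding dderiv_scaleR[OF d2 d3] dderiv_bounded_linear[OF bounded_linear_inner_left d1]
        dderiv_compose[OF Cinf_dderiv[OF F] gV[OF x] dg[OF x]] ..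
  qed
  also have "\<dots> = dderiv (dderiv h g x) (dderiv (dderiv k g x) F) (g x) + dderiv (dderiv h (dderiv k g) x) F (g x)"
  proof -
    have "(\<Sum>b\<in>Basis. (dderiv k g x \<bullet> b) *\<^sub>R dderiv (dderiv h g x) (dderiv b F) (g x)) =
        dderiv (dderiv h g x) (dderiv (\<Sum>b\<in>Basis. (dderiv k g x \<bullet> b) *\<^sub>R b) F) (g x)"
      using linear_sum[OF linear_dderiv2[OF assms(2) F gV[OF x]],
          of "dderiv h g x" "\<lambda>b. (dderiv k g x \<bullet> b) *\<^sub>R b" Basis]
        linear_scale[OF linear_dderiv2[OF assms(2) F gV[OF x]]] by simp
    also have "\<dots> = dderiv (dderiv h g x) (dderiv (dderiv k g x) F) (g x)"
      by (simp only: euclidean_representation)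
    finally show ?thesis
      by (simp only: sum.distrib dderiv_expand[OF F gV[OF x], of "dderiv h (dderiv k g) x"])
  qed
  finally show ?thesis .
qed

subsection \<open>Integration over the sphere\<close>

lemma S2_integral_alt: "S2_integral f = (\<integral>z. f (stereo_inv z) * (4 * (sw z)\<^sup>2) \<partial>lborel)"
  unfolding S2_integral_def sw_def by (simp add: divide_inverse power_inverse)

lemma S2_integral_cong: "(\<And>y. y \<in> S2 \<Longrightarrow> f y = g y) \<Longrightarrow> S2_integral f = S2_integral g"
  unfolding S2_integral_def by (intro Bochner_Integration.integral_cong) auto

lemma continuous_on_stereo_compose:
  assumes "continuous_on S2 f"
  shows "continuous_on UNIV (\<lambda>z. f (stereo_inv z))"
  by (rule continuous_on_compose2[OF assms Cinf_continuous_on[OF Cinf_stereo_inv]]) auto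

lemma S2_integrable:
  fixes f :: "real ^ 3 \<Rightarrow> real"
  assumes f: "continuous_on S2 f"
  shows "integrable lborel (\<lambda>z. f (stereo_inv z) * (4 * (sw z)\<^sup>2))"
proof -
  have "bounded (f ` S2)" by (intro compact_imp_bounded compact_continuous_image f compact_sphere)
  then obtain C where C: "\<And>y. y \<in> S2 \<Longrightarrow> \<bar>f y\<bar> \<le> C" 
    using bounded_iff[of "f ` S2"] by (metis imageI real_norm_def)
  have [measurable]: "(\<lambda>z. f (stereo_inv z)) \<in> borel_measurable borel"
    by (rule borel_measurable_continuous_onI[OF continuous_on_stereo_compose[OF f]])
  show ?thesis
  proof (rule Bochner_Integration.integrable_bound[OF integrable_mult_right[OF integrable_sw_sq, of "4 * C"]])
    show "AE z in lborel. norm (f (stereo_inv z) * (4 * (sw z)\<^sup>2)) \<le> norm (4 * C * (sw z)\<^sup>2)"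
    proof (rule AE_I2)
      fix z
      have "norm (f (stereo_inv z) * (4 * (sw z)\<^sup>2)) = \<bar>f (stereo_inv z)\<bar> * (4 * (sw z)\<^sup>2)"
        by (simp add: abs_mult)
      also have "\<dots> \<le> C * (4 * (sw z)\<^sup>2)" by (intro mult_right_mono C) auto
      also have "\<dots> \<le> norm (4 * C * (sw z)\<^sup>2)" by (simp add: abs_mult mult_right_mono)
      finally show "norm (f (stereo_inv z) * (4 * (sw z)\<^sup>2)) \<le> norm (4 * C * (sw z)\<^sup>2)" .
    qed
  qed measurable
qed

lemma S2_integral_add:
  assumes "continuous_on S2 f" "continuous_on S2 g"
  shows "S2_integral (\<lambda>y. f y + g y) = S2_integral f + S2_integral g"
  unfolding S2_integral_alt using S2_integrable[OF assms(1)] S2_integrable[OF assms(2)]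
  by (simp add: distrib_right)

lemma S2_integral_cmult: "S2_integral (\<lambda>y. c * f y) = c * S2_integral f"
  unfolding S2_integral_alt by (simp add: mult.assoc)

lemma S2_integral_const: "S2_integral (\<lambda>y. c) = 4 * pi * c"
  unfolding S2_integral_alt using integral_sw_sq by simp

lemma stereo_inv_tendsto_north: "((\<lambda>x::real. stereo_inv (of_real x)) \<longlongrightarrow> north) at_top"
proof -
  have eq: "stereo_inv (of_real x) = north + (2 * x / (1 + x\<^sup>2)) *\<^sub>R axis 1 1 - (2 / (1 + x\<^sup>2)) *\<^sub>R north" for x :: real
    by (simp add: stereo_inv_eq sw_def plane_def scaleR_diff_right divide_inverse)
  have "((\<lambda>x::real. 2 * x / (1 + x\<^sup>2)) \<longlongrightarrow> 0) at_top" "((\<lambda>x::real. 2 / (1 + x\<^sup>2)) \<longlongrightarrow> 0) at_top"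
    by real_asymp+
  then have "((\<lambda>x::real. north + (2 * x / (1 + x\<^sup>2)) *\<^sub>R axis 1 1 - (2 / (1 + x\<^sup>2)) *\<^sub>R north)
      \<longlongrightarrow> north + 0 *\<^sub>R axis 1 1 - 0 *\<^sub>R north) at_top"
    by (intro tendsto_intros)
  then show ?thesis unfolding eq by simp
qed

text \<open>The chart misses only the north pole, which is the limit of the image of the positive
  real axis. Identities computed in the chart thereby extend to the whole sphere.\<close>

lemma S2_continuous_eqI:
  fixes f g :: "real ^ 3 \<Rightarrow> 'b::t2_space"
  assumes f: "continuous_on S2 f" and g: "continuous_on S2 g"
    and eq: "\<And>z. f (stereo_inv z) = g (stereo_inv z)" and y: "y \<in> S2"
  shows "f y = g y"
proof (cases "y = north")
  case False
  then show ?thesis using stereo_inv_surj[OF y] eq by metis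
next
  case True
  have north: "north \<in> S2" by (simp add: norm_eq_1)
  have lim: "((\<lambda>x::real. k (stereo_inv (of_real x))) \<longlongrightarrow> k north) at_top" if "continuous_on S2 k" for k :: "real ^ 3 \<Rightarrow> 'b"
    by (rule continuous_on_tendsto_compose[OF that stereo_inv_tendsto_north north]) simp
  show ?thesis
    using tendsto_unique[OF _ lim[OF f] lim[OF g, folded eq]] True by simp
qed

text \<open>The set of chart points where \<open>f\<close> is positive is open and null, hence
  empty; continuity covers the pole.\<close>

lemma S2_integral_eq_0_imp:
  fixes f :: "real ^ 3 \<Rightarrow> real"
  assumes f: "continuous_on S2 f" and nonneg: "\<And>y. y \<in> S2 \<Longrightarrow> f y \<ge> 0" and 0: "S2_integral f = 0" and y: "y \<in> S2"
  shows "f y = 0"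
proof -
  let ?S = "{z. f (stereo_inv z) > 0}"
  have "AE z in lborel. f (stereo_inv z) * (4 * (sw z)\<^sup>2) = 0"
    using integral_nonneg_eq_0_iff_AE[OF S2_integrable[OF f]] 0 nonneg unfolding S2_integral_alt by simp
  then have "AE z in lborel. \<not> f (stereo_inv z) > 0"
    by eventually_elim auto
  moreover have S: "open ?S"
    using continuous_on_stereo_compose[OF f] by (intro open_Collect_less continuous_on_const)
  ultimately have "?S \<in> null_sets lborel"
    by (subst (asm) AE_iff_null) auto
  then have "negligible ?S"
    by (simp add: negligible_iff_null_sets null_sets_completionI)
  then have "?S = {}" using open_not_negligible[OF S] by blast
  then have "f (stereo_inv z) = 0" for z
    using nonneg[of "stereo_inv z"] by (auto simp: set_eq_iff not_less intro: antisym)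
  then show ?thesis
    using S2_continuous_eqI[OF f continuous_on_const _ y] by blast
qed

abbreviation punctured :: "(real ^ 3) set" where
  "punctured \<equiv> - {0}"

lemma punctured [simp]: "open punctured" "S2 \<subseteq> punctured" "stereo_inv z \<noteq> 0"
  using norm_stereo_inv[of z] by (auto simp del: norm_stereo_inv)

text \<open>Dominated convergence: difference quotients are bounded by the maximum of the
  \<open>t\<close>-derivative over the sphere times a compact interval, and the area density is
  integrable.\<close>

lemma DERIV_S2_integral:
  fixes A :: "(real ^ 3) \<times> real \<Rightarrow> real"
  assumes "open I" "t0 \<in> I" and A: "Cinf (punctured \<times> I) A"
  shows "((\<lambda>t. S2_integral (\<lambda>y. A (y, t))) has_real_derivative S2_integral (\<lambda>y. dderiv (0, 1) A (y, t0))) (at t0)"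
proof -
  obtain \<delta> where \<delta>: "\<delta> > 0" "cball t0 \<delta> \<subseteq> I" using open_contains_cball assms(1,2) by blast
  have op: "open (punctured \<times> I)" by (intro open_Times assms(1)) simp
  have cA: "continuous_on (punctured \<times> I) A" "continuous_on (punctured \<times> I) (dderiv (0, 1) A)"
    by (intro Cinf_continuous_on Cinf_dderiv A)+
  have cont: "continuous_on S2 (\<lambda>y. f (y, t))" if "t \<in> I" "continuous_on (punctured \<times> I) f"
    for f :: "(real ^ 3) \<times> real \<Rightarrow> real" and t
    by (rule continuous_on_compose2[OF that(2)]) (use that(1) in \<open>auto intro!: continuous_intros\<close>)
  have "compact (S2 \<times> cball t0 \<delta>)" by (intro compact_Times compact_sphere compact_cball)
  moreover have "S2 \<times> cball t0 \<delta> \<subseteq> punctured \<times> I" using \<delta>(2) by auto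
  ultimately have "bounded (dderiv (0, 1) A ` (S2 \<times> cball t0 \<delta>))"
    by (intro compact_imp_bounded compact_continuous_image continuous_on_subset[OF cA(2)])
  then obtain C where C: "\<And>y t. y \<in> S2 \<Longrightarrow> t \<in> cball t0 \<delta> \<Longrightarrow> \<bar>dderiv (0, 1) A (y, t)\<bar> \<le> C"
    using bounded_iff[of "dderiv (0, 1) A ` (S2 \<times> cball t0 \<delta>)"] by (metis imageI mem_Sigma_iff real_norm_def)
  have der: "((\<lambda>t. A (y, t)) has_real_derivative dderiv (0, 1) A (y, t)) (at t)" if "y \<in> S2" "t \<in> I" for y t
  proof -
    have "(y, 0) + t *\<^sub>R (0, 1) \<in> punctured \<times> I" using that by auto
    from dderiv_along_line[OF A this] show ?thesis by simp
  qed
  define q where "q t z = (A (stereo_inv z, t) - A (stereo_inv z, t0)) / (t - t0) * (4 * (sw z)\<^sup>2)" for t z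
  have q: "(S2_integral (\<lambda>y. A (y, t)) - S2_integral (\<lambda>y. A (y, t0))) / (t - t0) = integral\<^sup>L lborel (q t)" if "t \<in> I" for t
  proof -
    have "S2_integral (\<lambda>y. A (y, t)) - S2_integral (\<lambda>y. A (y, t0)) =
        (\<integral>z. A (stereo_inv z, t) * (4 * (sw z)\<^sup>2) - A (stereo_inv z, t0) * (4 * (sw z)\<^sup>2) \<partial>lborel)"
      unfolding S2_integral_alt
      by (rule Bochner_Integration.integral_diff[symmetric]) (intro S2_integrable cont cA that assms(2))+
    then have "(S2_integral (\<lambda>y. A (y, t)) - S2_integral (\<lambda>y. A (y, t0))) / (t - t0) =
        (\<integral>z. (A (stereo_inv z, t) * (4 * (sw z)\<^sup>2) - A (stereo_inv z, t0) * (4 * (sw z)\<^sup>2)) / (t - t0) \<partial>lborel)"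
      by simp
    also have "\<dots> = integral\<^sup>L lborel (q t)"
      unfolding q_def by (intro Bochner_Integration.integral_cong) (auto simp: left_diff_distrib)
    finally show ?thesis .
  qed
  have "((\<lambda>t. (S2_integral (\<lambda>y. A (y, t)) - S2_integral (\<lambda>y. A (y, t0))) / (t - t0)) \<longlongrightarrow>
      S2_integral (\<lambda>y. dderiv (0, 1) A (y, t0))) (at t0 within ball t0 \<delta>)"
    unfolding tendsto_at_iff_sequentially
  proof (intro allI impI)
    fix X assume X: "\<forall>i. X i \<in> ball t0 \<delta> - {t0}" "X \<longlonglongrightarrow> t0"
    then have XI: "X i \<in> I" "X i \<noteq> t0" "X i \<in> cball t0 \<delta>" for i using \<delta>(2) by (auto simp: less_imp_le subset_iff)
    have meas: "q (X i) \<in> borel_measurable lborel" for i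
    proof -
      have "q (X i) = (\<lambda>z. (A (stereo_inv z, X i) * (4 * (sw z)\<^sup>2) - A (stereo_inv z, t0) * (4 * (sw z)\<^sup>2)) / (X i - t0))"
        by (auto simp: q_def left_diff_distrib)
      then show ?thesis
        using borel_measurable_integrable[OF S2_integrable[OF cont[OF XI(1) cA(1)]]]
          borel_measurable_integrable[OF S2_integrable[OF cont[OF assms(2) cA(1)]]] by simp
    qed
    have "(\<lambda>i. integral\<^sup>L lborel (q (X i))) \<longlonglongrightarrow> (\<integral>z. dderiv (0, 1) A (stereo_inv z, t0) * (4 * (sw z)\<^sup>2) \<partial>lborel)"
    proof (rule integral_dominated_convergence[where w = "\<lambda>z. 4 * C * (sw z)\<^sup>2"])
      show "(\<lambda>z. dderiv (0, 1) A (stereo_inv z, t0) * (4 * (sw z)\<^sup>2)) \<in> borel_measurable lborel"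
        using S2_integrable[OF cont[OF assms(2) cA(2)]] by (rule borel_measurable_integrable)
      show "integrable lborel (\<lambda>z. 4 * C * (sw z)\<^sup>2)" by (intro integrable_mult_right integrable_sw_sq)
      show "AE z in lborel. (\<lambda>i. q (X i) z) \<longlonglongrightarrow> dderiv (0, 1) A (stereo_inv z, t0) * (4 * (sw z)\<^sup>2)"
      proof (rule AE_I2)
        fix z
        have "((\<lambda>t. (A (stereo_inv z, t) - A (stereo_inv z, t0)) / (t - t0)) \<longlongrightarrow> dderiv (0, 1) A (stereo_inv z, t0)) (at t0)"
          using der[of "stereo_inv z" t0] assms(2) by (simp add: has_field_derivative_iff)
        then have "(\<lambda>i. (A (stereo_inv z, X i) - A (stereo_inv z, t0)) / (X i - t0)) \<longlonglongrightarrow> dderiv (0, 1) A (stereo_inv z, t0)"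
          using X(2) XI(2) by (auto simp: tendsto_at_iff_sequentially o_def)
        then show "(\<lambda>i. q (X i) z) \<longlonglongrightarrow> dderiv (0, 1) A (stereo_inv z, t0) * (4 * (sw z)\<^sup>2)"
          unfolding q_def by (intro tendsto_mult tendsto_const)
      qed
      show "AE z in lborel. norm (q (X i) z) \<le> 4 * C * (sw z)\<^sup>2" for i
      proof (rule AE_I2)
        fix z
        have "norm (A (stereo_inv z, X i) - A (stereo_inv z, t0)) \<le> C * norm (X i - t0)"
        proof (rule field_differentiable_bound[of "cball t0 \<delta>" "\<lambda>t. A (stereo_inv z, t)" "\<lambda>t. dderiv (0, 1) A (stereo_inv z, t)"])
          show "((\<lambda>t. A (stereo_inv z, t)) has_field_derivative dderiv (0, 1) A (stereo_inv z, t)) (at t within cball t0 \<delta>)"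
            if "t \<in> cball t0 \<delta>" for t
            by (rule has_field_derivative_at_within[OF der[OF stereo_inv_in_S2 subsetD[OF \<delta>(2) that]]])
          show "norm (dderiv (0, 1) A (stereo_inv z, t)) \<le> C" if "t \<in> cball t0 \<delta>" for t
            using C[of "stereo_inv z" t] that by simp
        qed (use XI \<delta>(1) in auto)
        then have "norm ((A (stereo_inv z, X i) - A (stereo_inv z, t0)) / (X i - t0)) \<le> C"
          using XI(2)[of i] by (simp add: abs_divide divide_le_eq)
        then have "norm ((A (stereo_inv z, X i) - A (stereo_inv z, t0)) / (X i - t0)) * (4 * (sw z)\<^sup>2) \<le> C * (4 * (sw z)\<^sup>2)"
          by (rule mult_right_mono) simp
        then show "norm (q (X i) z) \<le> 4 * C * (sw z)\<^sup>2"
          by (simp add: q_def abs_mult mult_ac)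
      qed
    qed (rule meas)
    then show "((\<lambda>t. (S2_integral (\<lambda>y. A (y, t)) - S2_integral (\<lambda>y. A (y, t0))) / (t - t0)) \<circ> X)
        \<longlonglongrightarrow> S2_integral (\<lambda>y. dderiv (0, 1) A (y, t0))"
      unfolding o_def q[OF XI(1)] S2_integral_alt[of "\<lambda>y. dderiv (0, 1) A (y, t0)"] .
  qed
  then show ?thesis
    using \<delta>(1) by (simp add: has_field_derivative_iff at_within_open[of t0 "ball t0 \<delta>"])
qed

lemma Cinf_continuous_on_S2: "Cinf punctured F \<Longrightarrow> continuous_on S2 F"
  by (rule continuous_on_subset[OF Cinf_continuous_on punctured(2)])

lemma dderiv_bounded_on_S2:
  fixes G :: "real ^ 3 \<Rightarrow> 'b::real_normed_vector"
  assumes G: "Cinf punctured G"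
  obtains C where "C \<ge> 0" "\<And>y v. y \<in> S2 \<Longrightarrow> norm (dderiv v G y) \<le> C * norm v"
proof -
  have "\<exists>c. \<forall>y\<in>S2. norm (dderiv b G y) \<le> c" for b
  proof -
    have "bounded (dderiv b G ` S2)"
      by (intro compact_imp_bounded compact_continuous_image compact_sphere Cinf_continuous_on_S2 Cinf_dderiv G)
    then show ?thesis unfolding bounded_iff by blast
  qed
  then obtain c where c: "\<And>b y. y \<in> S2 \<Longrightarrow> norm (dderiv b G y) \<le> c b" by metis
  have north: "north \<in> S2" by (simp add: norm_eq_1)
  have c0: "c b \<ge> 0" for b using c[OF north, of b] norm_ge_zero order_trans by blast
  show ?thesis
  proof (rule that[of "\<Sum>b\<in>Basis. c b"])
    show "(\<Sum>b\<in>Basis. c b) \<ge> 0" by (intro sum_nonneg c0)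
    fix y v :: "real ^ 3" assume y: "y \<in> S2"
    then have yp: "y \<in> punctured" by auto
    have "norm (dderiv v G y) = norm (\<Sum>b\<in>Basis. (v \<bullet> b) *\<^sub>R dderiv b G y)"
      by (rule arg_cong[OF dderiv_expand[OF G yp]])
    also have "\<dots> \<le> (\<Sum>b\<in>Basis. c b * norm v)"
    proof (rule sum_norm_le)
      fix b :: "real ^ 3" assume "b \<in> Basis"
      then show "norm ((v \<bullet> b) *\<^sub>R dderiv b G y) \<le> c b * norm v"
        using mult_mono[OF Basis_le_norm[of b v] c[OF y, of b]] by (simp add: mult.commute)
    qed
    also have "\<dots> = (\<Sum>b\<in>Basis. c b) * norm v" by (simp add: sum_distrib_right)
    finally show "norm (dderiv v G y) \<le> (\<Sum>b\<in>Basis. c b) * norm v" .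
  qed
qed

text \<open>In the chart the divergence density becomes a sum of two partial derivatives of
  functions on the plane, each with integral 0. The decay estimates exclude a contribution from the
  pole at infinity.\<close>

theorem S2_divergence:
  fixes V :: "real ^ 3 \<Rightarrow> real ^ 3"
  assumes V: "Cinf punctured V" and tan: "\<And>y. y \<noteq> 0 \<Longrightarrow> V y \<bullet> y = 0"
  shows "S2_integral (\<lambda>y. \<Sum>i\<in>Basis. dderiv i V y \<bullet> i) = 0"
proof -
  let ?s = "\<lambda>h. dderiv h stereo_inv"
  define a where "a h z = V (stereo_inv z) \<bullet> ?s h z" for h z
  have s: "Cinf UNIV stereo_inv" "Cinf UNIV (?s h)" for h by (intro Cinf_stereo_inv Cinf_dderiv)+
  have VS: "Cinf UNIV (\<lambda>z. V (stereo_inv z))"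
    by (rule Cinf_compose[OF _ _ _ V s(1)]) auto
  have a: "Cinf UNIV (a h)" for h
    unfolding a_def by (intro Cinf_inner VS s) simp
  have "bounded (V ` S2)"
    by (intro compact_imp_bounded compact_continuous_image compact_sphere Cinf_continuous_on_S2 V)
  then obtain c where "\<And>y. y \<in> S2 \<Longrightarrow> norm (V y) \<le> c"
    unfolding bounded_iff by blast
  then obtain C0 where C0: "C0 \<ge> 0" "\<And>y. y \<in> S2 \<Longrightarrow> norm (V y) \<le> C0"
    using that[of "max 0 c"] by (metis max.cobounded1 max.coboundedI2)
  obtain C1 where "C1 \<ge> 0" and C1: "\<And>y v. y \<in> S2 \<Longrightarrow> norm (dderiv v V y) \<le> C1 * norm v"
    using dderiv_bounded_on_S2[OF V] by blast
  have da: "dderiv h (a h) z = dderiv (?s h z) V (stereo_inv z) \<bullet> ?s h z + V (stereo_inv z) \<bullet> dderiv h (?s h) z" for h z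
  proof -
    have "dderiv h (a h) z = V (stereo_inv z) \<bullet> dderiv h (?s h) z + dderiv h (\<lambda>z. V (stereo_inv z)) z \<bullet> ?s h z"
      unfolding a_def by (rule dderiv_inner[OF Cinf_differentiable[OF VS] Cinf_differentiable[OF s(2)]]) auto
    also have "dderiv h (\<lambda>z. V (stereo_inv z)) z = dderiv (?s h z) V (stereo_inv z)"
      by (rule dderiv_compose[OF V _ Cinf_differentiable[OF s(1)]]) auto
    finally show ?thesis by (simp add: add.commute)
  qed
  \<comment> \<open>One constant for both hypotheses of \<open>integral_dderiv_eq_0\<close>:
    \<open>2 * C0\<close> serves the function, \<open>4 * C1 + 28 * C0\<close> its
    derivative.\<close>
  define C where "C = 2 * C0 + 4 * C1 + 28 * C0"
  have C: "2 * C0 \<le> C" using C0 \<open>C1 \<ge> 0\<close> by (simp add: C_def)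
  have a0: "\<bar>a h z\<bar> \<le> C * sw z" if "norm h = 1" for h z
  proof -
    have "\<bar>a h z\<bar> \<le> norm (V (stereo_inv z)) * norm (?s h z)" unfolding a_def by (rule Cauchy_Schwarz_ineq2)
    also have "\<dots> \<le> C0 * (2 * sw z)"
      unfolding norm_stereo_inv_dderiv[OF that] by (intro mult_right_mono C0) (auto simp: less_imp_le)
    also have "\<dots> = 2 * C0 * sw z" by simp
    also have "\<dots> \<le> C * sw z" by (intro mult_right_mono C) (simp add: less_imp_le)
    finally show ?thesis .
  qed
  have a1: "\<bar>dderiv h (a h) z\<bar> \<le> C * (sw z * sqrt (sw z))" if h: "norm h = 1" for h z
  proof -
    have "\<bar>dderiv (?s h z) V (stereo_inv z) \<bullet> ?s h z\<bar> \<le> norm (dderiv (?s h z) V (stereo_inv z)) * norm (?s h z)"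
      by (rule Cauchy_Schwarz_ineq2)
    also have "\<dots> \<le> (C1 * norm (?s h z)) * norm (?s h z)" by (intro mult_right_mono C1) auto
    also have "\<dots> = 4 * C1 * (sw z)\<^sup>2" unfolding norm_stereo_inv_dderiv[OF h] by (simp add: power2_eq_square)
    also have "\<dots> \<le> 4 * C1 * (sw z * sqrt (sw z))" using \<open>C1 \<ge> 0\<close> by (intro mult_left_mono sw_sq_le) auto
    finally have 1: "\<bar>dderiv (?s h z) V (stereo_inv z) \<bullet> ?s h z\<bar> \<le> 4 * C1 * (sw z * sqrt (sw z))" .
    have "\<bar>V (stereo_inv z) \<bullet> dderiv h (?s h) z\<bar> \<le> norm (V (stereo_inv z)) * norm (dderiv h (?s h) z)"
      by (rule Cauchy_Schwarz_ineq2)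
    also have "\<dots> \<le> C0 * (28 * (sw z * sqrt (sw z)))"
      by (intro mult_mono C0 stereo_inv_dderiv2_bound h) auto
    finally have 2: "\<bar>V (stereo_inv z) \<bullet> dderiv h (?s h) z\<bar> \<le> 28 * C0 * (sw z * sqrt (sw z))" by simp
    have "\<bar>dderiv h (a h) z\<bar> \<le> (4 * C1 + 28 * C0) * (sw z * sqrt (sw z))"
      unfolding da distrib_right using 1 2 by linarith
    also have "\<dots> \<le> C * (sw z * sqrt (sw z))"
      using C0(1) by (intro mult_right_mono) (auto simp: C_def less_imp_le)
    finally show ?thesis .
  qed
  have int: "integrable lborel (dderiv h (a h))" "integral\<^sup>L lborel (dderiv h (a h)) = 0" if "h = 1 \<or> h = \<i>" for h
    using integral_dderiv_eq_0[OF a a0 a1 that] that by auto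
  have "(\<Sum>i\<in>Basis. dderiv i V y \<bullet> i) * (4 * (sw z)\<^sup>2) = dderiv 1 (a 1) z + dderiv \<i> (a \<i>) z"
    if y: "y = stereo_inv z" for z y
  proof -
    have yp: "y \<in> punctured" by (simp add: y)
    have lin: "linear (\<lambda>v. dderiv v V y)" by (rule linear_dderiv[OF V yp])
    have bil: "bilinear (\<lambda>p q. dderiv p V y \<bullet> q)"
      unfolding bilinear_def
      by (auto intro!: linearI simp: linear_add[OF lin] linear_scale[OF lin] inner_add_left inner_add_right)
    \<comment> \<open>Differentiating tangency in the radial direction shows that the radial term of
      the Euclidean trace vanishes, so only the tangential trace remains.\<close>
    have "dderiv y (\<lambda>x. V x \<bullet> x) y = dderiv y (\<lambda>x. 0) y"
      by (rule dderiv_cong[of punctured]) (use yp tan in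
        \<open>auto intro!: Cinf_differentiable[OF Cinf_inner[OF _ V Cinf_ident]]\<close>)
    moreover have "dderiv y (\<lambda>x. V x \<bullet> x) y = V y \<bullet> y + dderiv y V y \<bullet> y"
      by (subst dderiv_inner[OF Cinf_differentiable[OF V yp] differentiable_ident])
        (simp add: dderiv_eqI[OF has_derivative_ident])
    ultimately have "dderiv y V y \<bullet> y = 0"
      using tan[of y] yp by (simp add: dderiv_def)
    \<comment> \<open>The second-derivative terms of the chart add up to a multiple of
      \<open>y\<close>, to which \<open>V y\<close> is orthogonal.\<close>
    moreover have "V y \<bullet> dderiv 1 (?s 1) z + V y \<bullet> dderiv \<i> (?s \<i>) z = 0"
      using tan[of y] yp stereo_inv_laplace[of z] y by (simp add: inner_add_right[symmetric])
    ultimately show ?thesis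
      using trace_stereo[OF bil, of z] by (simp add: da y mult.commute)
  qed
  then show ?thesis
    unfolding S2_integral_alt using int by simp
qed

subsection \<open>Radial extension and the Laplacian of the sphere\<close>

definition lap :: "(real ^ 3 \<Rightarrow> 'b::real_normed_vector) \<Rightarrow> real ^ 3 \<Rightarrow> 'b" where
  "lap F y = (\<Sum>i\<in>Basis. dderiv i (dderiv i F) y)"

definition grad_sq :: "(real ^ 3 \<Rightarrow> 'b::real_inner) \<Rightarrow> real ^ 3 \<Rightarrow> real" where
  "grad_sq F y = (\<Sum>i\<in>Basis. dderiv i F y \<bullet> dderiv i F y)"

definition radial :: "(real ^ 3 \<Rightarrow> 'b) \<Rightarrow> real ^ 3 \<Rightarrow> 'b" where
  "radial f y = f (sgn y)"

lemma sgn_S2: "y \<in> S2 \<Longrightarrow> sgn y = y"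
  by (simp add: sgn_div_norm)

lemma sgn_in_S2: "y \<noteq> 0 \<Longrightarrow> sgn y \<in> S2"
  by (simp add: norm_sgn)

lemma sgn_punctured: "sgn ` punctured \<subseteq> S2"
  using sgn_in_S2 by blast

lemma norm_sphere_map:
  assumes "f ` S2 \<subseteq> sphere 0 1" "y \<in> S2"
  shows "norm (f y) = 1"
proof -
  have "f y \<in> sphere 0 1" using assms by blast
  then show ?thesis by simp
qed

lemma sgn_unit: "norm a = 1 \<Longrightarrow> sgn a = a"
  by (simp add: sgn_div_norm)

lemma radial_S2: "y \<in> S2 \<Longrightarrow> radial f y = f y"
  by (simp add: radial_def sgn_S2)

lemma radial_stereo_inv [simp]: "radial f (stereo_inv z) = f (stereo_inv z)"
  by (simp add: radial_S2)

lemma Cinf_radial: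
  assumes "smooth_on S2 f"
  shows "Cinf punctured (radial f)"
  unfolding radial_def
  by (rule Cinf_smooth_on_compose[OF assms _ Cinf_sgn[OF _ Cinf_ident] sgn_punctured]) auto

lemma smooth_onI_radial: "Cinf punctured F \<Longrightarrow> (\<And>y. y \<in> S2 \<Longrightarrow> F y = f y) \<Longrightarrow> smooth_on S2 f"
  using smooth_on_cong[OF Cinf_imp_smooth_on[OF punctured(1,2)]] by metis

lemma Cinf_lap: "Cinf punctured F \<Longrightarrow> Cinf punctured (lap F)"
  unfolding lap_def[abs_def] by (intro Cinf_sum Cinf_dderiv) simp_all

lemma Cinf_grad_sq: "Cinf punctured F \<Longrightarrow> Cinf punctured (grad_sq F)"
  unfolding grad_sq_def[abs_def] by (intro Cinf_sum Cinf_inner Cinf_dderiv) simp_all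

lemma dderiv_compose':
  assumes "Cinf V f" "g x \<in> V" "(g has_derivative g') (at x)"
  shows "dderiv v (\<lambda>x. f (g x)) x = dderiv (g' v) f (g x)"
  using has_derivative_compose[OF assms(3) Cinf_has_derivative[OF assms(1,2)]]
  by (rule dderiv_eqI)

lemma lap_cong:
  assumes F: "Cinf punctured F" and eq: "\<And>y. y \<noteq> 0 \<Longrightarrow> F y = G y" and y: "y \<noteq> 0"
  shows "lap F y = lap G y"
  unfolding lap_def
proof (rule sum.cong[OF refl])
  fix i :: "real ^ 3"
  have "dderiv i F x = dderiv i G x" if "x \<in> punctured" for x
    by (rule dderiv_cong[OF punctured(1) that _ Cinf_differentiable[OF F that]]) (use eq in auto)
  then show "dderiv i (dderiv i F) y = dderiv i (dderiv i G) y"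
    by (intro dderiv_cong[OF punctured(1) _ _ Cinf_differentiable[OF Cinf_dderiv[OF F]]]) (use y in auto)
qed

lemma dderiv_ray_eq_0:
  fixes G :: "real ^ 3 \<Rightarrow> 'b::real_normed_vector"
  assumes G: "Cinf punctured G" and const: "\<And>s. s > 0 \<Longrightarrow> G (s *\<^sub>R p) = k" and "p \<noteq> 0" "c > 0"
  shows "dderiv p G (c *\<^sub>R p) = 0"
proof -
  have "dderiv 1 (\<lambda>s. G (s *\<^sub>R p)) c = dderiv (1 *\<^sub>R p) G (c *\<^sub>R p)"
    by (rule dderiv_compose'[OF G]) (use assms(3,4) in \<open>auto intro!: derivative_eq_intros\<close>)
  moreover have "dderiv 1 (\<lambda>s. k) c = dderiv 1 (\<lambda>s. G (s *\<^sub>R p)) c"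
    by (rule dderiv_cong[of "{0<..}"]) (use const \<open>c > 0\<close> in auto)
  moreover have "dderiv 1 (\<lambda>s. k) c = 0" by (simp add: dderiv_def)
  ultimately show ?thesis by simp
qed

text \<open>The first derivative in direction \<open>p\<close> vanishes at every point of the ray
  through \<open>p\<close>, not only at \<open>p\<close>; hence it is itself constant along the ray
  and can be differentiated once more.\<close>

lemma radial_ray:
  assumes F: "Cinf punctured (radial f)" and "p \<noteq> 0"
  shows "dderiv p (radial f) p = 0" "dderiv p (dderiv p (radial f)) p = 0"
proof -
  have 1: "dderiv p (radial f) (c *\<^sub>R p) = 0" if "c > 0" for c
    by (rule dderiv_ray_eq_0[OF F _ \<open>p \<noteq> 0\<close> that, of "radial f p"]) (simp add: radial_def sgn_scaleR)
  show "dderiv p (radial f) p = 0" using 1[of 1] by simp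
  show "dderiv p (dderiv p (radial f)) p = 0"
    using dderiv_ray_eq_0[OF Cinf_dderiv[OF F] 1 \<open>p \<noteq> 0\<close>, of 1] by simp
qed

text \<open>Conformal invariance of the Laplacian in dimension two. The first-order term of the
  chain rule is a radial derivative by \<open>stereo_inv_laplace\<close>, and the Hessian has no
  radial part; both vanish for a function constant along rays.\<close>

lemma lap_stereo:
  assumes F: "Cinf punctured (radial f)"
  shows "(4 * (sw z)\<^sup>2) *\<^sub>R lap (radial f) (stereo_inv z) =
    dderiv 1 (dderiv 1 (\<lambda>z. f (stereo_inv z))) z + dderiv \<i> (dderiv \<i> (\<lambda>z. f (stereo_inv z))) z"
proof -
  let ?y = "stereo_inv z"
  have y: "?y \<in> punctured" by simp
  have eq: "(\<lambda>z. f (stereo_inv z)) = (\<lambda>z. radial f (stereo_inv z))" by simp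
  have lin: "linear (\<lambda>v. dderiv v (radial f) ?y)" by (rule linear_dderiv[OF F y])
  have c: "dderiv h (dderiv k (\<lambda>z. f (stereo_inv z))) z =
      dderiv (dderiv h stereo_inv z) (dderiv (dderiv k stereo_inv z) (radial f)) ?y +
      dderiv (dderiv h (dderiv k stereo_inv) z) (radial f) ?y" for h k
    unfolding eq by (rule dderiv2_compose[OF open_UNIV punctured(1) _ F Cinf_stereo_inv]) auto
  have "dderiv (dderiv 1 (dderiv 1 stereo_inv) z) (radial f) ?y + dderiv (dderiv \<i> (dderiv \<i> stereo_inv) z) (radial f) ?y = 0"
    unfolding linear_add[OF lin, symmetric] stereo_inv_laplace linear_scale[OF lin] radial_ray(1)[OF F punctured(3)]
    by simp
  then have "dderiv 1 (dderiv 1 (\<lambda>z. f (stereo_inv z))) z + dderiv \<i> (dderiv \<i> (\<lambda>z. f (stereo_inv z))) z =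
     dderiv (dderiv 1 stereo_inv z) (dderiv (dderiv 1 stereo_inv z) (radial f)) ?y +
     dderiv (dderiv \<i> stereo_inv z) (dderiv (dderiv \<i> stereo_inv z) (radial f)) ?y"
    unfolding c by (simp add: algebra_simps)
  also have "\<dots> = (4 * (sw z)\<^sup>2) *\<^sub>R lap (radial f) ?y"
    using trace_stereo[OF bilinear_dderiv2[OF punctured(1) F y], of z] radial_ray(2)[OF F punctured(3)]
    unfolding lap_def by simp
  finally show ?thesis by simp
qed

lemma bilinear_dderiv_inner:
  fixes F :: "'a::euclidean_space \<Rightarrow> 'b::real_inner"
  assumes "Cinf U F" "y \<in> U"
  shows "bilinear (\<lambda>p q. dderiv p F y \<bullet> dderiv q F y)"
  unfolding bilinear_def
  by (auto intro!: linearI simp: linear_add[OF linear_dderiv[OF assms]] linear_scale[OF linear_dderiv[OF assms]]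
      inner_add_left inner_add_right)

subsection \<open>The energy and its first variation\<close>

lemma sgn_has_derivative:
  fixes y :: "'a::euclidean_space"
  assumes "norm y = 1"
  shows "(sgn has_derivative (\<lambda>v. v - (y \<bullet> v) *\<^sub>R y)) (at y)"
proof -
  have "((\<lambda>x. inverse (norm x) *\<^sub>R x) has_derivative (\<lambda>v. v - (y \<bullet> v) *\<^sub>R y)) (at y)"
    using assms by (auto intro!: derivative_eq_intros has_derivative_norm[THEN has_derivative_eq_rhs] simp: sgn_div_norm inner_commute[of _ y])
  then show ?thesis by (simp add: sgn_div_norm[abs_def])
qed

text \<open>A derivative within the sphere is determined only on tangent vectors. Composing with
  \<open>sgn\<close>, whose derivative at \<open>y\<close> is the tangential projection, turns any
  choice of it into the unique derivative of the radial extension.\<close>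

lemma norm_differential_sq_eq:
  fixes f :: "real ^ 3 \<Rightarrow> real ^ 'm"
  assumes f: "smooth_on S2 f" and y: "y \<in> S2"
  shows "norm_differential_sq f y = grad_sq (radial f) y"
proof -
  have F: "Cinf punctured (radial f)" by (rule Cinf_radial[OF f])
  have yp: "y \<in> punctured" "y \<noteq> 0" "norm y = 1" using y by auto
  have "(radial f has_derivative (\<lambda>v. dderiv v (radial f) y)) (at y within S2)"
    by (rule has_derivative_at_withinI[OF Cinf_has_derivative[OF F yp(1)]])
  then have "(f has_derivative (\<lambda>v. dderiv v (radial f) y)) (at y within S2)"
    by (rule has_derivative_transform[OF y, rotated]) (simp add: radial_S2)
  then have "f differentiable (at y within S2)"
    by (rule differentiableI)
  then have D: "(f has_derivative differential f y) (at y within S2)"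
    unfolding differential_def frechet_derivative_works .
  from D sgn_punctured have D': "(f has_derivative differential f y) (at (sgn y) within sgn ` punctured)"
    unfolding sgn_S2[OF y] by (rule has_derivative_subset)
  have "((\<lambda>x. f (sgn x)) has_derivative (\<lambda>v. differential f y (v - (y \<bullet> v) *\<^sub>R y))) (at y within punctured)"
    by (rule has_derivative_in_compose[OF has_derivative_at_withinI[OF sgn_has_derivative[OF yp(3)]] D'])
  then have "(radial f has_derivative (\<lambda>v. differential f y (v - (y \<bullet> v) *\<^sub>R y))) (at y)"
    unfolding radial_def[abs_def] at_within_open[OF yp(1) punctured(1)] .
  then have dd: "dderiv v (radial f) y = differential f y (v - (y \<bullet> v) *\<^sub>R y)" for v
    by (rule dderiv_eqI)
  define B where "B = (SOME B. tangent_frame y B)"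
  have B: "tangent_frame y B"
    unfolding B_def by (rule someI_ex[OF tangent_frame_exists])
  have perp: "y \<bullet> e = 0" if "e \<in> B" for e
    using B span_base[OF that] unfolding tangent_frame_def by blast
  have "norm_differential_sq f y = (\<Sum>e\<in>B. dderiv e (radial f) y \<bullet> dderiv e (radial f) y)"
    unfolding norm_differential_sq_def B_def[symmetric]
    by (intro sum.cong refl) (simp add: dd perp power2_norm_eq_inner)
  also have "\<dots> = grad_sq (radial f) y"
    using trace_tangent_frame[OF bilinear_dderiv_inner[OF F yp(1)] y B] radial_ray(1)[OF F yp(2)]
    unfolding grad_sq_def by simp
  finally show ?thesis .
qed

lemma energy_eq:
  fixes f :: "real ^ 3 \<Rightarrow> real ^ 'm"
  assumes "smooth_on S2 f"
  shows "energy f = 1 / 2 * S2_integral (grad_sq (radial f))"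
  unfolding energy_def using S2_integral_cong[OF norm_differential_sq_eq[OF assms]] by simp

text \<open>The divergence theorem is applied to the field with components
  \<open>dderiv i (radial f) y \<bullet> W y\<close>. It is tangential because the radial extension
  has no radial derivative, whatever \<open>W\<close> is.\<close>

lemma S2_green:
  fixes f :: "real ^ 3 \<Rightarrow> 'b::euclidean_space"
  assumes F: "Cinf punctured (radial f)" and W: "Cinf punctured W"
  shows "S2_integral (\<lambda>y. \<Sum>i\<in>Basis. dderiv i (radial f) y \<bullet> dderiv i W y) = - S2_integral (\<lambda>y. lap (radial f) y \<bullet> W y)"
proof -
  define V where "V y = (\<Sum>i\<in>Basis. (dderiv i (radial f) y \<bullet> W y) *\<^sub>R i)" for y
  have FW: "Cinf punctured (\<lambda>y. dderiv i (radial f) y \<bullet> W y)" for i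
    by (intro Cinf_inner Cinf_dderiv F W) simp
  have V: "Cinf punctured V"
    unfolding V_def by (intro Cinf_sum Cinf_scaleR FW) (simp_all add: Cinf_const)
  have "V y \<bullet> y = 0" if "y \<noteq> 0" for y
  proof -
    have yp: "y \<in> punctured" using that by simp
    have "V y \<bullet> y = (\<Sum>i\<in>Basis. (y \<bullet> i) *\<^sub>R dderiv i (radial f) y) \<bullet> W y"
      by (simp add: V_def inner_sum_left inner_commute[of y] mult.commute)
    also have "\<dots> = dderiv y (radial f) y \<bullet> W y"
      by (simp only: dderiv_expand[OF F yp, of y, symmetric])
    finally show ?thesis by (simp add: radial_ray(1)[OF F that])
  qed
  then have 0: "S2_integral (\<lambda>y. \<Sum>i\<in>Basis. dderiv i V y \<bullet> i) = 0"
    by (rule S2_divergence[OF V])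
  have "(\<Sum>j\<in>Basis. dderiv j V y \<bullet> j) =
      (\<Sum>i\<in>Basis. dderiv i (radial f) y \<bullet> dderiv i W y) + lap (radial f) y \<bullet> W y" if "y \<in> S2" for y
  proof -
    have yp: "y \<in> punctured" using that by auto
    have "dderiv j V y \<bullet> j = dderiv j (radial f) y \<bullet> dderiv j W y + dderiv j (dderiv j (radial f)) y \<bullet> W y"
      if j: "j \<in> Basis" for j
    proof -
      have "dderiv j V y \<bullet> j = dderiv j (\<lambda>y. V y \<bullet> j) y"
        by (rule dderiv_bounded_linear[OF bounded_linear_inner_left Cinf_differentiable[OF V yp], symmetric])
      also have "(\<lambda>y. V y \<bullet> j) = (\<lambda>y. dderiv j (radial f) y \<bullet> W y)"
        using j by (simp add: V_def inner_sum_left inner_Basis if_distrib cong: if_cong)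
      also have "dderiv j (\<lambda>y. dderiv j (radial f) y \<bullet> W y) y =
          dderiv j (radial f) y \<bullet> dderiv j W y + dderiv j (dderiv j (radial f)) y \<bullet> W y"
        by (rule dderiv_inner[OF Cinf_differentiable[OF Cinf_dderiv[OF F] yp] Cinf_differentiable[OF W yp]])
      finally show ?thesis .
    qed
    then show ?thesis by (simp add: lap_def inner_sum_left sum.distrib)
  qed
  then have "S2_integral (\<lambda>y. (\<Sum>i\<in>Basis. dderiv i (radial f) y \<bullet> dderiv i W y) + lap (radial f) y \<bullet> W y) = 0"
    unfolding 0[symmetric] by (rule S2_integral_cong[symmetric])
  moreover have "Cinf punctured (\<lambda>y. \<Sum>i\<in>Basis. dderiv i (radial f) y \<bullet> dderiv i W y)"
    "Cinf punctured (\<lambda>y. lap (radial f) y \<bullet> W y)"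
    by (intro Cinf_sum Cinf_inner Cinf_dderiv Cinf_lap F W punctured)+
  ultimately show ?thesis
    using S2_integral_add[OF Cinf_continuous_on_S2 Cinf_continuous_on_S2] by fastforce
qed

lemma Cinf_variation:
  assumes "smooth_on (S2 \<times> J) (\<lambda>(x, t). \<Phi> t x)" "open J"
  shows "Cinf (punctured \<times> J) (\<lambda>(y, t). \<Phi> t (sgn y))"
proof -
  have op: "open (punctured \<times> J)" by (intro open_Times assms(2)) simp
  have 1: "Cinf (punctured \<times> J) (\<lambda>p. (sgn (fst p), snd p))"
    by (intro Cinf_intros op) auto
  have 2: "(\<lambda>p. (sgn (fst p), snd p)) ` (punctured \<times> J) \<subseteq> S2 \<times> J"
    by (rule image_subsetI) (use sgn_in_S2 in \<open>auto simp: mem_Times_iff simp del: mem_sphere\<close>)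
  show ?thesis
    using Cinf_smooth_on_compose[OF assms(1) op 1 2] by (simp add: case_prod_unfold)
qed

lemma Cinf_slice:
  fixes c :: "'c::euclidean_space"
  assumes "Cinf (punctured \<times> J) H" "c \<in> J" "open J"
  shows "Cinf punctured (\<lambda>y. H (y, c))"
  by (rule Cinf_compose[OF _ _ _ assms(1)])
    (use assms in \<open>auto intro!: Cinf_intros open_Times\<close>)

lemma dderiv_slice:
  fixes c :: "'c::euclidean_space"
  assumes "Cinf (punctured \<times> J) H" "c \<in> J" "y \<noteq> 0"
  shows "dderiv h (\<lambda>y. H (y, c)) y = dderiv (h, 0) H (y, c)"
  by (rule dderiv_compose'[OF assms(1)]) (use assms in \<open>auto intro!: derivative_eq_intros\<close>)

lemma lap_slice:
  fixes c :: "'c::euclidean_space"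
  assumes H: "Cinf (punctured \<times> J) H" and c: "c \<in> J" and y: "y \<noteq> 0" and J: "open J"
  shows "lap (\<lambda>y. H (y, c)) y = (\<Sum>i\<in>Basis. dderiv (i, 0) (dderiv (i, 0) H) (y, c))"
  unfolding lap_def
proof (rule sum.cong[OF refl])
  fix i :: "real ^ 3"
  have "dderiv i (dderiv i (\<lambda>y. H (y, c))) y = dderiv i (\<lambda>y. dderiv (i, 0) H (y, c)) y"
    by (rule dderiv_cong[OF punctured(1) _ _ Cinf_differentiable[OF Cinf_dderiv[OF Cinf_slice[OF H c J]]]])
      (use y dderiv_slice[OF H c] in auto)
  also have "\<dots> = dderiv (i, 0) (dderiv (i, 0) H) (y, c)"
    by (rule dderiv_slice[OF Cinf_dderiv[OF H] c y])
  finally show "dderiv i (dderiv i (\<lambda>y. H (y, c))) y = dderiv (i, 0) (dderiv (i, 0) H) (y, c)" .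
qed

text \<open>Differentiate the energy density under the integral, exchange the parameter derivative
  with the spatial ones, and integrate by parts. It serves harmonicity and also, at each fixed first
  parameter, the inner derivative of the second variation.\<close>

theorem first_variation:
  fixes \<Phi> :: "real \<Rightarrow> real ^ 3 \<Rightarrow> real ^ 'm"
  assumes sm: "smooth_on (S2 \<times> J) (\<lambda>(x, t). \<Phi> t x)" and J: "open J" "t0 \<in> J"
  shows "((\<lambda>t. energy (\<Phi> t)) has_real_derivative
    - S2_integral (\<lambda>y. lap (radial (\<Phi> t0)) y \<bullet> dderiv (0, 1) (\<lambda>(y, t). \<Phi> t (sgn y)) (y, t0))) (at t0)"
proof -
  define H where "H = (\<lambda>(y, t). \<Phi> t (sgn y))"
  have H: "Cinf (punctured \<times> J) H"
    unfolding H_def by (rule Cinf_variation[OF sm J(1)])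
  have radial_eq: "radial (\<Phi> t) = (\<lambda>y. H (y, t))" for t
    by (auto simp: radial_def H_def)
  have F: "Cinf punctured (radial (\<Phi> t))" if "t \<in> J" for t
    unfolding radial_eq by (rule Cinf_slice[OF H that J(1)])
  have W: "Cinf punctured (\<lambda>y. dderiv (0, 1) H (y, t0))"
    by (rule Cinf_slice[OF Cinf_dderiv[OF H] J(2,1)])
  have op: "open (punctured \<times> J)" by (intro open_Times J) simp
  define A where "A = (\<lambda>p. \<Sum>i\<in>Basis. dderiv (i, 0) H p \<bullet> dderiv (i, 0) H p)"
  have A: "Cinf (punctured \<times> J) A"
    unfolding A_def by (intro Cinf_sum Cinf_inner Cinf_dderiv H op)
  have en: "energy (\<Phi> t) = 1 / 2 * S2_integral (\<lambda>y. A (y, t))" if "t \<in> J" for t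
  proof -
    have "smooth_on S2 (\<Phi> t)" by (rule smooth_onI_radial[OF F[OF that] radial_S2])
    then have "energy (\<Phi> t) = 1 / 2 * S2_integral (grad_sq (radial (\<Phi> t)))" by (rule energy_eq)
    also have "S2_integral (grad_sq (radial (\<Phi> t))) = S2_integral (\<lambda>y. A (y, t))"
    proof (rule S2_integral_cong)
      fix y assume "y \<in> S2"
      then have "y \<noteq> 0" by auto
      then show "grad_sq (radial (\<Phi> t)) y = A (y, t)"
        unfolding grad_sq_def A_def radial_eq by (simp add: dderiv_slice[OF H that])
    qed
    finally show ?thesis .
  qed
  have dA: "dderiv (0, 1) A (y, t0) = 2 * (\<Sum>i\<in>Basis. dderiv i (radial (\<Phi> t0)) y \<bullet> dderiv i (\<lambda>y. dderiv (0, 1) H (y, t0)) y)"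
    if "y \<in> S2" for y
  proof -
    have y: "y \<noteq> 0" "(y, t0) \<in> punctured \<times> J" using that J by auto
    have "dderiv (0, 1) A (y, t0) = (\<Sum>i\<in>Basis. dderiv (0, 1) (\<lambda>p. dderiv (i, 0) H p \<bullet> dderiv (i, 0) H p) (y, t0))"
      unfolding A_def
      by (rule dderiv_sum[OF Cinf_differentiable[OF _ y(2)]]) (intro Cinf_inner Cinf_dderiv H op)
    also have "\<dots> = (\<Sum>i\<in>Basis. 2 * (dderiv (i, 0) H (y, t0) \<bullet> dderiv (0, 1) (dderiv (i, 0) H) (y, t0)))"
      by (intro sum.cong refl, subst dderiv_inner[OF Cinf_differentiable[OF Cinf_dderiv[OF H] y(2)] Cinf_differentiable[OF Cinf_dderiv[OF H] y(2)]])
        (simp add: inner_commute)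
    also have "\<dots> = (\<Sum>i\<in>Basis. 2 * (dderiv (i, 0) H (y, t0) \<bullet> dderiv (i, 0) (dderiv (0, 1) H) (y, t0)))"
      by (intro sum.cong refl, subst dderiv_commute[OF op H y(2)]) simp
    also have "\<dots> = 2 * (\<Sum>i\<in>Basis. dderiv i (radial (\<Phi> t0)) y \<bullet> dderiv i (\<lambda>y. dderiv (0, 1) H (y, t0)) y)"
      unfolding radial_eq dderiv_slice[OF H J(2) y(1)] dderiv_slice[OF Cinf_dderiv[OF H] J(2) y(1)]
      by (simp add: sum_distrib_left)
    finally show ?thesis .
  qed
  have "((\<lambda>t. 1 / 2 * S2_integral (\<lambda>y. A (y, t))) has_real_derivative
      1 / 2 * S2_integral (\<lambda>y. dderiv (0, 1) A (y, t0))) (at t0)"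
    by (intro DERIV_cmult DERIV_S2_integral[OF J A])
  also have "S2_integral (\<lambda>y. dderiv (0, 1) A (y, t0)) =
      S2_integral (\<lambda>y. 2 * (\<Sum>i\<in>Basis. dderiv i (radial (\<Phi> t0)) y \<bullet> dderiv i (\<lambda>y. dderiv (0, 1) H (y, t0)) y))"
    by (rule S2_integral_cong[OF dA])
  also have "\<dots> = 2 * - S2_integral (\<lambda>y. lap (radial (\<Phi> t0)) y \<bullet> dderiv (0, 1) H (y, t0))"
    unfolding S2_integral_cmult S2_green[OF F[OF J(2)] W] ..
  finally have "((\<lambda>t. 1 / 2 * S2_integral (\<lambda>y. A (y, t))) has_real_derivative
      - S2_integral (\<lambda>y. lap (radial (\<Phi> t0)) y \<bullet> dderiv (0, 1) H (y, t0))) (at t0)" by simp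
  then show ?thesis
    unfolding H_def[symmetric]
    by (rule has_field_derivative_transform_within_open[OF _ J]) (simp add: en)
qed

lemma unit_dderiv:
  assumes "open U" and H: "Cinf U H" and 1: "\<And>p. p \<in> U \<Longrightarrow> H p \<bullet> H p = 1" and p: "p \<in> U"
  shows "H p \<bullet> dderiv a H p = 0" "dderiv b H p \<bullet> dderiv a H p + H p \<bullet> dderiv b (dderiv a H) p = 0"
proof -
  have first: "H q \<bullet> dderiv a H q = 0" if q: "q \<in> U" for q
  proof -
    have "dderiv a (\<lambda>p. 1) q = dderiv a (\<lambda>p. H p \<bullet> H p) q"
      by (rule dderiv_cong[OF \<open>open U\<close> q]) (simp_all add: 1)
    then show ?thesis
      by (simp add: dderiv_inner[OF Cinf_differentiable[OF H q] Cinf_differentiable[OF H q]] inner_commute)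
        (simp add: dderiv_def)
  qed
  then show "H p \<bullet> dderiv a H p = 0" using p .
  have "dderiv b (\<lambda>p. 0) p = dderiv b (\<lambda>p. H p \<bullet> dderiv a H p) p"
    by (rule dderiv_cong[OF \<open>open U\<close> p]) (simp_all add: first)
  then show "dderiv b H p \<bullet> dderiv a H p + H p \<bullet> dderiv b (dderiv a H) p = 0"
    by (simp add: dderiv_inner[OF Cinf_differentiable[OF H p] Cinf_differentiable[OF Cinf_dderiv[OF H] p]])
      (simp add: dderiv_def)
qed

lemma sphere_radial:
  assumes "f ` S2 \<subseteq> sphere 0 1" "y \<noteq> 0"
  shows "radial f y \<bullet> radial f y = 1"
proof -
  have "norm (f (sgn y)) = 1" by (rule norm_sphere_map[OF assms(1) sgn_in_S2[OF assms(2)]])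
  then show ?thesis by (simp add: radial_def norm_eq_1)
qed

text \<open>Two differentiations of |f|^2 = 1: the normal part of the Laplacian of any map into the
  sphere is fixed by its energy density.\<close>

lemma lap_inner_sphere:
  assumes F: "Cinf punctured (radial f)" and "f ` S2 \<subseteq> sphere 0 1" "y \<noteq> 0"
  shows "lap (radial f) y \<bullet> radial f y = - grad_sq (radial f) y"
proof -
  have yp: "y \<in> punctured" using assms(3) by simp
  have "dderiv i (dderiv i (radial f)) y \<bullet> radial f y = - (dderiv i (radial f) y \<bullet> dderiv i (radial f) y)" for i
    using unit_dderiv(2)[OF punctured(1) F _ yp, of i i] sphere_radial[OF assms(2)]
    by (simp add: inner_commute eq_neg_iff_add_eq_0 add.commute)
  then show ?thesis by (simp add: lap_def grad_sq_def inner_sum_left sum_negf)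
qed

text \<open>Perturbing a unit vector orthogonally never reaches 0, so test variations can be
  normalised for all parameter values.\<close>

lemma norm_perturbed_ge_1:
  fixes a w :: "'b::real_inner"
  assumes "a \<bullet> a = 1" "a \<bullet> w = 0"
  shows "norm (a + w) \<ge> 1"
proof -
  have "(norm (a + w))\<^sup>2 = 1 + w \<bullet> w"
    using assms by (simp add: power2_norm_eq_inner inner_add_left inner_add_right inner_commute)
  then show ?thesis by (metis inner_ge_zero le_add_same_cancel1 norm_ge_zero one_power2 power2_le_imp_le)
qed

lemma sgn_perturbed_has_derivative:
  fixes a v :: "'b::euclidean_space"
  assumes "norm a = 1" "a \<bullet> v = 0"
  shows "((\<lambda>t::real. sgn (a + t *\<^sub>R v)) has_derivative (\<lambda>h. h *\<^sub>R v)) (at 0)"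
proof -
  have 1: "((\<lambda>t::real. a + t *\<^sub>R v) has_derivative (\<lambda>h. h *\<^sub>R v)) (at 0)"
    by (auto intro!: derivative_eq_intros)
  have 2: "(sgn has_derivative (\<lambda>v. v - (a \<bullet> v) *\<^sub>R a)) (at (a + 0 *\<^sub>R v))"
    using sgn_has_derivative[OF assms(1)] by simp
  show ?thesis
    by (rule has_derivative_eq_rhs[OF has_derivative_compose[OF 1 2]]) (simp add: assms(2))
qed

text \<open>If the Laplacian is normal, it is orthogonal to every variation field and the first
  variation vanishes. Conversely, varying in the direction of its tangential part makes the first
  variation minus the integral of that part squared.\<close>

theorem harmonic_map_iff:
  fixes \<phi> :: "real ^ 3 \<Rightarrow> real ^ 'm"
  assumes \<phi>: "smooth_map S2 (sphere 0 1) \<phi>"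
  shows "harmonic_map \<phi> \<longleftrightarrow> (\<forall>y\<in>S2. lap (radial \<phi>) y = - grad_sq (radial \<phi>) y *\<^sub>R \<phi> y)"
proof -
  have sm: "smooth_on S2 \<phi>" and im: "\<phi> ` S2 \<subseteq> sphere 0 1"
    using \<phi> by (auto simp: smooth_map_def)
  let ?F = "radial \<phi>"
  have F: "Cinf punctured ?F" by (rule Cinf_radial[OF sm])
  show ?thesis
  proof
    assume h: "harmonic_map \<phi>"
    define T where "T y = lap ?F y + grad_sq ?F y *\<^sub>R ?F y" for y
    have T: "Cinf punctured T"
      unfolding T_def by (intro Cinf_add Cinf_scaleR Cinf_lap Cinf_grad_sq F punctured)
    have FT: "?F y \<bullet> T y = 0" if "y \<noteq> 0" for y
      using lap_inner_sphere[OF F im that] sphere_radial[OF im that]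
      by (simp add: T_def inner_add_right inner_commute)
    have ge1: "norm (?F y + t *\<^sub>R T y) \<ge> 1" if "y \<noteq> 0" for t y
      by (rule norm_perturbed_ge_1) (simp_all add: sphere_radial[OF im that] FT[OF that])
    have nz: "?F y + t *\<^sub>R T y \<noteq> 0" if "y \<noteq> 0" for t y
      using ge1[OF that, of t] by auto
    define \<Phi> where "\<Phi> t y = sgn (?F y + t *\<^sub>R T y)" for t y
    have sm\<Phi>: "smooth_on (S2 \<times> J) (\<lambda>(x, t). \<Phi> t x)" if "open J" for J
    proof (rule Cinf_imp_smooth_on[of "punctured \<times> J"])
      show op: "open (punctured \<times> J)" by (intro open_Times that) simp
      have fst: "Cinf (punctured \<times> J) (\<lambda>p. G (fst p))" if "Cinf punctured G" for G :: "real ^ 3 \<Rightarrow> real ^ 'm"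
        by (rule Cinf_compose[OF op punctured(1) _ that]) (auto intro!: Cinf_intros op)
      show "Cinf (punctured \<times> J) (\<lambda>(x, t). \<Phi> t x)"
        unfolding \<Phi>_def case_prod_unfold
        by (intro Cinf_sgn Cinf_add Cinf_scaleR fst Cinf_snd Cinf_ident F T op) (use nz in auto)
    qed auto
    have "smooth_variation 1 \<phi> \<Phi>"
      unfolding smooth_variation_def smooth_map_def
    proof (intro conjI ballI)
      show "smooth_on (S2 \<times> {- 1<..<1}) (\<lambda>(x, t). \<Phi> t x)" by (rule sm\<Phi>) simp
      show "(\<lambda>(x, t). \<Phi> t x) ` (S2 \<times> {- 1<..<1}) \<subseteq> sphere 0 1"
      proof (clarsimp simp: \<Phi>_def norm_sgn)
        fix y :: "real ^ 3" and t assume y: "norm y = 1" "?F y + t *\<^sub>R T y = 0"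
        then have "y \<noteq> 0" by auto
        from nz[OF this] show False using y(2) by blast
      qed
      show "\<Phi> 0 y = \<phi> y" if "y \<in> S2" for y
        by (simp add: \<Phi>_def radial_S2[OF that] sgn_unit[OF norm_sphere_map[OF im that]])
    qed simp
    then have 1: "((\<lambda>t. energy (\<Phi> t)) has_real_derivative 0) (at 0)"
      using h unfolding harmonic_map_def by blast
    have 2: "((\<lambda>t. energy (\<Phi> t)) has_real_derivative
        - S2_integral (\<lambda>y. lap (radial (\<Phi> 0)) y \<bullet> dderiv (0, 1) (\<lambda>(y, t). \<Phi> t (sgn y)) (y, 0))) (at 0)"
      by (rule first_variation[OF sm\<Phi>[OF open_UNIV]]) auto
    have "S2_integral (\<lambda>y. lap (radial (\<Phi> 0)) y \<bullet> dderiv (0, 1) (\<lambda>(y, t). \<Phi> t (sgn y)) (y, 0)) =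
        S2_integral (\<lambda>y. T y \<bullet> T y)"
    proof (rule S2_integral_cong)
      fix y assume y: "y \<in> S2"
      then have y0: "y \<noteq> 0" "y \<in> punctured" by auto
      have "\<Phi> 0 (sgn x) = ?F x" if "x \<noteq> 0" for x
      proof -
        have s: "sgn x \<in> S2" by (rule sgn_in_S2[OF that])
        show ?thesis
          by (simp add: \<Phi>_def radial_S2[OF s] sgn_unit[OF norm_sphere_map[OF im s]]) (simp add: radial_def)
      qed
      then have l: "lap (radial (\<Phi> 0)) y = lap ?F y"
        by (intro lap_cong[symmetric, OF F _ y0(1)]) (simp add: radial_def[of "\<Phi> 0"])
      have "dderiv (0, 1) (\<lambda>(y, t). \<Phi> t (sgn y)) (y, 0) = dderiv 1 (\<lambda>t. \<Phi> t (sgn y)) 0"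
      proof -
        have g: "((\<lambda>t::real. (y, t)) has_derivative (\<lambda>t. (0, t))) (at 0)"
          by (auto intro!: derivative_eq_intros)
        have "dderiv 1 (\<lambda>t. (case (y, t) of (y, t) \<Rightarrow> \<Phi> t (sgn y))) 0 = dderiv (0, 1) (\<lambda>(y, t). \<Phi> t (sgn y)) (y, 0)"
          by (rule dderiv_compose'[OF Cinf_variation[OF sm\<Phi>[OF open_UNIV] open_UNIV] _ g]) (use y0 in auto)
        then show ?thesis by simp
      qed
      also have "\<dots> = T y"
      proof (rule dderiv_eqI[THEN trans])
        show "((\<lambda>t. \<Phi> t (sgn y)) has_derivative (\<lambda>h. h *\<^sub>R T y)) (at 0)"
          unfolding \<Phi>_def sgn_S2[OF y]
          by (rule sgn_perturbed_has_derivative) (simp_all add: FT[OF y0(1)] norm_eq_1 sphere_radial[OF im y0(1)])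
      qed simp
      finally have W: "dderiv (0, 1) (\<lambda>(y, t). \<Phi> t (sgn y)) (y, 0) = T y" .
      have "lap ?F y \<bullet> T y = T y \<bullet> T y"
        using FT[OF y0(1)] by (subst (2) T_def) (simp add: inner_add_left)
      then show "lap (radial (\<Phi> 0)) y \<bullet> dderiv (0, 1) (\<lambda>(y, t). \<Phi> t (sgn y)) (y, 0) = T y \<bullet> T y"
        unfolding l W .
    qed
    then have int0: "S2_integral (\<lambda>y. T y \<bullet> T y) = 0"
      using DERIV_unique[OF 1 2] by simp
    show "\<forall>y\<in>S2. lap ?F y = - grad_sq ?F y *\<^sub>R \<phi> y"
    proof
      fix y assume y: "y \<in> S2"
      have "continuous_on S2 (\<lambda>y. T y \<bullet> T y)"
        by (intro Cinf_continuous_on_S2 Cinf_inner T punctured)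
      from S2_integral_eq_0_imp[OF this _ int0 y] have "T y = 0" by simp
      then show "lap ?F y = - grad_sq ?F y *\<^sub>R \<phi> y"
        by (simp add: T_def radial_S2[OF y] eq_neg_iff_add_eq_0)
    qed
  next
    assume pde: "\<forall>y\<in>S2. lap ?F y = - grad_sq ?F y *\<^sub>R \<phi> y"
    show "harmonic_map \<phi>"
      unfolding harmonic_map_def
    proof (intro conjI allI impI \<phi>)
      fix \<epsilon> \<Phi> assume var: "smooth_variation \<epsilon> \<phi> \<Phi>"
      let ?J = "{- \<epsilon><..<\<epsilon>}"
      have sm\<Phi>: "smooth_on (S2 \<times> ?J) (\<lambda>(x, t). \<Phi> t x)" and im\<Phi>: "\<And>x t. x \<in> S2 \<Longrightarrow> t \<in> ?J \<Longrightarrow> norm (\<Phi> t x) = 1"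
        and 0: "0 \<in> ?J" and \<Phi>0: "\<And>x. x \<in> S2 \<Longrightarrow> \<Phi> 0 x = \<phi> x"
        using var by (auto simp: smooth_variation_def smooth_map_def image_subset_iff)
      define H where "H = (\<lambda>(y, t). \<Phi> t (sgn y))"
      have H: "Cinf (punctured \<times> ?J) H" unfolding H_def by (rule Cinf_variation[OF sm\<Phi>]) simp
      have op: "open (punctured \<times> ?J)" by (intro open_Times) simp_all
      have H1: "H p \<bullet> H p = 1" if "p \<in> punctured \<times> ?J" for p
      proof -
        have "fst p \<noteq> 0" "snd p \<in> ?J" using that by auto
        then have "norm (\<Phi> (snd p) (sgn (fst p))) = 1" by (intro im\<Phi> sgn_in_S2)
        then show ?thesis by (simp add: H_def case_prod_unfold norm_eq_1)
      qed
      \<comment> \<open>By the equation the Laplacian is a multiple of the position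
        \<open>H (y, 0)\<close>, while the derivative of unit vectors is orthogonal to it.\<close>
      have "lap (radial (\<Phi> 0)) y \<bullet> dderiv (0, 1) H (y, 0) = 0" if y: "y \<in> S2" for y
      proof -
        have y0: "y \<noteq> 0" using y by auto
        have "lap (radial (\<Phi> 0)) y = lap ?F y"
          by (rule lap_cong[symmetric, OF F _ y0]) (simp add: radial_def \<Phi>0 norm_sgn)
        also have "\<dots> = - grad_sq ?F y *\<^sub>R H (y, 0)"
          using pde y by (simp add: H_def sgn_S2[OF y] \<Phi>0[OF y])
        finally show ?thesis
          using unit_dderiv(1)[OF op H H1, of "(y, 0)" "(0, 1)"] y0 0 by simp
      qed
      then have "S2_integral (\<lambda>y. lap (radial (\<Phi> 0)) y \<bullet> dderiv (0, 1) H (y, 0)) = S2_integral (\<lambda>y. 0)"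
        by (rule S2_integral_cong)
      then show "((\<lambda>t. energy (\<Phi> t)) has_real_derivative 0) (at 0)"
        using first_variation[OF sm\<Phi> open_greaterThanLessThan 0] S2_integral_const[of 0] unfolding H_def by simp
    qed
  qed
qed

subsection \<open>Jacobi fields\<close>

text \<open>If \<open>v\<close> solves the Jacobi equation along a harmonic map, the second variation vanishes in every
  direction \<open>w\<close>: the two terms of its integrand cancel pointwise.\<close>

lemma second_variation_eq_0:
  fixes \<phi> :: "real ^ 3 \<Rightarrow> real ^ 'm"
  assumes \<phi>: "smooth_map S2 (sphere 0 1) \<phi>"
    and pde: "\<And>y. y \<in> S2 \<Longrightarrow> lap (radial \<phi>) y = - grad_sq (radial \<phi>) y *\<^sub>R \<phi> y"
    and v: "v \<in> pullback_sections \<phi>"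
    and jac: "\<And>y. y \<in> S2 \<Longrightarrow> lap (radial v) y = - grad_sq (radial \<phi>) y *\<^sub>R v y"
    and var: "smooth_variation2 \<epsilon> \<phi> \<Phi>" and tv: "tangent_to (\<lambda>t. \<Phi> t 0) v" and tw: "tangent_to (\<lambda>s. \<Phi> 0 s) w"
  shows "((\<lambda>t. deriv (\<lambda>s. energy (\<Phi> t s)) 0) has_real_derivative 0) (at 0)"
proof -
  let ?J = "{-\<epsilon><..<\<epsilon>}"
  have F: "Cinf punctured (radial \<phi>)" using \<phi> by (intro Cinf_radial) (simp add: smooth_map_def)
  have FV: "Cinf punctured (radial v)" using v by (intro Cinf_radial) (simp add: pullback_sections_def)
  have sm: "smooth_on (S2 \<times> ?J \<times> ?J) (\<lambda>(x, t, s). \<Phi> t s x)"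
    and im: "(\<lambda>(x, t, s). \<Phi> t s x) ` (S2 \<times> ?J \<times> ?J) \<subseteq> sphere 0 1"
    and 0: "0 \<in> ?J" and \<Phi>0: "\<And>x. x \<in> S2 \<Longrightarrow> \<Phi> 0 0 x = \<phi> x"
    using var by (auto simp: smooth_variation2_def smooth_map_def)
  have opJ: "open (?J \<times> ?J)" by (intro open_Times) simp_all
  have op: "open (punctured \<times> ?J \<times> ?J)" by (intro open_Times) simp_all
  define H where "H = (\<lambda>(y, t, s). \<Phi> t s (sgn y))"
  have H: "Cinf (punctured \<times> ?J \<times> ?J) H"
  proof -
    have 1: "Cinf (punctured \<times> ?J \<times> ?J) (\<lambda>p. (sgn (fst p), snd p))"
      by (intro Cinf_intros op) auto
    have 2: "(\<lambda>p. (sgn (fst p), snd p)) ` (punctured \<times> ?J \<times> ?J) \<subseteq> S2 \<times> ?J \<times> ?J"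
      by (rule image_subsetI) (use sgn_in_S2 in \<open>auto simp: mem_Times_iff simp del: mem_sphere\<close>)
    show ?thesis
      using Cinf_smooth_on_compose[OF sm op 1 2] by (simp add: H_def case_prod_unfold)
  qed
  have H1: "H p \<bullet> H p = 1" if p: "p \<in> punctured \<times> ?J \<times> ?J" for p
  proof -
    have "(sgn (fst p), snd p) \<in> S2 \<times> ?J \<times> ?J"
      using p sgn_in_S2[of "fst p"] by (auto simp: mem_Times_iff simp del: mem_sphere)
    from subsetD[OF im imageI[OF this]] show ?thesis
      by (simp add: H_def case_prod_unfold norm_eq_1)
  qed
  let ?S = "dderiv (0, 0, 1) H"
  \<comment> \<open>The spatial Laplacian of all maps of the family at once, as a smooth function of
    the point and both parameters, so that it can be differentiated in the parameters.\<close>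
  define L where "L p = (\<Sum>i\<in>Basis. dderiv (i, 0) (dderiv (i, 0) H) p)" for p
  have L: "Cinf (punctured \<times> ?J \<times> ?J) L"
    unfolding L_def by (intro Cinf_sum Cinf_dderiv H op)
  have radial_eq: "radial (\<Phi> t s) = (\<lambda>y. H (y, t, s))" for t s
    by (auto simp: radial_def H_def)
  have lap_eq: "lap (radial (\<Phi> t s)) y = L (y, t, s)" if "t \<in> ?J" "s \<in> ?J" "y \<noteq> 0" for t s y
    unfolding radial_eq L_def by (rule lap_slice[OF H _ that(3) opJ]) (use that in auto)
  \<comment> \<open>Up to sign, the integrand of the derivative in the second parameter at 0, still
    depending on the first one.\<close>
  define B where "B p = L (fst p, snd p, 0) \<bullet> ?S (fst p, snd p, 0)" for p :: "(real ^ 3) \<times> real"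
  have opB: "open (punctured \<times> ?J)" by (intro open_Times) simp_all
  have inc: "Cinf (punctured \<times> ?J) (\<lambda>p. G (fst p, snd p, 0))" if "Cinf (punctured \<times> ?J \<times> ?J) G"
    for G :: "(real ^ 3) \<times> real \<times> real \<Rightarrow> real ^ 'm"
    by (rule Cinf_compose[OF opB op _ that]) (use 0 in \<open>auto intro!: Cinf_intros opB\<close>)
  have B: "Cinf (punctured \<times> ?J) B"
    unfolding B_def by (intro Cinf_inner opB inc L Cinf_dderiv H)
  have der1: "deriv (\<lambda>s. energy (\<Phi> t s)) 0 = - S2_integral (\<lambda>y. B (y, t))" if t: "t \<in> ?J" for t
  proof -
    have g: "Cinf (punctured \<times> ?J) (\<lambda>p. (fst p, t, snd p))"
      by (intro Cinf_intros opB)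
    have smt: "smooth_on (S2 \<times> ?J) (\<lambda>(x, s). \<Phi> t s x)"
    proof (rule smooth_on_transfer)
      show "smooth_on (punctured \<times> ?J) (\<lambda>p. H (fst p, t, snd p))"
        by (rule Cinf_imp_smooth_on[OF opB order_refl], rule Cinf_compose[OF opB op _ H g]) (use t in auto)
    qed (auto simp: H_def sgn_unit)
    have "((\<lambda>s. energy (\<Phi> t s)) has_real_derivative
        - S2_integral (\<lambda>y. lap (radial (\<Phi> t 0)) y \<bullet> dderiv (0, 1) (\<lambda>(y, s). \<Phi> t s (sgn y)) (y, 0))) (at 0)"
      by (rule first_variation[OF smt _ 0]) simp
    then have "deriv (\<lambda>s. energy (\<Phi> t s)) 0 =
        - S2_integral (\<lambda>y. lap (radial (\<Phi> t 0)) y \<bullet> dderiv (0, 1) (\<lambda>(y, s). \<Phi> t s (sgn y)) (y, 0))"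
      by (rule DERIV_imp_deriv)
    also have "S2_integral (\<lambda>y. lap (radial (\<Phi> t 0)) y \<bullet> dderiv (0, 1) (\<lambda>(y, s). \<Phi> t s (sgn y)) (y, 0)) =
        S2_integral (\<lambda>y. B (y, t))"
    proof (rule S2_integral_cong)
      fix y assume "y \<in> S2"
      then have y: "y \<noteq> 0" by auto
      have g': "((\<lambda>p. (fst p, t, snd p)) has_derivative (\<lambda>h. (fst h, 0, snd h))) (at (y, 0::real))"
        by (auto intro!: derivative_eq_intros)
      have "dderiv (0, 1) (\<lambda>p. H (fst p, t, snd p)) (y, 0) = dderiv (0, 0, 1) H (fst (y, 0::real), t, snd (y, 0::real))"
        by (rule trans[OF dderiv_compose'[OF H _ g']]) (use y t 0 in auto)
      then have "dderiv (0, 1) (\<lambda>(y, s). \<Phi> t s (sgn y)) (y, 0) = ?S (y, t, 0)"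
        by (simp add: H_def case_prod_unfold)
      then show "lap (radial (\<Phi> t 0)) y \<bullet> dderiv (0, 1) (\<lambda>(y, s). \<Phi> t s (sgn y)) (y, 0) = B (y, t)"
        by (simp add: B_def lap_eq[OF t 0 y])
    qed
    finally show ?thesis .
  qed
  have dB: "dderiv (0, 1) B (y, 0) = 0" if y: "y \<in> S2" for y
  proof -
    have y0: "y \<noteq> 0" using y by auto
    have p: "(y, 0, 0) \<in> punctured \<times> ?J \<times> ?J" and pB: "(y, 0) \<in> punctured \<times> ?J" using y0 0 by auto
    let ?p = "(y, 0, 0)" and ?T = "(0, 1, 0)"
    have dinc: "dderiv (0, 1) (\<lambda>p. G (fst p, snd p, 0)) (y, 0) = dderiv ?T G ?p"
      if "Cinf (punctured \<times> ?J \<times> ?J) G" for G :: "(real ^ 3) \<times> real \<times> real \<Rightarrow> real ^ 'm"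
    proof -
      have g': "((\<lambda>p. (fst p, snd p, 0::real)) has_derivative (\<lambda>h. (fst h, snd h, 0))) (at (y, 0::real))"
        by (auto intro!: derivative_eq_intros)
      show ?thesis
        by (rule trans[OF dderiv_compose'[OF that _ g']]) (use p in auto)
    qed
    have "dderiv (0, 1) B (y, 0) = L ?p \<bullet> dderiv ?T ?S ?p + dderiv ?T L ?p \<bullet> ?S ?p"
      unfolding B_def
      by (subst dderiv_inner[OF Cinf_differentiable[OF inc[OF L] pB] Cinf_differentiable[OF inc[OF Cinf_dderiv[OF H]] pB]])
        (simp add: dinc[OF L] dinc[OF Cinf_dderiv[OF H]])
    moreover have "L ?p = - grad_sq (radial \<phi>) y *\<^sub>R H ?p"
    proof -
      have "L ?p = lap (radial (\<Phi> 0 0)) y" by (rule lap_eq[OF 0 0 y0, symmetric])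
      also have "\<dots> = lap (radial \<phi>) y"
        by (rule lap_cong[symmetric, OF F _ y0]) (simp add: radial_def \<Phi>0 norm_sgn)
      finally show ?thesis using pde[OF y] by (simp add: H_def sgn_S2[OF y] \<Phi>0[OF y])
    qed
    moreover have HT: "dderiv ?T H (x, 0, 0) = radial v x" if x: "x \<noteq> 0" for x
    proof -
      have g: "((\<lambda>t::real. (x, t, 0::real)) has_derivative (\<lambda>t. (0, t, 0))) (at 0)"
        by (auto intro!: derivative_eq_intros)
      have "((\<lambda>t. \<Phi> t 0 (sgn x)) has_vector_derivative v (sgn x)) (at 0)"
        using tv sgn_in_S2[OF x] unfolding tangent_to_def by blast
      then have "dderiv 1 (\<lambda>t. \<Phi> t 0 (sgn x)) 0 = v (sgn x)"
        unfolding has_vector_derivative_def by (rule dderiv_eqI[THEN trans]) simp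
      moreover have "dderiv 1 (\<lambda>t. H (x, t, 0)) 0 = dderiv ?T H (x, 0, 0)"
        by (rule dderiv_compose'[OF H _ g]) (use x 0 in auto)
      ultimately show ?thesis by (simp add: H_def radial_def)
    qed
    \<comment> \<open>Commuting derivatives, the first parameter derivative of the Laplacian is the
      Laplacian of the variation field, to which the Jacobi equation applies.\<close>
    moreover have "dderiv ?T L ?p = lap (radial v) y"
    proof -
      have comm: "dderiv ?T (dderiv a (dderiv b H)) ?p = dderiv a (dderiv b (dderiv ?T H)) ?p" for a b
      proof -
        have "dderiv ?T (dderiv a (dderiv b H)) ?p = dderiv a (dderiv ?T (dderiv b H)) ?p"
          by (rule dderiv_commute[OF op Cinf_dderiv[OF H] p])
        also have "\<dots> = dderiv a (dderiv b (dderiv ?T H)) ?p"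
          by (rule dderiv_cong[OF op p dderiv_commute[OF op H]])
            (auto intro: Cinf_differentiable[OF Cinf_dderiv[OF Cinf_dderiv[OF H]] p])
        finally show ?thesis .
      qed
      have "dderiv ?T L ?p = (\<Sum>i\<in>Basis. dderiv ?T (dderiv (i, 0) (dderiv (i, 0) H)) ?p)"
        unfolding L_def[abs_def]
        by (rule dderiv_sum[OF Cinf_differentiable[OF Cinf_dderiv[OF Cinf_dderiv[OF H]] p]])
      also have "\<dots> = (\<Sum>i\<in>Basis. dderiv (i, 0) (dderiv (i, 0) (dderiv ?T H)) ?p)"
        by (simp only: comm)
      also have "\<dots> = lap (\<lambda>x. dderiv ?T H (x, 0, 0)) y"
        by (rule lap_slice[OF Cinf_dderiv[OF H] _ y0 opJ, symmetric]) (use 0 in auto)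
      also have "\<dots> = lap (radial v) y"
        by (rule lap_cong[symmetric, OF FV _ y0]) (simp add: HT)
      finally show ?thesis .
    qed
    \<comment> \<open>Both equations have the same factor, the energy density of
      \<open>\<phi>\<close>. What it multiplies in \<open>dderiv (0, 1) B\<close> is this sum, which
      is zero because |H|^2 is constant.\<close>
    moreover have "dderiv ?T H ?p \<bullet> ?S ?p + H ?p \<bullet> dderiv ?T ?S ?p = 0"
      by (rule unit_dderiv(2)[OF op H H1 p])
    ultimately show ?thesis
      using jac[OF y] HT[OF y0]
      by (simp add: radial_S2[OF y] add_eq_0_iff)
  qed
  have "((\<lambda>t. - S2_integral (\<lambda>y. B (y, t))) has_real_derivative
      - S2_integral (\<lambda>y. dderiv (0, 1) B (y, 0))) (at 0)"
    by (intro DERIV_minus DERIV_S2_integral[OF _ 0 B]) simp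
  moreover have "S2_integral (\<lambda>y. dderiv (0, 1) B (y, 0)) = 0"
    using S2_integral_cong[OF dB] S2_integral_const[of 0] by simp
  ultimately have "((\<lambda>t. - S2_integral (\<lambda>y. B (y, t))) has_real_derivative 0) (at 0)" by simp
  then show ?thesis
    by (rule has_field_derivative_transform_within_open[OF _ open_greaterThanLessThan 0]) (simp add: der1)
qed

text \<open>The operator is a definite description, so besides the vanishing second variation a
  uniqueness argument is required: any candidate \<open>u\<close> is tested against itself.\<close>

theorem jacobi_fieldI:
  fixes \<phi> :: "real ^ 3 \<Rightarrow> real ^ 'm"
  assumes \<phi>: "smooth_map S2 (sphere 0 1) \<phi>"
    and pde: "\<And>y. y \<in> S2 \<Longrightarrow> lap (radial \<phi>) y = - grad_sq (radial \<phi>) y *\<^sub>R \<phi> y"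
    and v: "v \<in> pullback_sections \<phi>"
    and jac: "\<And>y. y \<in> S2 \<Longrightarrow> lap (radial v) y = - grad_sq (radial \<phi>) y *\<^sub>R v y"
  shows "jacobi_field \<phi> v"
proof -
  have zero: "(\<lambda>x. 0) \<in> pullback_sections \<phi>"
    using Cinf_imp_smooth_on[OF open_UNIV, of S2 "\<lambda>x. 0 :: real ^ 'm"] by (simp add: pullback_sections_def)
  have F: "Cinf punctured (radial \<phi>)" and im: "\<phi> ` S2 \<subseteq> sphere 0 1"
    using \<phi> by (auto simp: smooth_map_def intro: Cinf_radial)
  have sec: "Cinf punctured (radial u)" "y \<in> S2 \<Longrightarrow> \<phi> y \<bullet> u y = 0" if "u \<in> pullback_sections \<phi>" for u y
    using that by (auto simp: pullback_sections_def intro: Cinf_radial)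
  have "jacobi_operator \<phi> v = (\<lambda>x. 0)"
    unfolding jacobi_operator_def
  proof (rule the_equality, intro conjI ballI allI impI)
    show "(\<lambda>x. 0) \<in> pullback_sections \<phi>" by (rule zero)
    fix w \<epsilon> \<Phi>
    assume A: "smooth_variation2 \<epsilon> \<phi> \<Phi> \<and> tangent_to (\<lambda>t. \<Phi> t 0) v \<and> tangent_to (\<lambda>s. \<Phi> 0 s) w"
    have "((\<lambda>t. deriv (\<lambda>s. energy (\<Phi> t s)) 0) has_real_derivative 0) (at 0)"
      by (rule second_variation_eq_0[OF \<phi> pde v jac, where w = w]) (use A in blast)+
    then show "((\<lambda>t. deriv (\<lambda>s. energy (\<Phi> t s)) 0) has_real_derivative S2_integral (\<lambda>x. 0 \<bullet> w x)) (at 0)"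
      using S2_integral_const[of 0] by simp
  next
    fix u
    assume u: "u \<in> pullback_sections \<phi> \<and>
     (\<forall>w \<in> pullback_sections \<phi>. \<forall>\<epsilon> \<Phi>.
        smooth_variation2 \<epsilon> \<phi> \<Phi> \<and> tangent_to (\<lambda>t. \<Phi> t 0) v \<and> tangent_to (\<lambda>s. \<Phi> 0 s) w \<longrightarrow>
        ((\<lambda>t. deriv (\<lambda>s. energy (\<Phi> t s)) 0) has_real_derivative
           S2_integral (\<lambda>x. u x \<bullet> w x)) (at 0))"
    then have us: "u \<in> pullback_sections \<phi>" by blast
    \<comment> \<open>A two-parameter variation tangent to \<open>v\<close> and \<open>u\<close>.
      Its second variation is the integral of |u|^2 by the assumption on \<open>u\<close> and 0 by
      \<open>second_variation_eq_0\<close>; sections vanish off the sphere, so \<open>u\<close> is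
      the zero function.\<close>
    define \<Phi> where "\<Phi> t s y = sgn (radial \<phi> y + (t *\<^sub>R radial v y + s *\<^sub>R radial u y))" for t s y
    have nz: "radial \<phi> y + (t *\<^sub>R radial v y + s *\<^sub>R radial u y) \<noteq> 0" if "y \<noteq> 0" for y t s
    proof -
      have "radial \<phi> y \<bullet> (t *\<^sub>R radial v y + s *\<^sub>R radial u y) = 0"
        using sec(2)[OF v sgn_in_S2[OF that]] sec(2)[OF us sgn_in_S2[OF that]]
        by (simp add: radial_def inner_add_right)
      from norm_perturbed_ge_1[OF sphere_radial[OF im that] this] show ?thesis by auto
    qed
    let ?J = "{-1<..<1} :: real set"
    have op: "open (punctured \<times> ?J \<times> ?J)" by (intro open_Times) simp_all
    have "smooth_variation2 1 \<phi> \<Phi>"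
      unfolding smooth_variation2_def smooth_map_def
    proof (intro conjI ballI)
      have fst: "Cinf (punctured \<times> ?J \<times> ?J) (\<lambda>p. G (fst p))" if "Cinf punctured G" for G :: "real ^ 3 \<Rightarrow> real ^ 'm"
        by (rule Cinf_compose[OF op punctured(1) _ that]) (auto intro!: Cinf_intros op)
      show "smooth_on (S2 \<times> ?J \<times> ?J) (\<lambda>(x, t, s). \<Phi> t s x)"
      proof (rule Cinf_imp_smooth_on[OF op])
        show "Cinf (punctured \<times> ?J \<times> ?J) (\<lambda>(x, t, s). \<Phi> t s x)"
          unfolding \<Phi>_def case_prod_unfold
          by (intro Cinf_sgn Cinf_add Cinf_scaleR fst Cinf_fst Cinf_snd Cinf_ident F sec(1)[OF v] sec(1)[OF us] op)
            (use nz in auto)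
      qed auto
      show "(\<lambda>(x, t, s). \<Phi> t s x) ` (S2 \<times> ?J \<times> ?J) \<subseteq> sphere 0 1"
      proof (clarsimp simp: \<Phi>_def norm_sgn)
        fix y :: "real ^ 3" and t s
        assume y: "norm y = 1" "radial \<phi> y + (t *\<^sub>R radial v y + s *\<^sub>R radial u y) = 0"
        then have "y \<noteq> 0" by auto
        from nz[OF this] show False using y(2) by blast
      qed
      show "\<Phi> 0 0 y = \<phi> y" if "y \<in> S2" for y
        by (simp add: \<Phi>_def radial_S2[OF that] sgn_unit[OF norm_sphere_map[OF im that]])
    qed simp
    moreover have "tangent_to (\<lambda>t. \<Phi> t 0) v" "tangent_to (\<lambda>s. \<Phi> 0 s) u"
      unfolding tangent_to_def has_vector_derivative_def
      using sgn_perturbed_has_derivative[OF norm_sphere_map[OF im]] sec(2)[OF v] sec(2)[OF us]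
      by (simp_all add: \<Phi>_def radial_S2)
    ultimately have "((\<lambda>t. deriv (\<lambda>s. energy (\<Phi> t s)) 0) has_real_derivative S2_integral (\<lambda>x. u x \<bullet> u x)) (at 0)"
      "((\<lambda>t. deriv (\<lambda>s. energy (\<Phi> t s)) 0) has_real_derivative 0) (at 0)"
      using u us second_variation_eq_0[OF \<phi> pde v jac] by blast+
    then have "S2_integral (\<lambda>x. u x \<bullet> u x) = 0" by (rule DERIV_unique)
    moreover have "S2_integral (\<lambda>x. u x \<bullet> u x) = S2_integral (\<lambda>x. radial u x \<bullet> radial u x)"
      by (rule S2_integral_cong) (simp add: radial_S2)
    moreover have "continuous_on S2 (\<lambda>x. radial u x \<bullet> radial u x)"
      by (intro Cinf_continuous_on_S2 Cinf_inner sec(1)[OF us] punctured)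
    ultimately have "radial u y \<bullet> radial u y = 0" if "y \<in> S2" for y
      using S2_integral_eq_0_imp[of "\<lambda>x. radial u x \<bullet> radial u x" y] that by simp
    then have "u y = 0" if "y \<in> S2" for y using that by (simp add: radial_S2)
    moreover have "u y = 0" if "y \<notin> S2" for y using us that by (simp add: pullback_sections_def)
    ultimately show "u = (\<lambda>x. 0)" by blast
  qed
  then show ?thesis using v by (simp add: jacobi_field_def)
qed

subsection \<open>Wirtinger derivatives\<close>

definition wz :: "(complex \<Rightarrow> complex) \<Rightarrow> complex \<Rightarrow> complex" where
  "wz f z = (dderiv 1 f z - \<i> * dderiv \<i> f z) / 2"

definition wb :: "(complex \<Rightarrow> complex) \<Rightarrow> complex \<Rightarrow> complex" where
  "wb f z = (dderiv 1 f z + \<i> * dderiv \<i> f z) / 2"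

lemma wirtinger_eqI:
  assumes "(f has_derivative (\<lambda>h. a * h + b * cnj h)) (at z)"
  shows "wz f z = a" "wb f z = b"
proof -
  have 1: "dderiv 1 f z = a + b" by (rule dderiv_eqI[OF assms, THEN trans]) simp
  have i: "dderiv \<i> f z = \<i> * (a - b)"
    by (rule dderiv_eqI[OF assms, THEN trans]) (simp add: algebra_simps)
  show "wz f z = a" unfolding wz_def 1 i by (simp add: algebra_simps)
  show "wb f z = b" unfolding wb_def 1 i by (simp add: algebra_simps)
qed

lemma wirtinger_has_derivative:
  assumes "f differentiable at z"
  shows "(f has_derivative (\<lambda>h. wz f z * h + wb f z * cnj h)) (at z)"
proof (rule has_derivative_eq_rhs[OF has_derivative_dderiv[OF assms]])
  have lin: "linear (\<lambda>v. dderiv v f z)"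
    using has_derivative_linear[OF has_derivative_dderiv[OF assms]] .
  have "dderiv h f z = wz f z * h + wb f z * cnj h" for h
  proof -
    have "dderiv h f z = dderiv (Re h *\<^sub>R 1 + Im h *\<^sub>R \<i>) f z"
      by (rule arg_cong[where f = "\<lambda>h. dderiv h f z"]) (simp add: complex_eq_iff)
    also have "\<dots> = Re h *\<^sub>R dderiv 1 f z + Im h *\<^sub>R dderiv \<i> f z"
      by (simp only: linear_add[OF lin] linear_scale[OF lin])
    also have "\<dots> = wz f z * h + wb f z * cnj h"
      by (simp add: wz_def wb_def complex_eq_iff field_simps)
    finally show ?thesis .
  qed
  then show "(\<lambda>v. dderiv v f z) = (\<lambda>h. wz f z * h + wb f z * cnj h)" by blast
qed

lemma Cinf_wirtinger: "Cinf UNIV f \<Longrightarrow> Cinf UNIV (wz f)" "Cinf UNIV f \<Longrightarrow> Cinf UNIV (wb f)"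
proof -
  assume f: "Cinf UNIV f"
  have "Cinf UNIV (\<lambda>z. (1/2) * (dderiv 1 f z - \<i> * dderiv \<i> f z))"
    "Cinf UNIV (\<lambda>z. (1/2) * (dderiv 1 f z + \<i> * dderiv \<i> f z))"
    by (intro Cinf_mult Cinf_add Cinf_diff Cinf_const Cinf_dderiv f open_UNIV)+
  then show "Cinf UNIV (wz f)" "Cinf UNIV (wb f)"
    by (simp_all add: wz_def[abs_def] wb_def[abs_def])
qed

lemma Cinf_differentiable_UNIV: "Cinf UNIV f \<Longrightarrow> f differentiable at x"
  by (rule Cinf_differentiable) auto

lemma dderiv_half_combination:
  fixes f g :: "'a::euclidean_space \<Rightarrow> complex"
  assumes "f differentiable at z" "g differentiable at z"
  shows "dderiv h (\<lambda>z. (f z + c * g z) / 2) z = (dderiv h f z + c * dderiv h g z) / 2"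
  by (rule dderiv_eqI) (use assms in \<open>auto intro!: derivative_eq_intros has_derivative_dderiv\<close>)

lemma dderiv_wirtinger:
  assumes f: "Cinf UNIV f"
  shows "dderiv h (wz f) z = (dderiv h (dderiv 1 f) z - \<i> * dderiv h (dderiv \<i> f) z) / 2"
    "dderiv h (wb f) z = (dderiv h (dderiv 1 f) z + \<i> * dderiv h (dderiv \<i> f) z) / 2"
  using dderiv_half_combination[of "dderiv 1 f" z "dderiv \<i> f" h "- \<i>"]
    dderiv_half_combination[of "dderiv 1 f" z "dderiv \<i> f" h "\<i>"]
    Cinf_differentiable_UNIV[OF Cinf_dderiv[OF f]]
  by (simp_all add: wz_def[abs_def] wb_def[abs_def])

lemma wz_wb_commute: "Cinf UNIV f \<Longrightarrow> wb (wz f) z = wz (wb f) z"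
  using dderiv_commute[OF open_UNIV _ UNIV_I, of f \<i> 1 z]
  by (simp add: wz_def[of "wb f"] wb_def[of "wz f"] dderiv_wirtinger
      add_divide_distrib diff_divide_distrib algebra_simps)

lemma laplace_wirtinger:
  "Cinf UNIV f \<Longrightarrow> dderiv 1 (dderiv 1 f) z + dderiv \<i> (dderiv \<i> f) z = 4 * wb (wz f) z"
  using dderiv_commute[OF open_UNIV _ UNIV_I, of f \<i> 1 z]
  by (simp add: wb_def[of "wz f"] dderiv_wirtinger
      add_divide_distrib diff_divide_distrib algebra_simps)

lemma wirtinger_mult:
  assumes "f differentiable at z" "g differentiable at z"
  shows "wz (\<lambda>z. f z * g z) z = f z * wz g z + wz f z * g z"
    "wb (\<lambda>z. f z * g z) z = f z * wb g z + wb f z * g z"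
proof -
  have "((\<lambda>z. f z * g z) has_derivative
      (\<lambda>h. (f z * wz g z + wz f z * g z) * h + (f z * wb g z + wb f z * g z) * cnj h)) (at z)"
    by (rule has_derivative_eq_rhs[OF has_derivative_mult[OF wirtinger_has_derivative wirtinger_has_derivative]])
      (use assms in \<open>auto simp: algebra_simps\<close>)
  then show "wz (\<lambda>z. f z * g z) z = f z * wz g z + wz f z * g z"
    "wb (\<lambda>z. f z * g z) z = f z * wb g z + wb f z * g z"
    by (rule wirtinger_eqI)+
qed

lemma wirtinger_sum:
  assumes "\<And>i. i \<in> I \<Longrightarrow> f i differentiable at z"
  shows "wz (\<lambda>z. \<Sum>i\<in>I. f i z) z = (\<Sum>i\<in>I. wz (f i) z)"
    "wb (\<lambda>z. \<Sum>i\<in>I. f i z) z = (\<Sum>i\<in>I. wb (f i) z)"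
  unfolding wz_def wb_def
  by (simp_all add: dderiv_sum[OF assms] sum_distrib_left sum_subtractf[symmetric] sum.distrib[symmetric] sum_divide_distrib)

lemma wirtinger_const [simp]: "wz (\<lambda>z. c) z = 0" "wb (\<lambda>z. c) z = 0"
  by (simp_all add: wz_def wb_def dderiv_def)

text \<open>The form in which the absence of holomorphic differentials on the sphere is used: decay
  at infinity in one chart takes the place of regularity at the north pole, and Liouville's theorem
  concludes.\<close>

lemma holomorphic_if_wb_0:
  assumes f: "Cinf UNIV f" and "\<And>z. wb f z = 0" and lim: "(f \<longlongrightarrow> 0) at_infinity"
  shows "f = (\<lambda>z. 0)"
proof
  have "(f has_field_derivative wz f z) (at z)" for z
    using wirtinger_has_derivative[OF Cinf_differentiable_UNIV[OF f], of z] assms(2)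
    by (simp add: has_field_derivative_def)
  then have "f holomorphic_on UNIV"
    by (auto simp: holomorphic_on_open)
  then show "f z = 0" for z by (rule Liouville_weak_0[OF _ lim])
qed

subsection \<open>Isotropy of harmonic spheres\<close>

text \<open>Real components are made complex so that Wirtinger operators apply. Sums of products
  over the basis are then complex bilinear, not Hermitian, as isotropy requires.\<close>

definition cpt :: "(complex \<Rightarrow> 'b::euclidean_space) \<Rightarrow> 'b \<Rightarrow> complex \<Rightarrow> complex" where
  "cpt K b z = complex_of_real (K z \<bullet> b)"

lemma bounded_linear_of_real_inner: "bounded_linear (\<lambda>x. complex_of_real (x \<bullet> b))"
  by (rule bounded_linear_compose[OF bounded_linear_of_real bounded_linear_inner_left])

lemma Cinf_cpt: "Cinf UNIV K \<Longrightarrow> Cinf UNIV (cpt K b)"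
  unfolding cpt_def by (intro Cinf_of_real Cinf_inner Cinf_const open_UNIV)

lemma dderiv_cpt: "Cinf UNIV K \<Longrightarrow> dderiv h (cpt K b) = cpt (dderiv h K) b"
  unfolding cpt_def by (rule ext) (rule dderiv_bounded_linear[OF bounded_linear_of_real_inner Cinf_differentiable_UNIV])

lemma wz_cpt: "Cinf UNIV K \<Longrightarrow> wz (cpt K b) z = (cpt (dderiv 1 K) b z - \<i> * cpt (dderiv \<i> K) b z) / 2"
  by (simp add: wz_def dderiv_cpt)

lemma wz_wz_cpt:
  assumes K: "Cinf UNIV K"
  shows "wz (wz (cpt K b)) z = (cpt (dderiv 1 (dderiv 1 K)) b z - \<i> * cpt (dderiv 1 (dderiv \<i> K)) b z
     - \<i> * cpt (dderiv \<i> (dderiv 1 K)) b z - cpt (dderiv \<i> (dderiv \<i> K)) b z) / 4"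
  by (simp add: wz_def[of "wz (cpt K b)"] dderiv_wirtinger Cinf_cpt K dderiv_cpt Cinf_dderiv
      add_divide_distrib diff_divide_distrib algebra_simps)

lemma tendsto_cpt: "(K \<longlongrightarrow> 0) F \<Longrightarrow> (cpt K b \<longlongrightarrow> 0) F"
  unfolding cpt_def using tendsto_of_real[OF tendsto_inner[OF _ tendsto_const, of K 0 F b]] by simp

text \<open>The first and the third sum are the coefficients of holomorphic differentials on the sphere.\<close>

theorem harmonic_isotropic:
  fixes K :: "complex \<Rightarrow> 'b::euclidean_space"
  assumes K: "Cinf UNIV K" and unit: "\<And>z. K z \<bullet> K z = 1" and \<rho>: "Cinf UNIV \<rho>"
    and harm: "\<And>z. dderiv 1 (dderiv 1 K) z + dderiv \<i> (dderiv \<i> K) z = - \<rho> z *\<^sub>R K z"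
    and lim1: "\<And>h. (dderiv h K \<longlongrightarrow> 0) at_infinity"
    and lim2: "\<And>h k. (dderiv h (dderiv k K) \<longlongrightarrow> 0) at_infinity"
  shows "(\<Sum>b\<in>Basis. (wz (cpt K b) z)\<^sup>2) = 0"
    "(\<Sum>b\<in>Basis. wz (cpt K b) z * wz (wz (cpt K b)) z) = 0"
    "(\<Sum>b\<in>Basis. (wz (wz (cpt K b)) z)\<^sup>2) = 0"
proof -
  let ?k = "\<lambda>b. cpt K b" and ?A = "\<lambda>b. wz (cpt K b)" and ?B = "\<lambda>b. wz (wz (cpt K b))"
  define r where "r z = - complex_of_real (\<rho> z) / 4" for z
  have k: "Cinf UNIV (?k b)" for b by (rule Cinf_cpt[OF K])
  have A: "Cinf UNIV (?A b)" for b by (rule Cinf_wirtinger(1)[OF k])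
  have B: "Cinf UNIV (?B b)" for b by (rule Cinf_wirtinger(1)[OF A])
  have r: "Cinf UNIV r"
  proof -
    have "Cinf UNIV (\<lambda>z. (- 1 / 4) * complex_of_real (\<rho> z))"
      by (intro Cinf_mult Cinf_const Cinf_of_real \<rho> open_UNIV)
    then show ?thesis by (simp add: r_def[abs_def])
  qed
  note d = Cinf_differentiable_UNIV
  have wbA: "wb (?A b) = (\<lambda>z. r z * ?k b z)" for b
  proof
    fix z
    have "4 * wb (?A b) z = cpt (dderiv 1 (dderiv 1 K)) b z + cpt (dderiv \<i> (dderiv \<i> K)) b z"
      by (simp add: laplace_wirtinger[OF k, symmetric] dderiv_cpt K Cinf_dderiv)
    also have "\<dots> = complex_of_real ((dderiv 1 (dderiv 1 K) z + dderiv \<i> (dderiv \<i> K) z) \<bullet> b)"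
      by (simp add: cpt_def inner_add_left)
    also have "\<dots> = 4 * (r z * ?k b z)"
      unfolding harm by (simp add: r_def cpt_def)
    finally show "wb (?A b) z = r z * ?k b z" by simp
  qed
  have kA: "(\<Sum>b\<in>Basis. ?k b z * ?A b z) = 0" for z
  proof -
    have "(\<Sum>b\<in>Basis. ?k b z * ?k b z) = 1" for z
    proof -
      have "(\<Sum>b\<in>Basis. ?k b z * ?k b z) = complex_of_real (K z \<bullet> K z)"
        unfolding cpt_def by (subst euclidean_inner) simp
      then show ?thesis by (simp add: unit)
    qed
    then have "wz (\<lambda>z. \<Sum>b\<in>Basis. ?k b z * ?k b z) z = 0" by simp
    then have "(\<Sum>b\<in>Basis. 2 * (?k b z * ?A b z)) = 0"
      by (subst (asm) wirtinger_sum(1)) (auto intro!: d Cinf_mult k simp: wirtinger_mult d[OF k] mult.commute)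
    then show ?thesis by (simp add: sum_distrib_left[symmetric])
  qed
  \<comment> \<open>The antiholomorphic derivative of this sum is 2 r times the pairing of the map
    with its z-derivative, which vanishes by |K| = 1.\<close>
  have P: "(\<lambda>z. \<Sum>b\<in>Basis. ?A b z * ?A b z) = (\<lambda>z. 0)"
  proof (rule holomorphic_if_wb_0)
    show "Cinf UNIV (\<lambda>z. \<Sum>b\<in>Basis. ?A b z * ?A b z)"
      by (intro Cinf_sum Cinf_mult A open_UNIV)
    show "wb (\<lambda>z. \<Sum>b\<in>Basis. ?A b z * ?A b z) z = 0" for z
    proof -
      have "wb (\<lambda>z. \<Sum>b\<in>Basis. ?A b z * ?A b z) z = (\<Sum>b\<in>Basis. 2 * r z * (?k b z * ?A b z))"
        by (subst wirtinger_sum(2)) (auto intro!: d Cinf_mult A sum.cong simp: wirtinger_mult d[OF A] wbA)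
      then show ?thesis by (simp add: sum_distrib_left[symmetric] kA)
    qed
    have "((\<lambda>z. \<Sum>b\<in>Basis. ?A b z * ?A b z) \<longlongrightarrow> (\<Sum>b\<in>(Basis :: 'b set). (0 - \<i> * 0) / 2 * ((0 - \<i> * 0) / 2))) at_infinity"
      unfolding wz_cpt[OF K] by (intro tendsto_intros tendsto_cpt lim1) auto
    then show "((\<lambda>z. \<Sum>b\<in>Basis. ?A b z * ?A b z) \<longlongrightarrow> 0) at_infinity" by simp
  qed
  have AB: "(\<Sum>b\<in>Basis. ?A b z * ?B b z) = 0" for z
  proof -
    have "wz (\<lambda>z. \<Sum>b\<in>Basis. ?A b z * ?A b z) z = 0" unfolding P by simp
    then have "(\<Sum>b\<in>Basis. 2 * (?A b z * ?B b z)) = 0"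
      by (subst (asm) wirtinger_sum(1)) (auto intro!: d Cinf_mult A simp: wirtinger_mult d[OF A] mult.commute)
    then show ?thesis by (simp add: sum_distrib_left[symmetric])
  qed
  have kB: "(\<Sum>b\<in>Basis. ?k b z * ?B b z) = 0" for z
  proof -
    have "wz (\<lambda>z. \<Sum>b\<in>Basis. ?k b z * ?A b z) z = 0" unfolding kA by simp
    then have "(\<Sum>b\<in>Basis. ?k b z * ?B b z + ?A b z * ?A b z) = 0"
      by (subst (asm) wirtinger_sum(1)) (auto intro!: d Cinf_mult A k simp: wirtinger_mult d[OF A] d[OF k])
    then show ?thesis using fun_cong[OF P, of z] by (simp add: sum.distrib)
  qed
  \<comment> \<open>Since the antiholomorphic derivative of the second z-derivative is that of
    \<open>r * cpt K b\<close> in z, the derivative of the third sum involves only the pairings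
    \<open>AB\<close> and \<open>kB\<close>, both zero.\<close>
  have wbB: "wb (?B b) z = r z * ?A b z + wz r z * ?k b z" for b z
    unfolding wz_wb_commute[OF A] wbA by (rule wirtinger_mult(1)[OF d[OF r] d[OF k]])
  have Q: "(\<lambda>z. \<Sum>b\<in>Basis. ?B b z * ?B b z) = (\<lambda>z. 0)"
  proof (rule holomorphic_if_wb_0)
    show "Cinf UNIV (\<lambda>z. \<Sum>b\<in>Basis. ?B b z * ?B b z)"
      by (intro Cinf_sum Cinf_mult B open_UNIV)
    show "wb (\<lambda>z. \<Sum>b\<in>Basis. ?B b z * ?B b z) z = 0" for z
    proof -
      have "wb (\<lambda>z. \<Sum>b\<in>Basis. ?B b z * ?B b z) z =
          (\<Sum>b\<in>Basis. 2 * r z * (?A b z * ?B b z) + 2 * wz r z * (?k b z * ?B b z))"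
        by (subst wirtinger_sum(2))
          (auto intro!: d Cinf_mult B sum.cong simp: wirtinger_mult d[OF B] wbB algebra_simps)
      then show ?thesis by (simp add: sum.distrib sum_distrib_left[symmetric] AB kB)
    qed
    have "((\<lambda>z. \<Sum>b\<in>Basis. ?B b z * ?B b z) \<longlongrightarrow>
        (\<Sum>b\<in>(Basis :: 'b set). (0 - \<i> * 0 - \<i> * 0 - 0) / 4 * ((0 - \<i> * 0 - \<i> * 0 - 0) / 4))) at_infinity"
      unfolding wz_wz_cpt[OF K] by (intro tendsto_intros tendsto_cpt lim2) auto
    then show "((\<lambda>z. \<Sum>b\<in>Basis. ?B b z * ?B b z) \<longlongrightarrow> 0) at_infinity" by simp
  qed
  show "(\<Sum>b\<in>Basis. (?A b z)\<^sup>2) = 0" "(\<Sum>b\<in>Basis. (?B b z)\<^sup>2) = 0"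
    using fun_cong[OF P, of z] fun_cong[OF Q, of z] by (simp_all add: power2_eq_square)
  show "(\<Sum>b\<in>Basis. ?A b z * ?B b z) = 0" by (rule AB)
qed

lemma sw_tendsto_0: "(sw \<longlongrightarrow> 0) at_infinity"
proof -
  have "((\<lambda>r::real. inverse (1 + r\<^sup>2)) \<longlongrightarrow> 0) at_top" by real_asymp
  from filterlim_compose[OF this filterlim_norm_at_top]
  show ?thesis by (simp add: sw_def[abs_def])
qed

lemma norm_dderiv_stereo_tendsto_0: "((\<lambda>z. norm (dderiv h stereo_inv z)) \<longlongrightarrow> 0) at_infinity"
proof -
  have "norm (dderiv h stereo_inv z) = 2 * sw z * norm h" for z
    using stereo_inv_inner(3)[of h z h]
    by (simp add: norm_eq_sqrt_inner real_sqrt_mult less_imp_le)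
  then show ?thesis
    using tendsto_mult_left_zero[OF tendsto_mult_right_zero[OF sw_tendsto_0, of 2], of "norm h"] by simp
qed

lemma norm_dderiv2_stereo_tendsto_0: "((\<lambda>z. norm (dderiv k (dderiv h stereo_inv) z)) \<longlongrightarrow> 0) at_infinity"
proof (cases "h = 0 \<or> k = 0")
  case True
  then have "dderiv k (dderiv h stereo_inv) z = 0" for z
    unfolding stereo_inv_dderiv2 by (auto simp: plane_def)
  then show ?thesis by simp
next
  case False
  define M where "M = 28 * norm h * norm k"
  have "norm (dderiv k (dderiv h stereo_inv) z) \<le> M * (sw z * sqrt (sw z))" for z
  proof -
    have lin: "bilinear (\<lambda>p q. dderiv p (dderiv q stereo_inv) z)"
      by (rule bilinear_dderiv2[OF open_UNIV Cinf_stereo_inv UNIV_I])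
    have "dderiv k (dderiv h stereo_inv) z =
        dderiv (norm k *\<^sub>R sgn k) (dderiv (norm h *\<^sub>R sgn h) stereo_inv) z"
      using False by (simp add: sgn_div_norm)
    also have "\<dots> = norm h *\<^sub>R norm k *\<^sub>R dderiv (sgn k) (dderiv (sgn h) stereo_inv) z"
      by (simp only: bilinear_lmul[OF lin] bilinear_rmul[OF lin])
    also have "norm \<dots> = norm h * norm k * norm (dderiv (sgn k) (dderiv (sgn h) stereo_inv) z)" by simp
    also have "\<dots> \<le> norm h * norm k * (28 * (sw z * sqrt (sw z)))"
      using False by (intro mult_left_mono stereo_inv_dderiv2_bound) (auto simp: norm_sgn)
    finally show ?thesis by (simp add: M_def mult_ac)
  qed
  then have le: "\<forall>\<^sub>F z in at_infinity. norm (norm (dderiv k (dderiv h stereo_inv) z)) \<le> M * (sw z * sqrt (sw z))"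
    by simp
  have "((\<lambda>z. M * (sw z * sqrt (sw z))) \<longlongrightarrow> M * (0 * sqrt 0)) at_infinity"
    by (intro tendsto_intros sw_tendsto_0)
  then have "((\<lambda>z. M * (sw z * sqrt (sw z))) \<longlongrightarrow> 0) at_infinity" by simp
  with le show ?thesis by (rule Lim_null_comparison)
qed

text \<open>Derivatives of the extension are bounded on the compact sphere, so by the chain rule the
  decay is that of the derivatives of the chart. These limits feed Liouville's theorem.\<close>

lemma stereo_compose_decay:
  fixes f :: "real ^ 3 \<Rightarrow> 'b::euclidean_space"
  assumes F: "Cinf punctured (radial f)"
  shows "(dderiv h (\<lambda>z. f (stereo_inv z)) \<longlongrightarrow> 0) at_infinity"
    "(dderiv h (dderiv k (\<lambda>z. f (stereo_inv z))) \<longlongrightarrow> 0) at_infinity"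
proof -
  let ?s = "\<lambda>h. dderiv h stereo_inv"
  have eq: "(\<lambda>z. f (stereo_inv z)) = (\<lambda>z. radial f (stereo_inv z))" by simp
  obtain C where C: "C \<ge> 0" "\<And>y v. y \<in> S2 \<Longrightarrow> norm (dderiv v (radial f) y) \<le> C * norm v"
    using dderiv_bounded_on_S2[OF F] by metis
  have 1: "dderiv h (\<lambda>z. f (stereo_inv z)) z = dderiv (?s h z) (radial f) (stereo_inv z)" for h z
    unfolding eq by (rule dderiv_compose[OF F _ Cinf_differentiable_UNIV[OF Cinf_stereo_inv]]) simp
  show "(dderiv h (\<lambda>z. f (stereo_inv z)) \<longlongrightarrow> 0) at_infinity"
  proof (rule Lim_null_comparison)
    show "\<forall>\<^sub>F z in at_infinity. norm (dderiv h (\<lambda>z. f (stereo_inv z)) z) \<le> C * norm (?s h z)"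
      unfolding 1 using C(2) by simp
    show "((\<lambda>z. C * norm (?s h z)) \<longlongrightarrow> 0) at_infinity"
      by (rule tendsto_mult_right_zero[OF norm_dderiv_stereo_tendsto_0])
  qed
  have 2: "dderiv h (dderiv k (\<lambda>z. f (stereo_inv z))) z =
      (\<Sum>b\<in>Basis. (?s k z \<bullet> b) *\<^sub>R dderiv (?s h z) (dderiv b (radial f)) (stereo_inv z)) +
      dderiv (dderiv h (?s k) z) (radial f) (stereo_inv z)" for z
  proof -
    have y: "stereo_inv z \<in> punctured" by simp
    have "dderiv (?s h z) (dderiv (?s k z) (radial f)) (stereo_inv z) =
        (\<Sum>b\<in>Basis. (?s k z \<bullet> b) *\<^sub>R dderiv (?s h z) (dderiv b (radial f)) (stereo_inv z))"
      using linear_sum[OF linear_dderiv2[OF punctured(1) F y], of "?s h z" "\<lambda>b. (?s k z \<bullet> b) *\<^sub>R b" Basis]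
        linear_scale[OF linear_dderiv2[OF punctured(1) F y]]
      by (simp add: euclidean_representation)
    then show ?thesis
      unfolding eq
      by (subst dderiv2_compose[OF open_UNIV punctured(1) _ F Cinf_stereo_inv]) auto
  qed
  have "\<exists>c. \<forall>y v. y \<in> S2 \<longrightarrow> norm (dderiv v (dderiv b (radial f)) y) \<le> c * norm v" for b
    using dderiv_bounded_on_S2[OF Cinf_dderiv[OF F, of b]] by metis
  then obtain c where c: "\<And>b y v. y \<in> S2 \<Longrightarrow> norm (dderiv v (dderiv b (radial f)) y) \<le> c b * norm v"
    by metis
  define g where "g z = (\<Sum>b\<in>Basis. norm (?s k z) * (c b * norm (?s h z))) + C * norm (dderiv h (?s k) z)" for z
  show "(dderiv h (dderiv k (\<lambda>z. f (stereo_inv z))) \<longlongrightarrow> 0) at_infinity"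
  proof (rule Lim_null_comparison)
    have "norm (dderiv h (dderiv k (\<lambda>z. f (stereo_inv z))) z) \<le> g z" for z
      unfolding 2 g_def
    proof (intro norm_triangle_le add_mono C(2) sum_norm_le)
      fix b :: "real ^ 3" assume "b \<in> Basis"
      then show "norm ((?s k z \<bullet> b) *\<^sub>R dderiv (?s h z) (dderiv b (radial f)) (stereo_inv z))
          \<le> norm (?s k z) * (c b * norm (?s h z))"
        using mult_mono[OF Basis_le_norm[of b "?s k z"] c[of "stereo_inv z" "?s h z" b]] by simp
    qed simp
    then show "\<forall>\<^sub>F z in at_infinity. norm (dderiv h (dderiv k (\<lambda>z. f (stereo_inv z))) z) \<le> g z" by simp
    have "(g \<longlongrightarrow> (\<Sum>b\<in>(Basis :: (real ^ 3) set). 0 * (c b * 0)) + C * 0) at_infinity"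
      unfolding g_def
      by (intro tendsto_add tendsto_sum tendsto_mult tendsto_const norm_dderiv_stereo_tendsto_0 norm_dderiv2_stereo_tendsto_0)
    then show "(g \<longlongrightarrow> 0) at_infinity" by simp
  qed
qed

corollary harmonic_map_isotropic:
  fixes \<phi> :: "real ^ 3 \<Rightarrow> real ^ 'm"
  assumes h: "harmonic_map \<phi>"
  defines "K \<equiv> \<lambda>z. \<phi> (stereo_inv z)"
  shows "(\<Sum>b\<in>Basis. (wz (cpt K b) z)\<^sup>2) = 0"
    "(\<Sum>b\<in>Basis. wz (cpt K b) z * wz (wz (cpt K b)) z) = 0"
    "(\<Sum>b\<in>Basis. (wz (wz (cpt K b)) z)\<^sup>2) = 0"
proof -
  have \<phi>: "smooth_map S2 (sphere 0 1) \<phi>" using h by (simp add: harmonic_map_def)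
  have F: "Cinf punctured (radial \<phi>)" using \<phi> by (intro Cinf_radial) (simp add: smooth_map_def)
  have K: "Cinf UNIV K"
  proof -
    have "Cinf UNIV (\<lambda>z. radial \<phi> (stereo_inv z))"
      by (rule Cinf_compose[OF open_UNIV punctured(1) _ F Cinf_stereo_inv]) auto
    then show ?thesis by (simp add: K_def)
  qed
  have unit: "K z \<bullet> K z = 1" for z
    using norm_sphere_map[of \<phi> "stereo_inv z"] \<phi> by (simp add: K_def smooth_map_def norm_eq_1)
  define \<rho> where "\<rho> z = 4 * (sw z)\<^sup>2 * grad_sq (radial \<phi>) (stereo_inv z)" for z
  have \<rho>: "Cinf UNIV \<rho>"
    unfolding \<rho>_def
    by (intro Cinf_mult Cinf_const Cinf_power Cinf_sw open_UNIV
        Cinf_compose[OF open_UNIV punctured(1) _ Cinf_grad_sq[OF F] Cinf_stereo_inv]) auto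
  have harm: "dderiv 1 (dderiv 1 K) z + dderiv \<i> (dderiv \<i> K) z = - \<rho> z *\<^sub>R K z" for z
  proof -
    have "lap (radial \<phi>) (stereo_inv z) = - grad_sq (radial \<phi>) (stereo_inv z) *\<^sub>R \<phi> (stereo_inv z)"
      using h stereo_inv_in_S2 unfolding harmonic_map_iff[OF \<phi>] by blast
    then show ?thesis
      using lap_stereo[OF F, of z] by (simp add: K_def \<rho>_def)
  qed
  note lims = stereo_compose_decay[OF F, folded K_def]
  show "(\<Sum>b\<in>Basis. (wz (cpt K b) z)\<^sup>2) = 0"
    "(\<Sum>b\<in>Basis. wz (cpt K b) z * wz (wz (cpt K b)) z) = 0"
    "(\<Sum>b\<in>Basis. (wz (wz (cpt K b)) z)\<^sup>2) = 0"
    by (rule harmonic_isotropic[OF K unit \<rho> harm lims])+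
qed

subsection \<open>An obstruction to integrability\<close>

text \<open>Since \<open>w\<close> below vanishes at \<open>t = 0\<close> and \<open>w t\<close> is isotropic for all \<open>t\<close>, its derivative at \<open>0\<close> is isotropic
  as well.\<close>

theorem variation_through_harmonic_maps:
  fixes \<phi> v :: "real ^ 3 \<Rightarrow> real ^ 'm"
  assumes var: "smooth_variation \<epsilon> \<phi> \<Phi>" and tan: "tangent_to \<Phi> v"
    and harm: "\<And>t. t \<in> {-\<epsilon><..<\<epsilon>} \<Longrightarrow> harmonic_map (\<Phi> t)" and v: "smooth_on S2 v"
    and \<mu>: "\<And>b. b \<in> Basis \<Longrightarrow>
      wz (wz (cpt (\<lambda>z. \<phi> (stereo_inv z)) b)) z = \<mu> * wz (cpt (\<lambda>z. \<phi> (stereo_inv z)) b) z"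
  shows "(\<Sum>b\<in>Basis. (wz (wz (cpt (\<lambda>z. v (stereo_inv z)) b)) z - \<mu> * wz (cpt (\<lambda>z. v (stereo_inv z)) b) z)\<^sup>2) = 0"
proof -
  let ?J = "{-\<epsilon><..<\<epsilon>}"
  have sm: "smooth_on (S2 \<times> ?J) (\<lambda>(x, t). \<Phi> t x)" and 0: "0 \<in> ?J" and \<Phi>0: "\<And>x. x \<in> S2 \<Longrightarrow> \<Phi> 0 x = \<phi> x"
    using var by (auto simp: smooth_variation_def smooth_map_def)
  define K where "K t z = \<Phi> t (stereo_inv z)" for t z
  define V where "V z = v (stereo_inv z)" for z
  define H where "H p = \<Phi> (snd p) (stereo_inv (fst p))" for p :: "complex \<times> real"
  have op: "open (UNIV \<times> ?J :: (complex \<times> real) set)" by (intro open_Times) simp_all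
  have H: "Cinf (UNIV \<times> ?J) H"
  proof -
    have 1: "Cinf (UNIV \<times> ?J) (\<lambda>p. (stereo_inv (fst p), snd p))"
      by (intro Cinf_Pair op Cinf_snd Cinf_ident Cinf_compose[OF op open_UNIV _ Cinf_stereo_inv] Cinf_fst) auto
    have 2: "(\<lambda>p. (stereo_inv (fst p), snd p)) ` (UNIV \<times> ?J) \<subseteq> S2 \<times> ?J"
      by (rule image_subsetI) (auto simp: mem_Times_iff)
    show ?thesis
      using Cinf_smooth_on_compose[OF sm op 1 2] by (simp add: H_def[abs_def] case_prod_unfold)
  qed
  have s1: "dderiv h (\<lambda>z. G (z, t)) z = dderiv (h, 0) G (z, t)" if "Cinf (UNIV \<times> ?J) G" "t \<in> ?J"
    for G :: "complex \<times> real \<Rightarrow> real ^ 'm" and h z t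
  proof -
    have g: "((\<lambda>z. (z, t)) has_derivative (\<lambda>h. (h, 0))) (at z)"
      by (auto intro!: derivative_eq_intros)
    show ?thesis by (rule dderiv_compose'[OF that(1) _ g]) (use that(2) in auto)
  qed
  have K_eq: "K t = (\<lambda>z. H (z, t))" for t by (simp add: K_def[abs_def] H_def)
  have K1: "dderiv h (K t) = (\<lambda>z. dderiv (h, 0) H (z, t))" if "t \<in> ?J" for h t
    unfolding K_eq by (rule ext) (rule s1[OF H that])
  have K2: "dderiv k (dderiv h (K t)) = (\<lambda>z. dderiv (k, 0) (dderiv (h, 0) H) (z, t))" if "t \<in> ?J" for h k t
    unfolding K1[OF that] by (rule ext) (rule s1[OF Cinf_dderiv[OF H] that])
  have KC: "Cinf UNIV (K t)" if "t \<in> ?J" for t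
    unfolding K_eq by (rule Cinf_compose[OF open_UNIV op _ H]) (use that in \<open>auto intro!: Cinf_intros\<close>)
  have V_eq: "V z = dderiv (0, 1) H (z, 0)" for z
  proof -
    have g: "((\<lambda>t::real. (z, t)) has_derivative (\<lambda>t. (0, t))) (at 0)"
      by (auto intro!: derivative_eq_intros)
    have "((\<lambda>t. \<Phi> t (stereo_inv z)) has_vector_derivative v (stereo_inv z)) (at 0)"
      using tan stereo_inv_in_S2 unfolding tangent_to_def by blast
    then have "dderiv 1 (\<lambda>t. \<Phi> t (stereo_inv z)) 0 = v (stereo_inv z)"
      unfolding has_vector_derivative_def by (rule dderiv_eqI[THEN trans]) simp
    moreover have "dderiv 1 (\<lambda>t. H (z, t)) 0 = dderiv (0, 1) H (z, 0)"
      by (rule dderiv_compose'[OF H _ g]) (use 0 in auto)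
    ultimately show ?thesis by (simp add: H_def V_def)
  qed
  have V1: "dderiv h V = (\<lambda>z. dderiv (h, 0) (dderiv (0, 1) H) (z, 0))" for h
    unfolding V_eq[abs_def] by (rule ext) (rule s1[OF Cinf_dderiv[OF H] 0])
  have V2: "dderiv k (dderiv h V) z = dderiv (k, 0) (dderiv (h, 0) (dderiv (0, 1) H)) (z, 0)" for h k z
    unfolding V1 by (rule s1[OF Cinf_dderiv[OF Cinf_dderiv[OF H]] 0])
  have VC: "Cinf UNIV V"
    unfolding V_eq[abs_def] by (rule Cinf_compose[OF open_UNIV op _ Cinf_dderiv[OF H]]) (use 0 in \<open>auto intro!: Cinf_intros\<close>)
  have p: "(z, 0) \<in> UNIV \<times> ?J" using 0 by simp
  have tlim: "((\<lambda>t. (G (z, t) \<bullet> b - G (z, 0) \<bullet> b) / t) \<longlongrightarrow> dderiv (0, 1) G (z, 0) \<bullet> b) (at 0)"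
    if G: "Cinf (UNIV \<times> ?J) G" for G :: "complex \<times> real \<Rightarrow> real ^ 'm" and b
  proof -
    have Gb: "Cinf (UNIV \<times> ?J) (\<lambda>p. G p \<bullet> b)"
      by (rule Cinf_linear_compose[OF bounded_linear_inner_left op G])
    have "((\<lambda>t. G ((z, 0) + t *\<^sub>R (0, 1)) \<bullet> b) has_real_derivative dderiv (0, 1) (\<lambda>p. G p \<bullet> b) ((z, 0) + 0 *\<^sub>R (0, 1))) (at 0)"
      by (rule dderiv_along_line[OF Gb]) (use 0 in auto)
    moreover have "dderiv (0, 1) (\<lambda>p. G p \<bullet> b) (z, 0) = dderiv (0, 1) G (z, 0) \<bullet> b"
      by (rule dderiv_bounded_linear[OF bounded_linear_inner_left Cinf_differentiable[OF G p]])
    ultimately show ?thesis by (simp add: has_field_derivative_iff)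
  qed
  define w where "w b t = wz (wz (cpt (K t) b)) z - \<mu> * wz (cpt (K t) b) z" for b t
  have w0: "w b 0 = 0" if "b \<in> Basis" for b
  proof -
    have "K 0 = (\<lambda>z. \<phi> (stereo_inv z))" by (simp add: K_def[abs_def] \<Phi>0)
    then show ?thesis using \<mu>[OF that] by (simp add: w_def)
  qed
  \<comment> \<open>Expanding the square leaves exactly the three sums that vanish for harmonic
    maps, with coefficients 1, \<open>- 2 * \<mu>\<close> and \<open>\<mu>\<^sup>2\<close>.\<close>
  have iso: "(\<Sum>b\<in>Basis. (w b t)\<^sup>2) = 0" if t: "t \<in> ?J" for t
  proof -
    note i = harmonic_map_isotropic[OF harm[OF t], of z, folded K_def]
    have "(\<Sum>b\<in>Basis. (w b t)\<^sup>2) = (\<Sum>b\<in>Basis. (wz (wz (cpt (K t) b)) z)\<^sup>2)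
        - 2 * \<mu> * (\<Sum>b\<in>Basis. wz (cpt (K t) b) z * wz (wz (cpt (K t) b)) z)
        + \<mu>\<^sup>2 * (\<Sum>b\<in>Basis. (wz (cpt (K t) b) z)\<^sup>2)"
      unfolding w_def by (simp add: sum_distrib_left sum.distrib[symmetric] sum_subtractf[symmetric] power2_eq_square algebra_simps)
    then show ?thesis using i by (simp add: K_def[abs_def])
  qed
  \<comment> \<open>The real-linear combination that builds \<open>w\<close> from six real
    directional derivatives; by linearity difference quotients in \<open>t\<close> can be taken in
    each argument separately.\<close>
  define comb where "comb c11 c1i ci1 cii c1 ci =
      (complex_of_real c11 - \<i> * complex_of_real c1i - \<i> * complex_of_real ci1 - complex_of_real cii) / 4
      - \<mu> * ((complex_of_real c1 - \<i> * complex_of_real ci) / 2)" for c11 c1i ci1 cii c1 ci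
  have w_comb: "w b t = comb (dderiv (1, 0) (dderiv (1, 0) H) (z, t) \<bullet> b) (dderiv (1, 0) (dderiv (\<i>, 0) H) (z, t) \<bullet> b)
      (dderiv (\<i>, 0) (dderiv (1, 0) H) (z, t) \<bullet> b) (dderiv (\<i>, 0) (dderiv (\<i>, 0) H) (z, t) \<bullet> b)
      (dderiv (1, 0) H (z, t) \<bullet> b) (dderiv (\<i>, 0) H (z, t) \<bullet> b)" if "t \<in> ?J" for b t
    unfolding w_def wz_wz_cpt[OF KC[OF that]] wz_cpt[OF KC[OF that]] comb_def cpt_def K2[OF that]
    unfolding K1[OF that] ..
  define w' where "w' b = wz (wz (cpt V b)) z - \<mu> * wz (cpt V b) z" for b
  have comm1: "dderiv (0, 1) (dderiv a H) (z, 0) = dderiv a (dderiv (0, 1) H) (z, 0)" for a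
    by (rule dderiv_commute[OF op H p])
  have comm2: "dderiv (0, 1) (dderiv a (dderiv c H)) (z, 0) = dderiv a (dderiv c (dderiv (0, 1) H)) (z, 0)" for a c
  proof -
    have "dderiv (0, 1) (dderiv a (dderiv c H)) (z, 0) = dderiv a (dderiv (0, 1) (dderiv c H)) (z, 0)"
      by (rule dderiv_commute[OF op Cinf_dderiv[OF H] p])
    also have "\<dots> = dderiv a (dderiv c (dderiv (0, 1) H)) (z, 0)"
      by (rule dderiv_cong[OF op p dderiv_commute[OF op H] Cinf_differentiable[OF Cinf_dderiv[OF Cinf_dderiv[OF H]] p]])
    finally show ?thesis .
  qed
  have w'_comb: "w' b = comb (dderiv (0, 1) (dderiv (1, 0) (dderiv (1, 0) H)) (z, 0) \<bullet> b)
      (dderiv (0, 1) (dderiv (1, 0) (dderiv (\<i>, 0) H)) (z, 0) \<bullet> b)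
      (dderiv (0, 1) (dderiv (\<i>, 0) (dderiv (1, 0) H)) (z, 0) \<bullet> b)
      (dderiv (0, 1) (dderiv (\<i>, 0) (dderiv (\<i>, 0) H)) (z, 0) \<bullet> b)
      (dderiv (0, 1) (dderiv (1, 0) H) (z, 0) \<bullet> b) (dderiv (0, 1) (dderiv (\<i>, 0) H) (z, 0) \<bullet> b)" for b
    unfolding w'_def wz_wz_cpt[OF VC] wz_cpt[OF VC] comb_def cpt_def V2 comm1 comm2
    unfolding V1 ..
  have comb_diff: "(comb a1 a2 a3 a4 a5 a6 - comb b1 b2 b3 b4 b5 b6) / complex_of_real t =
      comb ((a1 - b1) / t) ((a2 - b2) / t) ((a3 - b3) / t) ((a4 - b4) / t) ((a5 - b5) / t) ((a6 - b6) / t)"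
    for a1 a2 a3 a4 a5 a6 b1 b2 b3 b4 b5 b6 t
    by (cases "t = 0") (simp_all add: comb_def field_simps)
  have lim: "((\<lambda>t. w b t / complex_of_real t) \<longlongrightarrow> w' b) (at 0)" if b: "b \<in> Basis" for b
  proof -
    let ?q = "\<lambda>G t. (G (z, t) \<bullet> b - G (z, 0) \<bullet> b) / t"
    let ?c = "\<lambda>t. comb (?q (dderiv (1, 0) (dderiv (1, 0) H)) t) (?q (dderiv (1, 0) (dderiv (\<i>, 0) H)) t)
        (?q (dderiv (\<i>, 0) (dderiv (1, 0) H)) t) (?q (dderiv (\<i>, 0) (dderiv (\<i>, 0) H)) t)
        (?q (dderiv (1, 0) H) t) (?q (dderiv (\<i>, 0) H) t)"
    have eq: "w b t / complex_of_real t = ?c t" if "t \<in> ?J" for t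
    proof -
      have "w b t / complex_of_real t = (w b t - w b 0) / complex_of_real t" by (simp add: w0[OF b])
      also have "\<dots> = ?c t" unfolding w_comb[OF that] w_comb[OF 0] by (rule comb_diff)
      finally show ?thesis .
    qed
    have "\<forall>\<^sub>F t in at 0. ?c t = w b t / complex_of_real t"
      by (rule eventually_mono[OF eventually_at_in_open'[OF open_greaterThanLessThan 0]]) (erule eq[symmetric])
    moreover have "(?c \<longlongrightarrow> w' b) (at 0)"
      unfolding w'_comb unfolding comb_def
      by (intro tendsto_intros tlim Cinf_dderiv H) auto
    ultimately show ?thesis by (rule Lim_transform_eventually[rotated])
  qed
  \<comment> \<open>Because \<open>w b 0 = 0\<close>, the quotients w/t converge to the derivative,
    and the sum of their squares is the isotropy sum divided by t^2, hence 0 along the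
    limit.\<close>
  have "((\<lambda>t. \<Sum>b\<in>Basis. (w b t / complex_of_real t)\<^sup>2) \<longlongrightarrow> (\<Sum>b\<in>Basis. (w' b)\<^sup>2)) (at 0)"
    by (intro tendsto_sum tendsto_power lim)
  moreover have "\<forall>\<^sub>F t in at 0. (\<Sum>b\<in>Basis. (w b t / complex_of_real t)\<^sup>2) = 0"
    using eventually_at_in_open'[OF open_greaterThanLessThan 0]
    by (rule eventually_mono) (simp add: power_divide sum_divide_distrib[symmetric] iso)
  ultimately have "((\<lambda>t::real. 0) \<longlongrightarrow> (\<Sum>b\<in>Basis. (w' b)\<^sup>2)) (at 0)"
    by (rule Lim_transform_eventually)
  then have "(\<Sum>b\<in>Basis. (w' b)\<^sup>2) = 0"
    by (simp add: tendsto_const_iff)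
  then show ?thesis by (simp add: w'_def V_def[abs_def])
qed

subsection \<open>Maps on the sphere in homogeneous coordinates\<close>

text \<open>The point of the sphere with stereographic coordinate \<open>Z / W\<close>; the north pole is \<open>W = 0\<close>.\<close>

definition descend :: "(complex \<times> complex \<Rightarrow> 'b) \<Rightarrow> real ^ 3 \<Rightarrow> 'b" where
  "descend R y = (if y = north then R (1, 0) else R (Complex (y$1) (y$2), of_real (1 - y$3)))"

lemma descend_stereo:
  assumes hom: "\<And>c Z W. c \<noteq> 0 \<Longrightarrow> R (c * Z, c * W) = R (Z, W)"
  shows "descend R (stereo_inv z) = R (z, 1)"
proof -
  have c: "stereo_inv z $ 1 = 2 * sw z * Re z" "stereo_inv z $ 2 = 2 * sw z * Im z" "1 - stereo_inv z $ 3 = 2 * sw z"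
    by (simp_all add: stereo_inv_eq plane_def axis_def)
  have "stereo_inv z \<noteq> north"
  proof
    assume "stereo_inv z = north"
    then have "1 - stereo_inv z $ 3 = 0" by (simp add: axis_def)
    then show False using c(3) by simp
  qed
  then have "descend R (stereo_inv z) = R (Complex (2 * sw z * Re z) (2 * sw z * Im z), of_real (2 * sw z))"
    unfolding descend_def c by simp
  also have "Complex (2 * sw z * Re z) (2 * sw z * Im z) = of_real (2 * sw z) * z"
    by (simp add: complex_eq_iff)
  also have "R (of_real (2 * sw z) * z, of_real (2 * sw z)) = R (of_real (2 * sw z) * z, of_real (2 * sw z) * 1)"
    by simp
  also have "\<dots> = R (z, 1)" by (rule hom) simp
  finally show ?thesis .
qed

lemma bounded_linear_Complex_nth: "bounded_linear (\<lambda>y :: real ^ 'n. Complex (y$i) (y$j))"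
proof -
  have "bounded_linear (\<lambda>y :: real ^ 'n. complex_of_real (y$i) + \<i> * complex_of_real (y$j))"
    by (intro bounded_linear_add bounded_linear_compose[OF bounded_linear_mult_right]
        bounded_linear_compose[OF bounded_linear_of_real] bounded_linear_vec_nth)
  then show ?thesis by (simp add: Complex_eq)
qed

text \<open>Each pole is avoided by one choice of homogeneous coordinates; by homogeneity the two
  choices give the same value, so both expressions are smooth local extensions.\<close>

lemma smooth_on_descend:
  fixes R :: "complex \<times> complex \<Rightarrow> 'b::real_normed_vector"
  assumes R: "Cinf (-{0}) R"
    and hom: "\<And>c Z W. c \<noteq> 0 \<Longrightarrow> R (c * Z, c * W) = R (Z, W)"
  shows "smooth_on S2 (descend R)"
  unfolding smooth_on_Cinf
proof
  fix x assume x: "x \<in> S2"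
  have sq: "y$1 * y$1 + y$2 * y$2 = (1 - y$3) * (1 + y$3)" if "y \<in> S2" for y :: "real ^ 3"
    using that by (simp add: norm_eq_1 inner_vec_def sum_3 algebra_simps)
  show "\<exists>U F. open U \<and> x \<in> U \<and> Cinf U F \<and> (\<forall>y\<in>S2 \<inter> U. F y = descend R y)"
  proof (cases "x = north")
    case False
    let ?U = "{y :: real ^ 3. y$3 < 1}"
    let ?F = "\<lambda>y :: real ^ 3. R (Complex (y$1) (y$2), of_real (1 - y$3))"
    have U: "open ?U" by (rule open_halfspace_component_lt_cart)
    have "x$3 \<le> 1" using component_le_norm_cart[of x 3] x by simp
    moreover have "x$3 \<noteq> 1"
    proof
      assume 3: "x$3 = 1"
      then have "x$1 = 0" "x$2 = 0" using sq[OF x] by (auto simp: sum_squares_eq_zero_iff)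
      with 3 False show False by (simp add: vec_eq_iff forall_3 axis_def)
    qed
    moreover have "Cinf ?U ?F"
    proof (rule Cinf_compose[OF U _ _ R])
      show "Cinf ?U (\<lambda>y. (Complex (y$1) (y$2), complex_of_real (1 - y$3)))"
        by (intro Cinf_Pair U Cinf_linear bounded_linear_Complex_nth Cinf_of_real Cinf_diff Cinf_const Cinf_vec_nth Cinf_ident)
    qed (auto simp: zero_prod_def complex_eq_iff)
    moreover have "?F y = descend R y" if "y \<in> S2 \<inter> ?U" for y
      using that by (auto simp: descend_def axis_def)
    ultimately show ?thesis using U by (intro exI[of _ ?U] exI[of _ ?F]) auto
  next
    case True
    let ?U = "{y :: real ^ 3. - 1 < y$3}"
    \<comment> \<open>Coordinates regular at the north pole: with Z = y1 + i y2 one has |Z|^2 = (1 -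
      y3)(1 + y3), so the pairs (Z, 1 - y3) and (1 + y3, cnj Z) are proportional.\<close>
    let ?F = "\<lambda>y :: real ^ 3. R (of_real (1 + y$3), cnj (Complex (y$1) (y$2)))"
    have U: "open ?U" using open_halfspace_component_gt_cart[of "-1" 3] by simp
    have "x \<in> ?U" using True by (simp add: axis_def)
    moreover have "Cinf ?U ?F"
    proof (rule Cinf_compose[OF U _ _ R])
      show "Cinf ?U (\<lambda>y. (complex_of_real (1 + y$3), cnj (Complex (y$1) (y$2))))"
        by (intro Cinf_Pair U Cinf_cnj Cinf_linear bounded_linear_Complex_nth Cinf_of_real Cinf_add Cinf_const Cinf_vec_nth Cinf_ident)
    qed (auto simp: zero_prod_def complex_eq_iff)
    moreover have "?F y = descend R y" if y: "y \<in> S2 \<inter> ?U" for y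
    proof (cases "y = north")
      case True
      have "R (2 * 1, 2 * 0) = R (1, 0)" by (rule hom) simp
      moreover have "cnj (Complex 0 0) = 0" by (simp add: complex_eq_iff)
      ultimately show ?thesis using True by (simp add: descend_def axis_def)
    next
      case False
      define Z where "Z = Complex (y$1) (y$2)"
      have n: "cnj Z * Z = of_real ((1 - y$3) * (1 + y$3))"
        using sq[of y] y by (simp add: Z_def complex_eq_iff)
      have "y$3 \<noteq> 1"
      proof
        assume 3: "y$3 = 1"
        then have "y$1 = 0" "y$2 = 0" using sq[of y] y by (auto simp: sum_squares_eq_zero_iff)
        with 3 False show False by (simp add: vec_eq_iff forall_3 axis_def)
      qed
      then have "1 - y$3 \<noteq> 0" by simp
      have "1 + y$3 \<noteq> 0" using y by auto
      have "Z \<noteq> 0" using n \<open>1 - y$3 \<noteq> 0\<close> \<open>1 + y$3 \<noteq> 0\<close>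
        by (metis mult_eq_0_iff mult_zero_right of_real_eq_0_iff)
      define c where "c = cnj Z / of_real (1 - y$3)"
      have W0: "complex_of_real (1 - y$3) \<noteq> 0" using \<open>1 - y$3 \<noteq> 0\<close> by (metis of_real_eq_0_iff)
      have "c \<noteq> 0" using \<open>Z \<noteq> 0\<close> W0 by (simp add: c_def)
      have 1: "c * Z = of_real (1 + y$3)"
        using n W0 by (simp add: c_def nonzero_divide_eq_eq mult.commute)
      have 2: "c * of_real (1 - y$3) = cnj Z" using W0 by (simp add: c_def)
      have "?F y = R (c * Z, c * of_real (1 - y$3))" unfolding 1 2 by (simp add: Z_def)
      also have "\<dots> = R (Z, of_real (1 - y$3))" by (rule hom[OF \<open>c \<noteq> 0\<close>])
      finally show ?thesis using False by (simp add: descend_def Z_def)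
    qed
    ultimately show ?thesis using U by (intro exI[of _ ?U] exI[of _ ?F]) auto
  qed
qed

subsection \<open>Calculus of Wirtinger derivatives\<close>

text \<open>Both Wirtinger derivatives are arguments, so composing the rules along a term computes
  them, and \<open>wd_eq\<close> brings the result into the wanted form.\<close>

definition wd :: "(complex \<Rightarrow> complex) \<Rightarrow> complex \<Rightarrow> complex \<Rightarrow> complex \<Rightarrow> bool" where
  "wd f a b z \<longleftrightarrow> (f has_derivative (\<lambda>h. a * h + b * cnj h)) (at z)"

lemma wdD: "wd f a b z \<Longrightarrow> wz f z = a" "wd f a b z \<Longrightarrow> wb f z = b"
  using wirtinger_eqI unfolding wd_def by blast+

lemma wd_eq: "wd f a b z \<Longrightarrow> a = a' \<Longrightarrow> b = b' \<Longrightarrow> wd f a' b' z"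
  by simp

lemma wd_const: "wd (\<lambda>z. c) 0 0 z"
  by (simp add: wd_def)

lemma wd_ident: "wd (\<lambda>z. z) 1 0 z"
  by (simp add: wd_def)

lemma wd_cnj: "wd f a b z \<Longrightarrow> wd (\<lambda>z. cnj (f z)) (cnj b) (cnj a) z"
  unfolding wd_def by (drule has_derivative_cnj) (simp add: add.commute)

lemma wd_add:
  assumes "wd f a b z" "wd g a' b' z"
  shows "wd (\<lambda>z. f z + g z) (a + a') (b + b') z"
  unfolding wd_def
  by (rule has_derivative_eq_rhs[OF has_derivative_add[OF assms[unfolded wd_def]]]) (auto simp: algebra_simps)

lemma wd_diff: "wd f a b z \<Longrightarrow> wd g a' b' z \<Longrightarrow> wd (\<lambda>z. f z - g z) (a - a') (b - b') z"
  unfolding wd_def by (rule has_derivative_eq_rhs[OF has_derivative_diff]) (auto simp: algebra_simps)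

lemma wd_mult:
  "wd f a b z \<Longrightarrow> wd g a' b' z \<Longrightarrow> wd (\<lambda>z. f z * g z) (f z * a' + a * g z) (f z * b' + b * g z) z"
  unfolding wd_def by (rule has_derivative_eq_rhs[OF has_derivative_mult]) (auto simp: algebra_simps)

lemma wd_divide:
  assumes "wd f a b z" "wd g a' b' z" "g z \<noteq> 0"
  shows "wd (\<lambda>z. f z / g z) ((a * g z - f z * a') / (g z)\<^sup>2) ((b * g z - f z * b') / (g z)\<^sup>2) z"
  unfolding wd_def
  by (rule has_derivative_eq_rhs[OF has_derivative_divide'[OF assms(1,2)[unfolded wd_def] assms(3)]])
    (auto simp: field_simps power2_eq_square assms(3))

lemma wd_power: "wd (\<lambda>z. z ^ m) (of_nat m * z ^ (m - 1)) 0 z"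
  unfolding wd_def by (auto intro!: derivative_eq_intros simp: mult_ac)

lemma laplace_eqI_cpt:
  fixes K :: "complex \<Rightarrow> 'b::euclidean_space"
  assumes K: "Cinf UNIV K" and "\<And>b. b \<in> Basis \<Longrightarrow> 4 * wb (wz (cpt K b)) z = complex_of_real r * cpt K b z"
  shows "dderiv 1 (dderiv 1 K) z + dderiv \<i> (dderiv \<i> K) z = r *\<^sub>R K z"
proof (rule euclidean_eqI)
  fix b :: 'b assume b: "b \<in> Basis"
  have "complex_of_real ((dderiv 1 (dderiv 1 K) z + dderiv \<i> (dderiv \<i> K) z) \<bullet> b) = 4 * wb (wz (cpt K b)) z"
    unfolding laplace_wirtinger[OF Cinf_cpt[OF K], symmetric]
    by (simp add: dderiv_cpt K Cinf_dderiv cpt_def inner_add_left)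
  also have "\<dots> = complex_of_real ((r *\<^sub>R K z) \<bullet> b)" unfolding assms(2)[OF b] by (simp add: cpt_def)
  finally show "(dderiv 1 (dderiv 1 K) z + dderiv \<i> (dderiv \<i> K) z) \<bullet> b = (r *\<^sub>R K z) \<bullet> b"
    by (simp only: of_real_eq_iff)
qed

subsection \<open>The example in the stereographic chart\<close>

text \<open>The rational map \<open>numer z / z\<close> of degree \<open>n + 3\<close>, with \<open>dnumer\<close> the derivative of \<open>numer\<close> and \<open>Wr\<close> the Wronskian
  \<open>numer' z - numer\<close>. Its composition with inverse stereographic projection has the components \<open>Re (Xc n)\<close>,
  \<open>Im (Xc n)\<close> and \<open>Yc n\<close>.\<close>

definition numer :: "nat \<Rightarrow> complex \<Rightarrow> complex" where
  "numer n z = z ^ (n + 3) + 1"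

definition dnumer :: "nat \<Rightarrow> complex \<Rightarrow> complex" where
  "dnumer n z = of_nat (n + 3) * z ^ (n + 2)"

definition Wr :: "nat \<Rightarrow> complex \<Rightarrow> complex" where
  "Wr n z = of_nat (n + 2) * z ^ (n + 3) - 1"

text \<open>This is 1 + |f|^2 multiplied by |z|^2, which removes the pole of f =
  \<open>numer n z / z\<close> at 0. It is kept complex and written with \<open>cnj\<close> for the
  Wirtinger rules; \<open>Dr\<close> is the same quantity as a real number.\<close>

definition Dc :: "nat \<Rightarrow> complex \<Rightarrow> complex" where
  "Dc n z = numer n z * cnj (numer n z) + z * cnj z"

definition Dr :: "nat \<Rightarrow> complex \<Rightarrow> real" where
  "Dr n z = numer n z \<bullet> numer n z + z \<bullet> z"

definition Xc :: "nat \<Rightarrow> complex \<Rightarrow> complex" where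
  "Xc n z = 2 * numer n z * cnj z / Dc n z"

definition Yc :: "nat \<Rightarrow> complex \<Rightarrow> complex" where
  "Yc n z = (numer n z * cnj (numer n z) - z * cnj z) / Dc n z"

lemma Wr_eq: "Wr n z = dnumer n z * z - numer n z"
proof -
  have "z ^ (n + 3) = z * z ^ (n + 2)" by (simp add: power_add power2_eq_square power3_eq_cube)
  then show ?thesis by (simp add: Wr_def dnumer_def numer_def algebra_simps)
qed

lemma Dr_pos: "Dr n z > 0"
proof (cases "z = 0")
  case True
  then show ?thesis by (simp add: Dr_def numer_def power_0_left)
next
  case False
  then show ?thesis unfolding Dr_def by (intro add_nonneg_pos) auto
qed

lemma complex_mult_cnj_inner: "z * cnj z = complex_of_real (z \<bullet> z)"
  by (simp add: complex_eq_iff inner_complex_def)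

lemma Dc_eq: "Dc n z = complex_of_real (Dr n z)"
  by (simp add: Dc_def Dr_def complex_mult_cnj_inner)

lemma Dc_nz [simp]: "Dc n z \<noteq> 0"
  unfolding Dc_eq using Dr_pos[of n z] by simp

lemma cnj_Dc [simp]: "cnj (Dc n z) = Dc n z"
  by (simp add: Dc_eq)

lemma wd_numer: "wd (numer n) (dnumer n z) 0 z"
  unfolding numer_def[abs_def] dnumer_def
  by (rule wd_eq[OF wd_add[OF wd_power wd_const]]) simp_all

lemma wd_dnumer: "wd (dnumer n) (of_nat (n + 3) * (of_nat (n + 2) * z ^ (n + 1))) 0 z"
  unfolding dnumer_def[abs_def]
  by (rule wd_eq[OF wd_mult[OF wd_const wd_power]]) simp_all

lemma wd_Wr: "wd (Wr n) (of_nat (n + 3) * (of_nat (n + 2) * z ^ (n + 2))) 0 z"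
  unfolding Wr_def[abs_def]
  by (rule wd_eq[OF wd_diff[OF wd_mult[OF wd_const wd_power] wd_const]]) simp_all

definition Dz :: "nat \<Rightarrow> complex \<Rightarrow> complex" where
  "Dz n z = dnumer n z * cnj (numer n z) + cnj z"

lemma wd_Dc: "wd (Dc n) (Dz n z) (cnj (Dz n z)) z"
  unfolding Dc_def[abs_def] Dz_def
  by (rule wd_eq[OF wd_add[OF wd_mult[OF wd_numer wd_cnj[OF wd_numer]] wd_mult[OF wd_ident wd_cnj[OF wd_ident]]]]) simp_all

lemma wd_Xc: "wd (Xc n) (2 * Wr n z * (cnj z)\<^sup>2 / (Dc n z)\<^sup>2) (- 2 * cnj (Wr n z) * (numer n z)\<^sup>2 / (Dc n z)\<^sup>2) z"
  unfolding Xc_def[abs_def]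
  by (rule wd_eq[OF wd_divide[OF wd_mult[OF wd_mult[OF wd_const wd_numer] wd_cnj[OF wd_ident]] wd_Dc Dc_nz]])
    (simp_all add: Wr_eq Dz_def Dc_def algebra_simps power2_eq_square)

lemma wd_cnj_Xc: "wd (\<lambda>z. cnj (Xc n z)) (- 2 * Wr n z * (cnj (numer n z))\<^sup>2 / (Dc n z)\<^sup>2) (2 * cnj (Wr n z) * z\<^sup>2 / (Dc n z)\<^sup>2) z"
  by (rule wd_eq[OF wd_cnj[OF wd_Xc]]) simp_all

lemma wd_Yc: "wd (Yc n) (2 * Wr n z * cnj (numer n z) * cnj z / (Dc n z)\<^sup>2) (2 * cnj (Wr n z) * numer n z * z / (Dc n z)\<^sup>2) z"
  unfolding Yc_def[abs_def]
  by (rule wd_eq[OF wd_divide[OF wd_diff[OF wd_mult[OF wd_numer wd_cnj[OF wd_numer]] wd_mult[OF wd_ident wd_cnj[OF wd_ident]]] wd_Dc Dc_nz]])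
    (simp_all add: Wr_eq Dz_def Dc_def algebra_simps power2_eq_square)

lemma wd_over_Dc_sq:
  assumes F: "wd F a b z"
  shows "wd (\<lambda>z. F z / (Dc n z)\<^sup>2) ((a * Dc n z - 2 * F z * Dz n z) / (Dc n z) ^ 3)
    ((b * Dc n z - 2 * F z * cnj (Dz n z)) / (Dc n z) ^ 3) z"
proof -
  have D: "wd (\<lambda>z. (Dc n z)\<^sup>2) (2 * Dc n z * Dz n z) (2 * Dc n z * cnj (Dz n z)) z"
    unfolding power2_eq_square by (rule wd_eq[OF wd_mult[OF wd_Dc wd_Dc]]) simp_all
  have nz: "(Dc n z)\<^sup>2 \<noteq> 0" by simp
  have eq: "(x * (Dc n z)\<^sup>2 - y * (2 * Dc n z * w)) / ((Dc n z)\<^sup>2)\<^sup>2 = (x * Dc n z - 2 * y * w) / (Dc n z) ^ 3" for x y w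
  proof -
    have "x * (Dc n z)\<^sup>2 - y * (2 * Dc n z * w) = Dc n z * (x * Dc n z - 2 * y * w)"
      by (simp add: algebra_simps power2_eq_square)
    moreover have "((Dc n z)\<^sup>2)\<^sup>2 = Dc n z * (Dc n z) ^ 3"
      by (simp add: power2_eq_square power3_eq_cube)
    ultimately show ?thesis by simp
  qed
  show ?thesis
    by (rule wd_eq[OF wd_divide[OF F D nz] eq eq])
qed

text \<open>Every component of the map has \<open>wz\<close>-derivative \<open>Wr / Dc\<^sup>2\<close> times an antiholomorphic function.\<close>

lemma wd_Wr_anti:
  assumes "wd A 0 a' z"
  shows "wd (\<lambda>z. Wr n z * A z / (Dc n z)\<^sup>2)
    ((of_nat (n + 3) * (of_nat (n + 2) * z ^ (n + 2)) * Dc n z - 2 * Wr n z * Dz n z) * A z / (Dc n z) ^ 3)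
    (Wr n z * (a' * Dc n z - 2 * A z * cnj (Dz n z)) / (Dc n z) ^ 3) z"
  by (rule wd_eq[OF wd_over_Dc_sq[OF wd_mult[OF wd_Wr assms]]])
    (simp_all add: algebra_simps)

text \<open>The inner product of the map with a vector whose products with the three axes of the
  image are \<open>a\<close>, \<open>b\<close>, \<open>c\<close>. One computation thus covers all
  components in any target.\<close>

definition coord :: "nat \<Rightarrow> real \<Rightarrow> real \<Rightarrow> real \<Rightarrow> complex \<Rightarrow> complex" where
  "coord n a b c z = of_real a / 2 * (Xc n z + cnj (Xc n z)) + of_real b / (2 * \<i>) * (Xc n z - cnj (Xc n z)) + of_real c * Yc n z"

definition anti :: "nat \<Rightarrow> real \<Rightarrow> real \<Rightarrow> real \<Rightarrow> complex \<Rightarrow> complex" where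
  "anti n a b c z = of_real a * ((cnj z)\<^sup>2 - (cnj (numer n z))\<^sup>2) - \<i> * of_real b * ((cnj z)\<^sup>2 + (cnj (numer n z))\<^sup>2)
     + 2 * of_real c * (cnj (numer n z) * cnj z)"

lemma wz_coord: "wz (coord n a b c) = (\<lambda>z. Wr n z * anti n a b c z / (Dc n z)\<^sup>2)"
proof
  fix z
  show "wz (coord n a b c) z = Wr n z * anti n a b c z / (Dc n z)\<^sup>2"
    unfolding coord_def[abs_def]
    by (rule wdD(1)[OF wd_eq[OF wd_add[OF wd_add[OF wd_mult[OF wd_const wd_add[OF wd_Xc wd_cnj_Xc]]
            wd_mult[OF wd_const wd_diff[OF wd_Xc wd_cnj_Xc]]] wd_mult[OF wd_const wd_Yc]] _ refl]])
      (simp add: anti_def divide_simps, simp add: algebra_simps)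
qed

lemma wd_anti:
  "wd (anti n a b c) 0
    (of_real a * (2 * cnj z - 2 * cnj (numer n z) * cnj (dnumer n z)) - \<i> * of_real b * (2 * cnj z + 2 * cnj (numer n z) * cnj (dnumer n z))
     + 2 * of_real c * (cnj (dnumer n z) * cnj z + cnj (numer n z))) z"
  unfolding anti_def[abs_def] power2_eq_square
  by (rule wd_eq[OF wd_add[OF wd_diff[OF
          wd_mult[OF wd_const wd_diff[OF wd_mult[OF wd_cnj[OF wd_ident] wd_cnj[OF wd_ident]] wd_mult[OF wd_cnj[OF wd_numer] wd_cnj[OF wd_numer]]]]
          wd_mult[OF wd_const wd_add[OF wd_mult[OF wd_cnj[OF wd_ident] wd_cnj[OF wd_ident]] wd_mult[OF wd_cnj[OF wd_numer] wd_cnj[OF wd_numer]]]]]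
          wd_mult[OF wd_const wd_mult[OF wd_cnj[OF wd_numer] wd_cnj[OF wd_ident]]]]])
    (simp_all add: algebra_simps)

text \<open>With f = \<open>numer n z / z\<close> this is 8 |f'|^2 / (1 + |f|^2)^2 cleared of
  denominators: the energy density |df|^2 in terms of the flat metric of the chart.\<close>

definition rho :: "nat \<Rightarrow> complex \<Rightarrow> real" where
  "rho n z = 8 * (cmod (Wr n z))\<^sup>2 / (Dr n z)\<^sup>2"

lemma rho_eq: "complex_of_real (rho n z) = 8 * (Wr n z * cnj (Wr n z)) / (Dc n z)\<^sup>2"
  by (simp add: rho_def Dc_eq complex_norm_square[symmetric])

lemma coord_laplace: "4 * wb (wz (coord n a b c)) z = complex_of_real (- rho n z) * coord n a b c z"
proof -
  have "wb (wz (coord n a b c)) z = Wr n z *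
      ((of_real a * (2 * cnj z - 2 * cnj (numer n z) * cnj (dnumer n z)) - \<i> * of_real b * (2 * cnj z + 2 * cnj (numer n z) * cnj (dnumer n z))
        + 2 * of_real c * (cnj (dnumer n z) * cnj z + cnj (numer n z))) * Dc n z
       - 2 * anti n a b c z * cnj (Dz n z)) / (Dc n z) ^ 3"
    unfolding wz_coord by (rule wdD(2)[OF wd_Wr_anti[OF wd_anti]])
  also have "(of_real a * (2 * cnj z - 2 * cnj (numer n z) * cnj (dnumer n z)) - \<i> * of_real b * (2 * cnj z + 2 * cnj (numer n z) * cnj (dnumer n z))
        + 2 * of_real c * (cnj (dnumer n z) * cnj z + cnj (numer n z))) * Dc n z
       - 2 * anti n a b c z * cnj (Dz n z) =
      - 2 * cnj (Wr n z) * (of_real a * (numer n z * cnj z + cnj (numer n z) * z) - \<i> * of_real b * (numer n z * cnj z - cnj (numer n z) * z)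
        + of_real c * (numer n z * cnj (numer n z) - z * cnj z))"
    by (simp add: Wr_eq Dz_def Dc_def anti_def algebra_simps power2_eq_square)
  also have "of_real a * (numer n z * cnj z + cnj (numer n z) * z) - \<i> * of_real b * (numer n z * cnj z - cnj (numer n z) * z)
        + of_real c * (numer n z * cnj (numer n z) - z * cnj z) = Dc n z * coord n a b c z"
    by (simp add: coord_def Xc_def Yc_def divide_simps) (simp add: algebra_simps)
  finally show ?thesis
    unfolding of_real_minus rho_eq by (simp add: field_simps power2_eq_square power3_eq_cube)
qed

text \<open>In \<open>wz_coord\<close> only the scalar factor \<open>Wr / Dc\<^sup>2\<close> is
  affected by a further z-derivative, and this factor is common to all components. The multiplier is
  its logarithmic derivative at 1, where \<open>Wr n 1 = of_nat (n + 1)\<close> is not zero.\<close>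

lemma coord_second: 
  "wz (wz (coord n a b c)) 1 = ((of_nat (n + 3) * of_nat (n + 2)) / of_nat (n + 1) - 2 * Dz n 1 / Dc n 1) * wz (coord n a b c) 1"
proof -
  have W1: "Wr n 1 = of_nat (n + 1)" by (simp add: Wr_def)
  have 1: "wz (wz (coord n a b c)) 1 =
      (of_nat (n + 3) * (of_nat (n + 2) * 1 ^ (n + 2)) * Dc n 1 - 2 * Wr n 1 * Dz n 1) * anti n a b c 1 / (Dc n 1) ^ 3"
    unfolding wz_coord by (rule wdD(1)[OF wd_Wr_anti[OF wd_anti]])
  have 2: "wz (coord n a b c) 1 = Wr n 1 * anti n a b c 1 / (Dc n 1)\<^sup>2"
    unfolding wz_coord ..
  have nz: "of_nat (n + 1) \<noteq> (0 :: complex)" by (simp only: of_nat_eq_0_iff)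
  have alg: "(s * (t * 1 ^ (n + 2)) * d - 2 * w * x) * y / d ^ 3 = (s * t / w - 2 * x / d) * (w * y / d\<^sup>2)"
    if "w \<noteq> 0" "d \<noteq> 0" for s t d w x y :: complex
    using that by (simp add: divide_simps) (simp add: algebra_simps power2_eq_square power3_eq_cube)
  show ?thesis
    unfolding 1 2 W1 by (rule alg[OF nz Dc_nz])
qed

text \<open>The function \<open>u\<close>. With \<open>k = 1 / z\<close> and \<open>h' = k (numer / z)'\<close>, it is a multiple of
  \<open>Re (k - 2 cnj (numer / z) h / (1 + |numer / z|\<^sup>2))\<close>.\<close>

definition Mc :: "nat \<Rightarrow> complex \<Rightarrow> complex" where
  "Mc n z = of_nat (n + 1) * cnj z - of_nat (n + 3) * z ^ (n + 2) * cnj (numer n z)"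

text \<open>The primitive is h = (n+2)/(n+1) z^(n+1) + 1/(2 z^2). Multiplying k - 2 cnj(f) h / (1 +
  |f|^2) by (n+1) \<open>Dc\<close> cancels all negative powers of z and leaves \<open>Mc\<close>;
  the factor n + 1 clears the denominator of h.\<close>

definition Uc :: "nat \<Rightarrow> complex \<Rightarrow> complex" where
  "Uc n z = (Mc n z + cnj (Mc n z)) / (2 * Dc n z)"

text \<open>The z-derivative of \<open>Mc + cnj Mc\<close>; \<open>Nc\<close> is then the numerator
  of the z-derivative of \<open>Uc\<close> over \<open>2 * Dc\<^sup>2\<close>.\<close>

definition Mz :: "nat \<Rightarrow> complex \<Rightarrow> complex" where
  "Mz n z = - (of_nat (n + 3) * of_nat (n + 2) * z ^ (n + 1) * cnj (numer n z)) + of_nat (n + 1)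
     - of_nat (n + 3) * (cnj z) ^ (n + 2) * dnumer n z"

definition Nc :: "nat \<Rightarrow> complex \<Rightarrow> complex" where
  "Nc n z = Mz n z * Dc n z - (Mc n z + cnj (Mc n z)) * Dz n z"

lemma wd_Mc: "wd (Mc n) (- (of_nat (n + 3) * of_nat (n + 2) * z ^ (n + 1) * cnj (numer n z)))
    (of_nat (n + 1) - of_nat (n + 3) * z ^ (n + 2) * cnj (dnumer n z)) z"
  unfolding Mc_def[abs_def]
  by (rule wd_eq[OF wd_diff[OF wd_mult[OF wd_const wd_cnj[OF wd_ident]]
          wd_mult[OF wd_mult[OF wd_const wd_power] wd_cnj[OF wd_numer]]]]) (simp_all add: mult.assoc)

lemma wd_Mc_sum: "wd (\<lambda>z. Mc n z + cnj (Mc n z)) (Mz n z) (cnj (Mz n z)) z"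
  by (rule wd_eq[OF wd_add[OF wd_Mc wd_cnj[OF wd_Mc]]]) (simp_all add: Mz_def)

lemma wd_Uc: "wd (Uc n) (Nc n z / (2 * (Dc n z)\<^sup>2)) (cnj (Nc n z) / (2 * (Dc n z)\<^sup>2)) z"
proof -
  let ?S = "Mc n z + cnj (Mc n z)"
  have D: "wd (\<lambda>z. 2 * Dc n z) (2 * Dz n z) (2 * cnj (Dz n z)) z"
    by (rule wd_eq[OF wd_mult[OF wd_const wd_Dc]]) simp_all
  have nz: "2 * Dc n z \<noteq> 0" by simp
  have alg: "(x * (2 * d) - s * (2 * w)) / (2 * d)\<^sup>2 = (x * d - s * w) / (2 * d\<^sup>2)" if "d \<noteq> 0" for x d s w :: complex
    using that by (simp add: divide_simps)
  have "cnj (Nc n z) = cnj (Mz n z) * Dc n z - ?S * cnj (Dz n z)"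
    by (simp add: Nc_def add.commute)
  then show ?thesis
    unfolding Uc_def[abs_def]
    by (intro wd_eq[OF wd_divide[OF wd_Mc_sum D nz]]) (simp_all only: alg[OF Dc_nz] Nc_def)
qed

lemma wd_Mz: "wd (Mz n)
    (- (of_nat (n + 3) * of_nat (n + 2) * (of_nat (n + 1) * z ^ n) * cnj (numer n z))
      - of_nat (n + 3) * (cnj z) ^ (n + 2) * (of_nat (n + 3) * (of_nat (n + 2) * z ^ (n + 1))))
    (- (of_nat (n + 3) * of_nat (n + 2) * z ^ (n + 1) * cnj (dnumer n z))
      - of_nat (n + 3) * (of_nat (n + 2) * (cnj z) ^ (n + 1)) * dnumer n z) z"
proof -
  have 1: "wd (\<lambda>z. (cnj z) ^ (n + 2)) 0 (of_nat (n + 2) * (cnj z) ^ (n + 1)) z"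
    using wd_cnj[OF wd_power[of "n + 2" z]] by simp
  have "wd (\<lambda>z. (of_nat (n + 1) - of_nat (n + 3) * of_nat (n + 2) * z ^ (n + 1) * cnj (numer n z))
      - of_nat (n + 3) * (cnj z) ^ (n + 2) * dnumer n z)
    (- (of_nat (n + 3) * of_nat (n + 2) * (of_nat (n + 1) * z ^ n) * cnj (numer n z))
      - of_nat (n + 3) * (cnj z) ^ (n + 2) * (of_nat (n + 3) * (of_nat (n + 2) * z ^ (n + 1))))
    (- (of_nat (n + 3) * of_nat (n + 2) * z ^ (n + 1) * cnj (dnumer n z))
      - of_nat (n + 3) * (of_nat (n + 2) * (cnj z) ^ (n + 1)) * dnumer n z) z"
    by (rule wd_eq[OF wd_diff[OF wd_diff[OF wd_const wd_mult[OF wd_mult[OF wd_const wd_power] wd_cnj[OF wd_numer]]]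
          wd_mult[OF wd_mult[OF wd_const 1] wd_dnumer]]]) simp_all
  then show ?thesis by (simp add: Mz_def[abs_def])
qed

lemma wd_Dz: "wd (Dz n) (of_nat (n + 3) * (of_nat (n + 2) * z ^ (n + 1)) * cnj (numer n z)) (dnumer n z * cnj (dnumer n z) + 1) z"
  unfolding Dz_def[abs_def]
  by (rule wd_eq[OF wd_add[OF wd_mult[OF wd_dnumer wd_cnj[OF wd_numer]] wd_cnj[OF wd_ident]]]) simp_all

text \<open>\<open>Nzz\<close> and \<open>Nzb\<close> are the two Wirtinger derivatives of
  \<open>Nc\<close>. In \<open>Nzz\<close> the two products \<open>Mz * Dz\<close> from the product
  rule have cancelled.\<close>

definition Nzz :: "nat \<Rightarrow> complex \<Rightarrow> complex" where
  "Nzz n z = (- (of_nat (n + 3) * of_nat (n + 2) * (of_nat (n + 1) * z ^ n) * cnj (numer n z))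
      - of_nat (n + 3) * (cnj z) ^ (n + 2) * (of_nat (n + 3) * (of_nat (n + 2) * z ^ (n + 1)))) * Dc n z
    - (Mc n z + cnj (Mc n z)) * (of_nat (n + 3) * (of_nat (n + 2) * z ^ (n + 1)) * cnj (numer n z))"

definition Nzb :: "nat \<Rightarrow> complex \<Rightarrow> complex" where
  "Nzb n z = (- (of_nat (n + 3) * of_nat (n + 2) * z ^ (n + 1) * cnj (dnumer n z))
      - of_nat (n + 3) * (of_nat (n + 2) * (cnj z) ^ (n + 1)) * dnumer n z) * Dc n z
    + Mz n z * cnj (Dz n z) - cnj (Mz n z) * Dz n z
    - (Mc n z + cnj (Mc n z)) * (dnumer n z * cnj (dnumer n z) + 1)"

lemma wd_Nc: "wd (Nc n) (Nzz n z) (Nzb n z) z"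
  unfolding Nc_def[abs_def]
  by (rule wd_eq[OF wd_diff[OF wd_mult[OF wd_Mz wd_Dc] wd_mult[OF wd_Mc_sum wd_Dz]]])
    (simp_all add: Nzz_def Nzb_def algebra_simps)

lemma wd_wz_Uc: "wd (wz (Uc n)) ((Nzz n z * Dc n z - 2 * Nc n z * Dz n z) / (2 * (Dc n z) ^ 3))
    ((Nzb n z * Dc n z - 2 * Nc n z * cnj (Dz n z)) / (2 * (Dc n z) ^ 3)) z"
proof -
  have "Nc n z / (2 * (Dc n z)\<^sup>2) = 1 / 2 * (Nc n z / (Dc n z)\<^sup>2)" for z by simp
  then have eq: "wz (Uc n) = (\<lambda>z. 1 / 2 * (Nc n z / (Dc n z)\<^sup>2))"
    using wdD(1)[OF wd_Uc] by (simp add: fun_eq_iff)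
  show ?thesis
    unfolding eq by (rule wd_eq[OF wd_mult[OF wd_const wd_over_Dc_sq[OF wd_Nc]]]) simp_all
qed

text \<open>This is the equation for \<open>Uc\<close> with denominators cleared, a polynomial
  identity once the symbolic exponents are removed.\<close>

lemma Nc_identity: "Nzb n z * Dc n z - 2 * Nc n z * cnj (Dz n z) = - 2 * (Wr n z * cnj (Wr n z)) * (Mc n z + cnj (Mc n z))"
proof -
  \<comment> \<open>The powers with exponent depending on \<open>n\<close>, their conjugates, z, its
    conjugate and \<open>n\<close> itself become independent indeterminates, because the identity
    holds without relations among them.\<close>
  define l where "l = z ^ (n + 1)"
  define m where "m = cnj l"
  define y where "y = cnj z"
  define c where "c = (of_nat n :: complex)"
  have p: "z ^ (n + 2) = z * l" "z ^ (n + 3) = z * z * l" "(cnj z) ^ (n + 1) = m" "(cnj z) ^ (n + 2) = y * m"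
    by (simp_all add: l_def m_def y_def power_add power2_eq_square power3_eq_cube)
  have cn: "cnj l = m" "cnj m = l" "cnj z = y" "cnj y = z" "cnj c = c"
    by (simp_all add: l_def m_def y_def c_def)
  have n: "of_nat (n + 1) = c + 1" "of_nat (n + 2) = c + 2" "of_nat (n + 3) = c + 3"
    by (simp_all add: c_def)
  have numer: "numer n z = z * z * l + 1" "dnumer n z = (c + 3) * (z * l)"
    unfolding numer_def dnumer_def p n by simp_all
  have cP: "cnj (numer n z) = y * y * m + 1" "cnj (dnumer n z) = (c + 3) * (y * m)"
    by (simp_all add: numer cn)
  have D: "Dc n z = (z * z * l + 1) * (y * y * m + 1) + z * y"
    by (simp add: Dc_def numer cn)
  have Dz: "Dz n z = (c + 3) * (z * l) * (y * y * m + 1) + y" "cnj (Dz n z) = (c + 3) * (y * m) * (z * z * l + 1) + z"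
    by (simp_all add: Dz_def numer cn)
  have M: "Mc n z = (c + 1) * y - (c + 3) * (z * l) * (y * y * m + 1)"
    unfolding Mc_def n p by (simp add: numer cn)
  have cM: "cnj (Mc n z) = (c + 1) * z - (c + 3) * (y * m) * (z * z * l + 1)"
    by (simp add: M cn)
  have Mz: "Mz n z = - ((c + 3) * (c + 2) * l * (y * y * m + 1)) + (c + 1) - (c + 3) * (y * m) * ((c + 3) * (z * l))"
    unfolding Mz_def n p l_def[symmetric] by (simp add: numer cn)
  have cMz: "cnj (Mz n z) = - ((c + 3) * (c + 2) * m * (z * z * l + 1)) + (c + 1) - (c + 3) * (z * l) * ((c + 3) * (y * m))"
    by (simp add: Mz cn)
  have W: "Wr n z = (c + 3) * (z * l) * z - (z * z * l + 1)"
    by (simp add: Wr_eq numer)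
  have cW: "cnj (Wr n z) = (c + 3) * (y * m) * y - (y * y * m + 1)"
    by (simp add: W cn)
  show ?thesis
    unfolding Nzb_def Nc_def cM cMz cW cP Dz(2)
    unfolding M Mz W D Dz(1) numer n p l_def[symmetric]
    by algebra
qed

lemma Uc_laplace: "4 * wb (wz (Uc n)) z = complex_of_real (- rho n z) * Uc n z"
  unfolding wdD(2)[OF wd_wz_Uc] Nc_identity of_real_minus rho_eq Uc_def
  by (simp add: field_simps power2_eq_square power3_eq_cube)

text \<open>For the general solution built from k the difference is a multiple of f' (k' / f')'. At
  1 all ingredients are explicit in \<open>n\<close>, and the value is (n+2)(n+3)/2.\<close>

lemma Uc_second: "wz (wz (Uc n)) 1 - ((of_nat (n + 3) * of_nat (n + 2)) / of_nat (n + 1) - 2 * Dz n 1 / Dc n 1) * wz (Uc n) 1 \<noteq> 0"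
proof -
  define c where "c = (of_nat n :: complex)"
  have n: "of_nat (n + 1) = c + 1" "of_nat (n + 2) = c + 2" "of_nat (n + 3) = c + 3"
    by (simp_all add: c_def)
  have nz: "c + 1 \<noteq> 0" "c + 2 \<noteq> 0" "c + 3 \<noteq> 0"
    unfolding n[symmetric] by (simp_all only: of_nat_eq_0_iff)
  have v: "numer n 1 = 2" "dnumer n 1 = c + 3" "Dc n 1 = 5" "Dz n 1 = 2 * (c + 3) + 1" "Mc n 1 = - c - 5" "cnj c = c"
    by (simp_all add: numer_def dnumer_def Dc_def Dz_def Mc_def c_def)
  have N: "Nc n 1 = - (11 * c + 30) * (c + 1)" "Nzz n 1 = (c + 3) * (c + 2) * (- 11 * c - 5)"
    unfolding Nc_def Nzz_def Mz_def n v by (simp_all add: v, simp_all add: algebra_simps power2_eq_square)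
  \<comment> \<open>The factor c + 1 in \<open>Nc n 1\<close> cancels the denominator of the
    multiplier.\<close>
  have cancel: "(c + 3) * (c + 2) / (c + 1) * (K * (c + 1) / L) = (c + 3) * (c + 2) * K / L" for K L
    using nz by simp
  have eq: "wz (wz (Uc n)) 1 - ((of_nat (n + 3) * of_nat (n + 2)) / of_nat (n + 1) - 2 * Dz n 1 / Dc n 1) * wz (Uc n) 1 = (c + 2) * (c + 3) / 2"
    unfolding wdD(1)[OF wd_wz_Uc] wdD(1)[OF wd_Uc] n N v left_diff_distrib[of "_ / _"] cancel
    by (simp add: field_simps)
  show ?thesis unfolding eq using nz by simp
qed

section \<open>Logarithmic potentials of the energy density and of the area\<close>

lemma wd_ln:
  assumes h: "wd (\<lambda>z. complex_of_real (h z)) a b z" and pos: "h z > 0"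
  shows "wd (\<lambda>z. complex_of_real (ln (h z))) (a / of_real (h z)) (b / of_real (h z)) z"
proof -
  let ?G = "\<lambda>k. a * k + b * cnj k"
  have 1: "((\<lambda>z. complex_of_real (h z)) has_derivative ?G) (at z)" using h by (simp add: wd_def)
  have re: "(h has_derivative (\<lambda>k. Re (?G k))) (at z)" using has_derivative_Re[OF 1] by simp
  have "((\<lambda>z. 0) has_derivative (\<lambda>k. Im (?G k))) (at z)" using has_derivative_Im[OF 1] by simp
  then have "(\<lambda>k. Im (?G k)) = (\<lambda>k. 0)" by (rule has_derivative_unique) simp
  then have "Im (?G k) = 0" for k by meson
  then have G: "complex_of_real (Re (?G k)) = ?G k" for k by (simp add: complex_eq_iff)
  have "((\<lambda>z. ln (h z)) has_derivative (\<lambda>k. Re (?G k) * inverse (h z))) (at z)"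
    by (rule has_derivative_ln[OF pos re])
  then have "((\<lambda>z. complex_of_real (ln (h z))) has_derivative (\<lambda>k. complex_of_real (Re (?G k) * inverse (h z)))) (at z)"
    by (rule has_derivative_of_real)
  moreover have "complex_of_real (Re (?G k) * inverse (h z)) = a / of_real (h z) * k + b / of_real (h z) * cnj k" for k
    unfolding of_real_mult G by (simp add: divide_inverse algebra_simps)
  ultimately show ?thesis unfolding wd_def by simp
qed

text \<open>The energy density of a rational map is the Laplacian of the logarithm of |p|^2 + |q|^2:
  in the numerator the cross terms combine, by the Lagrange identity, into the squared modulus of
  the Wronskian.\<close>

lemma ln_Dr_laplace: "8 * wb (wz (\<lambda>z. complex_of_real (ln (Dr n z)))) z = complex_of_real (rho n z)"
proof -
  have D: "wd (\<lambda>z. complex_of_real (Dr n z)) (Dz n z) (cnj (Dz n z)) z" for z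
    unfolding Dc_eq[symmetric] by (rule wd_Dc)
  have wz: "wz (\<lambda>z. complex_of_real (ln (Dr n z))) = (\<lambda>z. Dz n z / Dc n z)"
    unfolding Dc_eq by (rule ext) (rule wdD(1)[OF wd_ln[OF D Dr_pos]])
  have "wb (wz (\<lambda>z. complex_of_real (ln (Dr n z)))) z =
      ((dnumer n z * cnj (dnumer n z) + 1) * Dc n z - Dz n z * cnj (Dz n z)) / (Dc n z)\<^sup>2"
    unfolding wz by (rule wdD(2)[OF wd_divide[OF wd_Dz wd_Dc Dc_nz]])
  also have "(dnumer n z * cnj (dnumer n z) + 1) * Dc n z - Dz n z * cnj (Dz n z) = Wr n z * cnj (Wr n z)"
    by (simp add: Wr_eq Dz_def Dc_def algebra_simps)
  finally show ?thesis by (simp add: rho_eq)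
qed

text \<open>The same computation for the identity map, whose Wronskian has modulus 1; it produces a
  quarter of the area density.\<close>

lemma ln_sw_laplace: "wb (wz (\<lambda>z. complex_of_real (ln (1 + z \<bullet> z)))) z = complex_of_real ((sw z)\<^sup>2)"
proof -
  have pos: "1 + z \<bullet> z > 0" for z :: complex by (simp add: add_pos_nonneg)
  have nz: "1 + z * cnj z \<noteq> 0" for z
    unfolding complex_mult_cnj_inner using pos[of z] by (metis of_real_1 of_real_add of_real_eq_0_iff less_irrefl)
  have D': "wd (\<lambda>z. 1 + z * cnj z) (cnj z) z z" for z
    by (rule wd_eq[OF wd_add[OF wd_const wd_mult[OF wd_ident wd_cnj[OF wd_ident]]]]) simp_all
  then have D: "wd (\<lambda>z. complex_of_real (1 + z \<bullet> z)) (cnj z) z z" for z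
    by (simp add: complex_mult_cnj_inner)
  have wz: "wz (\<lambda>z. complex_of_real (ln (1 + z \<bullet> z))) = (\<lambda>z. cnj z / (1 + z * cnj z))"
    using wdD(1)[OF wd_ln[OF D pos]] by (simp add: complex_mult_cnj_inner fun_eq_iff)
  have "wb (wz (\<lambda>z. complex_of_real (ln (1 + z \<bullet> z)))) z = (cnj 1 * (1 + z * cnj z) - cnj z * z) / (1 + z * cnj z)\<^sup>2"
    unfolding wz by (rule wdD(2)[OF wd_divide[OF wd_cnj[OF wd_ident] D' nz]])
  also have "\<dots> = 1 / (complex_of_real (1 + z \<bullet> z))\<^sup>2" by (simp add: complex_mult_cnj_inner[symmetric] mult.commute)
  also have "\<dots> = complex_of_real ((sw z)\<^sup>2)"
    by (simp add: sw_def power2_norm_eq_inner power_inverse divide_inverse)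
  finally show ?thesis .
qed

subsection \<open>The example on the sphere\<close>

text \<open>\<open>hp\<close> and \<open>hq\<close> homogenise \<open>numer\<close> and the identity
  to the common degree n + 3. They have no common zero besides the origin, so their quotient is a
  map of degree n + 3 defined at infinity as well.\<close>

definition hp :: "nat \<Rightarrow> complex \<times> complex \<Rightarrow> complex" where
  "hp n p = fst p ^ (n + 3) + snd p ^ (n + 3)"

definition hq :: "nat \<Rightarrow> complex \<times> complex \<Rightarrow> complex" where
  "hq n p = fst p * snd p ^ (n + 2)"

definition hD :: "nat \<Rightarrow> complex \<times> complex \<Rightarrow> real" where
  "hD n p = hp n p \<bullet> hp n p + hq n p \<bullet> hq n p"

definition hX :: "nat \<Rightarrow> complex \<times> complex \<Rightarrow> complex" where
  "hX n p = inverse (hD n p) *\<^sub>R (2 * hp n p * cnj (hq n p))"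

definition hY :: "nat \<Rightarrow> complex \<times> complex \<Rightarrow> real" where
  "hY n p = inverse (hD n p) * (hp n p \<bullet> hp n p - hq n p \<bullet> hq n p)"

text \<open>\<open>Mc\<close> made homogeneous of degree n + 3 in the coordinates and of degree n +
  3 in their conjugates, matching \<open>hD\<close>, so that the quotient descends to the
  sphere.\<close>

definition hM :: "nat \<Rightarrow> complex \<times> complex \<Rightarrow> complex" where
  "hM n p = of_nat (n + 1) * (cnj (fst p) * cnj (snd p) ^ (n + 2) * snd p ^ (n + 3))
    - of_nat (n + 3) * (fst p ^ (n + 2) * snd p * cnj (hp n p))"

definition hU :: "nat \<Rightarrow> complex \<times> complex \<Rightarrow> real" where
  "hU n p = inverse (hD n p) * Re (hM n p)"

text \<open>Scaling by c changes ln \<open>hD\<close> by (n + 3) ln |c|^2; the second term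
  compensates this and makes the potential a smooth function on the sphere. Its Laplacian accounts
  for the degree in \<open>energy_phi\<close>.\<close>

definition hL :: "nat \<Rightarrow> complex \<times> complex \<Rightarrow> real" where
  "hL n p = ln (hD n p) - real (n + 3) * ln (fst p \<bullet> fst p + snd p \<bullet> snd p)"

lemma hD_pos: "p \<noteq> 0 \<Longrightarrow> hD n p > 0"
proof -
  assume p: "p \<noteq> 0"
  have "\<not> (hp n p = 0 \<and> hq n p = 0)"
  proof
    assume h: "hp n p = 0 \<and> hq n p = 0"
    then have "hq n p = 0" by blast
    then have "fst p = 0 \<or> snd p = 0" by (auto simp: hq_def)
    then have "fst p = 0 \<and> snd p = 0" using h by (auto simp: hp_def power_0_left)
    with p show False by (simp add: prod_eq_iff)
  qed
  then show ?thesis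
    unfolding hD_def by (metis add_nonneg_pos add_pos_nonneg inner_ge_zero inner_gt_zero_iff)
qed

lemma norm_pair_pos: "p \<noteq> (0 :: complex \<times> complex) \<Longrightarrow> fst p \<bullet> fst p + snd p \<bullet> snd p > 0"
  by (metis add_nonneg_pos add_pos_nonneg inner_ge_zero inner_gt_zero_iff prod_eq_iff zero_prod_def fst_conv snd_conv)

lemma Cinf_h:
  shows "Cinf (-{0}) (hX n)" "Cinf (-{0}) (hY n)" "Cinf (-{0}) (hU n)" "Cinf (-{0}) (hL n)"
proof -
  have op: "open (- {0 :: complex \<times> complex})" by (rule open_Compl) simp
  note fs = Cinf_fst[OF op Cinf_ident] Cinf_snd[OF op Cinf_ident]
  have hp: "Cinf (-{0}) (hp n)"
    unfolding hp_def[abs_def] by (intro Cinf_add Cinf_power fs op)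
  have hq: "Cinf (-{0}) (hq n)"
    unfolding hq_def[abs_def] by (intro Cinf_mult Cinf_power fs op)
  have hD: "Cinf (-{0}) (hD n)"
    unfolding hD_def[abs_def] by (intro Cinf_add Cinf_inner hp hq op)
  have pos: "hD n p > 0" if "p \<in> - {0}" for p using hD_pos that by simp
  show "Cinf (-{0}) (hX n)"
    unfolding hX_def[abs_def]
    by (intro Cinf_scaleR Cinf_inverse_pos Cinf_mult Cinf_const Cinf_cnj hp hq hD op pos)
  show "Cinf (-{0}) (hY n)"
    unfolding hY_def[abs_def]
    by (intro Cinf_mult Cinf_inverse_pos Cinf_diff Cinf_inner hp hq hD op pos)
  have "Cinf (-{0}) (hM n)"
    unfolding hM_def[abs_def]
    by (intro Cinf_diff Cinf_mult Cinf_const Cinf_cnj Cinf_power fs hp op)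
  then show "Cinf (-{0}) (hU n)"
    unfolding hU_def[abs_def] by (intro Cinf_mult Cinf_inverse_pos Cinf_Re hD op pos)
  show "Cinf (-{0}) (hL n)"
    unfolding hL_def[abs_def]
    by (intro Cinf_diff Cinf_mult Cinf_const Cinf_ln Cinf_add Cinf_inner fs hD op pos) (use norm_pair_pos in auto)
qed

lemma inner_mult_left_complex: "(a * x) \<bullet> (a * y) = (a \<bullet> a) * (x \<bullet> y)" for a x y :: complex
  by (simp add: inner_complex_def algebra_simps)

lemma h_hom:
  assumes c: "c \<noteq> 0"
  shows "hX n (c * Z, c * W) = hX n (Z, W)" "hY n (c * Z, c * W) = hY n (Z, W)" "hU n (c * Z, c * W) = hU n (Z, W)"
    "(Z, W) \<noteq> 0 \<Longrightarrow> hL n (c * Z, c * W) = hL n (Z, W)"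
proof -
  define a where "a = c ^ (n + 3)"
  define s where "s = a \<bullet> a"
  have s: "s > 0" using c by (simp add: s_def a_def)
  have p: "hp n (c * Z, c * W) = a * hp n (Z, W)"
    by (simp add: hp_def a_def power_mult_distrib algebra_simps)
  have q: "hq n (c * Z, c * W) = a * hq n (Z, W)"
    by (simp add: hq_def a_def power_mult_distrib power_add power2_eq_square power3_eq_cube)
  have D: "hD n (c * Z, c * W) = s * hD n (Z, W)"
    unfolding hD_def p q inner_mult_left_complex s_def by (simp add: algebra_simps)
  have ss: "a * cnj a = of_real s" unfolding s_def by (rule complex_mult_cnj_inner)
  have "2 * (a * hp n (Z, W)) * cnj (a * hq n (Z, W)) = (a * cnj a) * (2 * hp n (Z, W) * cnj (hq n (Z, W)))"
    by simp
  also have "\<dots> = s *\<^sub>R (2 * hp n (Z, W) * cnj (hq n (Z, W)))"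
    unfolding ss by (simp add: scaleR_conv_of_real)
  finally show "hX n (c * Z, c * W) = hX n (Z, W)"
    unfolding hX_def D p q using s by simp
  show "hY n (c * Z, c * W) = hY n (Z, W)"
    unfolding hY_def D p q inner_mult_left_complex s_def[symmetric] right_diff_distrib[symmetric]
    using s by simp
  have "hM n (c * Z, c * W) = (a * cnj a) * hM n (Z, W)"
    unfolding hM_def p
    by (simp add: a_def power_mult_distrib power_add power2_eq_square power3_eq_cube algebra_simps)
  then have "Re (hM n (c * Z, c * W)) = s * Re (hM n (Z, W))" unfolding ss by simp
  then show "hU n (c * Z, c * W) = hU n (Z, W)"
    unfolding hU_def D using s by simp
  assume ZW: "(Z, W) \<noteq> 0"
  have cc: "c \<bullet> c > 0" using c by simp
  have s_pow: "s = (c \<bullet> c) ^ (n + 3)"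
    by (simp add: s_def a_def power2_norm_eq_inner[symmetric] norm_power power_mult[symmetric] mult.commute)
  have "ln (s * hD n (Z, W)) = real (n + 3) * ln (c \<bullet> c) + ln (hD n (Z, W))"
    using s hD_pos[OF ZW, of n] cc unfolding s_pow by (simp add: ln_mult ln_realpow)
  moreover have "ln ((c * Z) \<bullet> (c * Z) + (c * W) \<bullet> (c * W)) = ln (c \<bullet> c) + ln (Z \<bullet> Z + W \<bullet> W)"
    unfolding inner_mult_left_complex distrib_left[symmetric]
    using norm_pair_pos[OF ZW] cc by (simp add: ln_mult)
  ultimately show "hL n (c * Z, c * W) = hL n (Z, W)"
    unfolding hL_def D by (simp add: algebra_simps)
qed

lemma h_chart:
  "hX n (z, 1) = Xc n z" "complex_of_real (hY n (z, 1)) = Yc n z" "complex_of_real (hU n (z, 1)) = Uc n z"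
  "hL n (z, 1) = ln (Dr n z) - real (n + 3) * ln (1 + z \<bullet> z)"
proof -
  have p: "hp n (z, 1) = numer n z" "hq n (z, 1) = z" "hM n (z, 1) = Mc n z"
    by (simp_all add: hp_def hq_def hM_def numer_def Mc_def)
  then have D: "hD n (z, 1) = Dr n z" by (simp add: hD_def Dr_def)
  show "hX n (z, 1) = Xc n z"
    unfolding hX_def D p Xc_def Dc_eq by (simp add: scaleR_conv_of_real divide_inverse mult_ac)
  show "complex_of_real (hY n (z, 1)) = Yc n z"
    unfolding hY_def D p Yc_def Dc_eq complex_mult_cnj_inner by (simp add: divide_inverse mult_ac)
  have eq: "complex_of_real (Re (Mc n z)) = (Mc n z + cnj (Mc n z)) / 2" by (simp add: complex_eq_iff)
  have "complex_of_real (hU n (z, 1)) = complex_of_real (Re (Mc n z)) / complex_of_real (Dr n z)"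
    unfolding hU_def D p by (simp add: divide_inverse mult.commute)
  also have "\<dots> = Uc n z" unfolding eq Uc_def Dc_eq by simp
  finally show "complex_of_real (hU n (z, 1)) = Uc n z" .
  show "hL n (z, 1) = ln (Dr n z) - real (n + 3) * ln (1 + z \<bullet> z)"
    unfolding hL_def D by (simp add: inner_complex_def add.commute)
qed

lemma continuous_S2:
  assumes "Cinf punctured (radial f)"
  shows "continuous_on S2 f"
  using Cinf_continuous_on_S2[OF assms] by (rule continuous_on_eq) (simp add: radial_S2)

lemma Cinf_chart:
  assumes "Cinf punctured (radial f)"
  shows "Cinf UNIV (\<lambda>z. f (stereo_inv z))"
proof -
  have "Cinf UNIV (\<lambda>z. radial f (stereo_inv z))"
    by (rule Cinf_compose[OF open_UNIV punctured(1) _ assms Cinf_stereo_inv]) auto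
  then show ?thesis by simp
qed

lemma wirtinger_cmult:
  assumes "f differentiable at z"
  shows "wz (\<lambda>z. c * f z) z = c * wz f z" "wb (\<lambda>z. c * f z) z = c * wb f z"
  using wirtinger_mult[of "\<lambda>z. c" z f] assms by simp_all

section \<open>The harmonic map, its normal field and the energy in a target of any
  dimension\<close>

text \<open>Three of the orthonormal vectors carry the image, the fourth carries the field. Fixing
  only these treats the targets S^3 and S^4 together; the degree of the map is n + 3.\<close>

locale rational_example =
  fixes n :: nat and e1 e2 e3 e4 :: "real ^ 'm"
  assumes orthonormal: "e1 \<bullet> e1 = 1" "e2 \<bullet> e2 = 1" "e3 \<bullet> e3 = 1" "e4 \<bullet> e4 = 1"
    "e1 \<bullet> e2 = 0" "e1 \<bullet> e3 = 0" "e2 \<bullet> e3 = 0" "e1 \<bullet> e4 = 0" "e2 \<bullet> e4 = 0" "e3 \<bullet> e4 = 0"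
begin

definition hphi :: "complex \<times> complex \<Rightarrow> real ^ 'm" where
  "hphi p = Re (hX n p) *\<^sub>R e1 + Im (hX n p) *\<^sub>R e2 + hY n p *\<^sub>R e3"

definition phi :: "real ^ 3 \<Rightarrow> real ^ 'm" where
  "phi = descend hphi"

definition nrm :: "real ^ 3 \<Rightarrow> real ^ 'm" where
  "nrm y = (if y \<in> S2 then descend (hU n) y *\<^sub>R e4 else 0)"

lemma hom: "c \<noteq> 0 \<Longrightarrow> hphi (c * Z, c * W) = hphi (Z, W)"
  by (simp add: hphi_def h_hom)

lemma smooth_phi: "smooth_on S2 phi"
proof -
  have op: "open (- {0 :: complex \<times> complex})" by (rule open_Compl) simp
  have "Cinf (-{0}) hphi"
    unfolding hphi_def[abs_def] by (intro Cinf_add Cinf_scaleR Cinf_const Cinf_Re Cinf_Im Cinf_h op)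
  then show ?thesis unfolding phi_def using hom by (rule smooth_on_descend)
qed

lemma Cinf_phi: "Cinf punctured (radial phi)"
  by (rule Cinf_radial[OF smooth_phi])

lemma phi_stereo: "phi (stereo_inv z) = Re (Xc n z) *\<^sub>R e1 + Im (Xc n z) *\<^sub>R e2 + Re (Yc n z) *\<^sub>R e3"
proof -
  have "phi (stereo_inv z) = hphi (z, 1)" unfolding phi_def by (rule descend_stereo[OF hom])
  moreover have "Re (Yc n z) = hY n (z, 1)" unfolding h_chart(2)[symmetric] by simp
  ultimately show ?thesis by (simp add: hphi_def h_chart(1))
qed

lemma cpt_phi: "cpt (\<lambda>z. phi (stereo_inv z)) b = coord n (e1 \<bullet> b) (e2 \<bullet> b) (e3 \<bullet> b)"
proof
  fix z
  have Y: "Yc n z = complex_of_real (Re (Yc n z))" by (simp add: h_chart(2)[symmetric])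
  have "coord n (e1 \<bullet> b) (e2 \<bullet> b) (e3 \<bullet> b) z =
      of_real (Re (Xc n z) * (e1 \<bullet> b) + Im (Xc n z) * (e2 \<bullet> b)) + of_real (e3 \<bullet> b) * Yc n z"
    by (simp add: coord_def complex_eq_iff Im_divide Re_divide)
  also have "\<dots> = cpt (\<lambda>z. phi (stereo_inv z)) b z"
    unfolding cpt_def phi_stereo by (subst Y) (simp add: inner_add_left mult.commute)
  finally show "cpt (\<lambda>z. phi (stereo_inv z)) b z = coord n (e1 \<bullet> b) (e2 \<bullet> b) (e3 \<bullet> b) z" ..
qed

lemma norm_phi:
  assumes "y \<in> S2"
  shows "phi y \<bullet> phi y = 1"
proof (rule S2_continuous_eqI[OF _ continuous_on_const _ assms])
  show "continuous_on S2 (\<lambda>y. phi y \<bullet> phi y)"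
    by (intro continuous_on_inner continuous_S2 Cinf_phi)
  fix z
  define a where "a = numer n z \<bullet> numer n z"
  define b where "b = z \<bullet> z"
  have D: "Dr n z = a + b" "a + b > 0" using Dr_pos[of n z] by (simp_all add: Dr_def a_def b_def)
  have "(Re (Xc n z))\<^sup>2 + (Im (Xc n z))\<^sup>2 = (cmod (Xc n z))\<^sup>2" by (simp add: cmod_power2)
  also have "\<dots> = 4 * a * b / (a + b)\<^sup>2"
  proof -
    have "cmod (Dc n z) = a + b" unfolding Dc_eq norm_of_real using D by simp
    then show ?thesis
      by (simp add: Xc_def norm_divide norm_mult power_divide power_mult_distrib a_def b_def power2_norm_eq_inner)
  qed
  finally have X: "(Re (Xc n z))\<^sup>2 + (Im (Xc n z))\<^sup>2 = 4 * a * b / (a + b)\<^sup>2" .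
  have Y: "Re (Yc n z) = (a - b) / (a + b)"
    unfolding Yc_def Dc_eq complex_mult_cnj_inner D by (simp add: a_def b_def Re_divide_of_real)
  have "phi (stereo_inv z) \<bullet> phi (stereo_inv z) = (Re (Xc n z))\<^sup>2 + (Im (Xc n z))\<^sup>2 + (Re (Yc n z))\<^sup>2"
    using orthonormal by (simp add: phi_stereo inner_add_left inner_add_right inner_commute power2_eq_square)
  also have "\<dots> = (4 * a * b + (a - b)\<^sup>2) / (a + b)\<^sup>2"
    unfolding X Y by (simp add: power_divide add_divide_distrib)
  also have "\<dots> = 1" using D(2) by (simp add: divide_simps) (simp add: algebra_simps power2_eq_square)
  finally show "phi (stereo_inv z) \<bullet> phi (stereo_inv z) = 1" .
qed

lemma smooth_map_phi: "smooth_map S2 (sphere 0 1) phi"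
  unfolding smooth_map_def using smooth_phi norm_phi by (auto simp: norm_eq_1)

lemma phi_sphere: "phi ` S2 \<subseteq> sphere 0 1"
  using smooth_map_phi by (simp add: smooth_map_def)

lemma lap_phi_chart: "(4 * (sw z)\<^sup>2) *\<^sub>R lap (radial phi) (stereo_inv z) = - rho n z *\<^sub>R phi (stereo_inv z)"
  unfolding lap_stereo[OF Cinf_phi]
  by (rule laplace_eqI_cpt[OF Cinf_chart[OF Cinf_phi]]) (simp only: cpt_phi coord_laplace)

text \<open>The energy density is read off from the equation itself: pairing the Laplacian with the
  map gives minus the density, and the map has length 1.\<close>

lemma grad_phi_chart: "4 * (sw z)\<^sup>2 * grad_sq (radial phi) (stereo_inv z) = rho n z"
proof -
  have "4 * (sw z)\<^sup>2 * (lap (radial phi) (stereo_inv z) \<bullet> radial phi (stereo_inv z)) = - rho n z * (phi (stereo_inv z) \<bullet> phi (stereo_inv z))"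
    using arg_cong[OF lap_phi_chart, of "\<lambda>x. x \<bullet> phi (stereo_inv z)" z] by simp
  moreover have "lap (radial phi) (stereo_inv z) \<bullet> phi (stereo_inv z) = - grad_sq (radial phi) (stereo_inv z)"
    using lap_inner_sphere[OF Cinf_phi phi_sphere, of "stereo_inv z"] by simp
  ultimately show ?thesis by (simp add: norm_phi)
qed

text \<open>The map and the normal field solve the same linear equation, so one passage from the
  chart to the sphere serves both.\<close>

lemma eq_grad_sqI:
  fixes f :: "real ^ 3 \<Rightarrow> real ^ 'm"
  assumes F: "Cinf punctured (radial f)"
    and eq: "\<And>z. (4 * (sw z)\<^sup>2) *\<^sub>R lap (radial f) (stereo_inv z) = - rho n z *\<^sub>R f (stereo_inv z)"
    and y: "y \<in> S2"
  shows "lap (radial f) y = - grad_sq (radial phi) y *\<^sub>R f y"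
proof (rule S2_continuous_eqI[OF _ _ _ y])
  show "continuous_on S2 (lap (radial f))" "continuous_on S2 (\<lambda>y. - grad_sq (radial phi) y *\<^sub>R f y)"
    by (intro continuous_on_scaleR continuous_on_minus continuous_S2 Cinf_continuous_on_S2 Cinf_lap Cinf_grad_sq F Cinf_phi)+
  fix z
  have "(4 * (sw z)\<^sup>2) *\<^sub>R lap (radial f) (stereo_inv z) = (4 * (sw z)\<^sup>2) *\<^sub>R (- grad_sq (radial phi) (stereo_inv z) *\<^sub>R f (stereo_inv z))"
    unfolding eq grad_phi_chart[symmetric] by simp
  then show "lap (radial f) (stereo_inv z) = - grad_sq (radial phi) (stereo_inv z) *\<^sub>R f (stereo_inv z)"
    by (rule scaleR_left_imp_eq[rotated]) simp
qed

lemmas phi_pde = eq_grad_sqI[OF Cinf_phi lap_phi_chart]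

lemma harmonic_phi: "harmonic_map phi"
  unfolding harmonic_map_iff[OF smooth_map_phi] using phi_pde by blast

lemma smooth_nrm: "smooth_on S2 nrm"
proof -
  have op: "open (- {0 :: complex \<times> complex})" by (rule open_Compl) simp
  have "smooth_on S2 (descend (\<lambda>p. hU n p *\<^sub>R e4))"
    by (rule smooth_on_descend) (intro Cinf_scaleR Cinf_const Cinf_h op, simp add: h_hom)
  then show ?thesis
    by (rule smooth_on_cong) (simp add: nrm_def descend_def)
qed

lemma nrm_section: "nrm \<in> pullback_sections phi"
  unfolding pullback_sections_def using smooth_nrm orthonormal
  by (auto simp: nrm_def phi_def descend_def hphi_def inner_add_left)

lemma nrm_stereo: "nrm (stereo_inv z) = hU n (z, 1) *\<^sub>R e4"
  by (simp add: nrm_def descend_stereo[OF h_hom(3)])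

lemma cpt_nrm: "cpt (\<lambda>z. nrm (stereo_inv z)) b = (\<lambda>z. of_real (e4 \<bullet> b) * Uc n z)"
  by (simp add: cpt_def[abs_def] nrm_stereo h_chart(3) mult.commute)

lemma Cinf_Uc: "Cinf UNIV (Uc n)"
proof -
  have F: "Cinf punctured (radial nrm)" by (rule Cinf_radial[OF smooth_nrm])
  have "Cinf UNIV (\<lambda>z. complex_of_real (nrm (stereo_inv z) \<bullet> e4))"
    by (intro Cinf_of_real Cinf_inner Cinf_const Cinf_chart F open_UNIV)
  moreover have "(\<lambda>z. complex_of_real (nrm (stereo_inv z) \<bullet> e4)) = Uc n"
    by (simp add: nrm_stereo orthonormal h_chart(3) fun_eq_iff)
  ultimately show ?thesis by simp
qed

lemma wz_cpt_nrm:
  "wz (cpt (\<lambda>z. nrm (stereo_inv z)) b) = (\<lambda>z. of_real (e4 \<bullet> b) * wz (Uc n) z)"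
  "wz (wz (cpt (\<lambda>z. nrm (stereo_inv z)) b)) z = of_real (e4 \<bullet> b) * wz (wz (Uc n)) z"
  "wb (wz (cpt (\<lambda>z. nrm (stereo_inv z)) b)) z = of_real (e4 \<bullet> b) * wb (wz (Uc n)) z"
proof -
  show 1: "wz (cpt (\<lambda>z. nrm (stereo_inv z)) b) = (\<lambda>z. of_real (e4 \<bullet> b) * wz (Uc n) z)"
    unfolding cpt_nrm by (rule ext) (rule wirtinger_cmult(1)[OF Cinf_differentiable_UNIV[OF Cinf_Uc]])
  show "wz (wz (cpt (\<lambda>z. nrm (stereo_inv z)) b)) z = of_real (e4 \<bullet> b) * wz (wz (Uc n)) z"
    "wb (wz (cpt (\<lambda>z. nrm (stereo_inv z)) b)) z = of_real (e4 \<bullet> b) * wb (wz (Uc n)) z"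
    unfolding 1 by (rule wirtinger_cmult[OF Cinf_differentiable_UNIV[OF Cinf_wirtinger(1)[OF Cinf_Uc]]])+
qed

lemma lap_nrm_chart: "(4 * (sw z)\<^sup>2) *\<^sub>R lap (radial nrm) (stereo_inv z) = - rho n z *\<^sub>R nrm (stereo_inv z)"
  unfolding lap_stereo[OF Cinf_radial[OF smooth_nrm]]
proof (rule laplace_eqI_cpt[OF Cinf_chart[OF Cinf_radial[OF smooth_nrm]]])
  fix b :: "real ^ 'm"
  have "4 * wb (wz (cpt (\<lambda>z. nrm (stereo_inv z)) b)) z = of_real (e4 \<bullet> b) * (4 * wb (wz (Uc n)) z)"
    unfolding wz_cpt_nrm(3) by simp
  then show "4 * wb (wz (cpt (\<lambda>z. nrm (stereo_inv z)) b)) z =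
      complex_of_real (- rho n z) * cpt (\<lambda>z. nrm (stereo_inv z)) b z"
    unfolding Uc_laplace cpt_nrm by simp
qed

lemma jacobi_nrm: "jacobi_field phi nrm"
  by (rule jacobi_fieldI[OF smooth_map_phi phi_pde nrm_section eq_grad_sqI[OF Cinf_radial[OF smooth_nrm] lap_nrm_chart]])

lemma not_integrable_nrm: "\<not> integrable_jacobi_field phi nrm"
proof
  let ?\<mu> = "(of_nat (n + 3) * of_nat (n + 2)) / of_nat (n + 1) - 2 * Dz n 1 / Dc n 1"
  let ?r = "wz (wz (Uc n)) 1 - ?\<mu> * wz (Uc n) 1"
  assume "integrable_jacobi_field phi nrm"
  then obtain \<epsilon> \<Phi> where \<Phi>: "smooth_variation \<epsilon> phi \<Phi>" "tangent_to \<Phi> nrm" "\<forall>t\<in>{-\<epsilon><..<\<epsilon>}. harmonic_map (\<Phi> t)"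
    unfolding integrable_jacobi_field_def by blast
  have "(\<Sum>b\<in>Basis. (wz (wz (cpt (\<lambda>z. nrm (stereo_inv z)) b)) 1 - ?\<mu> * wz (cpt (\<lambda>z. nrm (stereo_inv z)) b) 1)\<^sup>2) = 0"
  proof (rule variation_through_harmonic_maps[OF \<Phi>(1,2) _ smooth_nrm])
    show "harmonic_map (\<Phi> t)" if "t \<in> {-\<epsilon><..<\<epsilon>}" for t using \<Phi>(3) that by blast
    show "wz (wz (cpt (\<lambda>z. phi (stereo_inv z)) b)) 1 = ?\<mu> * wz (cpt (\<lambda>z. phi (stereo_inv z)) b) 1" for b
      unfolding cpt_phi by (rule coord_second)
  qed
  \<comment> \<open>The field has the constant direction \<open>e4\<close>, so the vector reduces to
    one complex scalar times a real unit vector; isotropy of such a vector forces the scalar to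
    vanish.\<close>
  also have "(\<Sum>b\<in>Basis. (wz (wz (cpt (\<lambda>z. nrm (stereo_inv z)) b)) 1 - ?\<mu> * wz (cpt (\<lambda>z. nrm (stereo_inv z)) b) 1)\<^sup>2) =
      (\<Sum>b\<in>Basis. of_real ((e4 \<bullet> b) * (e4 \<bullet> b)) * ?r\<^sup>2)"
  proof -
    have "(x * p - m * (x * q))\<^sup>2 = (x * x) * (p - m * q)\<^sup>2" for x p m q :: complex
      by (simp add: power2_eq_square algebra_simps)
    then show ?thesis
      unfolding wz_cpt_nrm(2) unfolding wz_cpt_nrm(1) of_real_mult by (intro sum.cong refl)
  qed
  also have "\<dots> = of_real (e4 \<bullet> e4) * ?r\<^sup>2"
    unfolding sum_distrib_right[symmetric] of_real_sum[symmetric] euclidean_inner[of e4 e4] ..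
  finally show False using Uc_second[of n] by (simp add: orthonormal)
qed

lemma not_full_phi: "\<not> full_map phi"
proof -
  have "e4 \<noteq> 0" using orthonormal(4) by auto
  moreover have "e4 \<bullet> phi y = 0" for y
    using orthonormal by (simp add: phi_def descend_def hphi_def inner_add_right inner_commute)
  ultimately show ?thesis
    unfolding full_map_def using phi_sphere by blast
qed

text \<open>Half of the energy density is \<open>n + 3\<close> plus the Laplacian of the function \<open>hL\<close> on the sphere.\<close>

lemma energy_phi: "energy phi = 4 * pi * real (n + 3)"
proof -
  define \<psi> where "\<psi> = descend (hL n)"
  have hom0: "hL n (c * Z, c * W) = hL n (Z, W)" if "c \<noteq> 0" for c Z W
  proof (cases "(Z, W) = 0")
    case True
    then show ?thesis by (simp add: zero_prod_def)
  next
    case False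
    then show ?thesis by (rule h_hom(4)[OF that])
  qed
  have \<psi>: "Cinf punctured (radial \<psi>)"
    unfolding \<psi>_def by (rule Cinf_radial[OF smooth_on_descend[OF Cinf_h(4) hom0]])
  have chart: "(\<lambda>z. \<psi> (stereo_inv z)) = (\<lambda>z. ln (Dr n z) - real (n + 3) * ln (1 + z \<bullet> z))"
    unfolding \<psi>_def by (rule ext) (rule trans[OF descend_stereo[of "hL n", OF hom0] h_chart(4)])
  have pos: "1 + z \<bullet> z > 0" for z :: complex by (simp add: add_pos_nonneg)
  have f: "Cinf UNIV (\<lambda>z. complex_of_real (ln (Dr n z)))"
  proof -
    have "Cinf UNIV (Dr n)"
      unfolding Dr_def[abs_def] numer_def
      by (intro Cinf_add Cinf_inner Cinf_power Cinf_const Cinf_ident open_UNIV)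
    then show ?thesis by (intro Cinf_of_real Cinf_ln open_UNIV Dr_pos)
  qed
  have g: "Cinf UNIV (\<lambda>z::complex. complex_of_real (ln (1 + z \<bullet> z)))"
    by (intro Cinf_of_real Cinf_ln Cinf_add Cinf_inner Cinf_const Cinf_ident open_UNIV pos)
  let ?f = "\<lambda>z. complex_of_real (ln (Dr n z))" and ?g = "\<lambda>z. complex_of_real (ln (1 + z \<bullet> z))" and ?d = "complex_of_real (- real (n + 3))"
  have wd: "wz (\<lambda>z. u z + c * w z) = (\<lambda>z. wz u z + c * wz w z)" "wb (\<lambda>z. u z + c * w z) = (\<lambda>z. wb u z + c * wb w z)"
    if "Cinf UNIV u" "Cinf UNIV w" for u w c
  proof -
    have "wd (\<lambda>z. u z + c * w z) (wz u z + c * wz w z) (wb u z + c * wb w z) z" for z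
    proof -
      have u: "wd u (wz u z) (wb u z) z" and w: "wd w (wz w z) (wb w z) z"
        unfolding wd_def using that by (auto intro!: wirtinger_has_derivative Cinf_differentiable_UNIV)
      show ?thesis by (rule wd_eq[OF wd_add[OF u wd_mult[OF wd_const w]]]) simp_all
    qed
    then show "wz (\<lambda>z. u z + c * w z) = (\<lambda>z. wz u z + c * wz w z)" "wb (\<lambda>z. u z + c * w z) = (\<lambda>z. wb u z + c * wb w z)"
      using wdD by blast+
  qed
  have lap\<psi>: "4 * (sw z)\<^sup>2 * lap (radial \<psi>) (stereo_inv z) = rho n z / 2 - real (n + 3) * (4 * (sw z)\<^sup>2)" for z
  proof -
    let ?h = "\<lambda>z. \<psi> (stereo_inv z)"
    have h: "Cinf UNIV ?h" by (rule Cinf_chart[OF \<psi>])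
    have eq: "cpt ?h 1 = (\<lambda>z. ?f z + ?d * ?g z)"
      unfolding chart by (simp add: cpt_def[abs_def] algebra_simps)
    have "complex_of_real (4 * (sw z)\<^sup>2 * lap (radial \<psi>) (stereo_inv z)) =
        complex_of_real (dderiv 1 (dderiv 1 ?h) z + dderiv \<i> (dderiv \<i> ?h) z)"
      using lap_stereo[OF \<psi>, of z] by simp
    also have "\<dots> = 4 * wb (wz (cpt ?h 1)) z"
      unfolding laplace_wirtinger[OF Cinf_cpt[OF h], symmetric]
      by (simp add: dderiv_cpt h Cinf_dderiv cpt_def)
    also have "\<dots> = 4 * (wb (wz ?f) z + ?d * wb (wz ?g) z)"
      unfolding eq wd(1)[OF f g] wd(2)[OF Cinf_wirtinger(1)[OF f] Cinf_wirtinger(1)[OF g]] ..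
    also have "\<dots> = complex_of_real (rho n z) / 2 + 4 * (?d * of_real ((sw z)\<^sup>2))"
      unfolding ln_sw_laplace ln_Dr_laplace[symmetric] by (simp add: algebra_simps)
    also have "\<dots> = complex_of_real (rho n z / 2 - real (n + 3) * (4 * (sw z)\<^sup>2))"
      by (simp add: algebra_simps)
    finally show ?thesis by (simp only: of_real_eq_iff)
  qed
  have grad: "grad_sq (radial phi) (stereo_inv z) = 2 * (lap (radial \<psi>) (stereo_inv z) + real (n + 3))" for z
  proof -
    have "4 * (sw z)\<^sup>2 * grad_sq (radial phi) (stereo_inv z) = 4 * (sw z)\<^sup>2 * (2 * (lap (radial \<psi>) (stereo_inv z) + real (n + 3)))"
      unfolding grad_phi_chart distrib_left using lap\<psi>[of z] by (simp add: algebra_simps)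
    then show ?thesis by simp
  qed
  \<comment> \<open>Green's formula against the constant 1; the integral of the density is thus its
    constant part times the area 4 pi.\<close>
  have "S2_integral (lap (radial \<psi>)) = 0"
    using S2_green[OF \<psi> Cinf_const[of punctured "1::real"]] S2_integral_const[of 0]
    by (simp add: dderiv_def)
  then have "S2_integral (\<lambda>y. lap (radial \<psi>) y + real (n + 3)) = 4 * pi * real (n + 3)"
    using S2_integral_add[OF Cinf_continuous_on_S2[OF Cinf_lap[OF \<psi>]] continuous_on_const, of "real (n + 3)"]
      S2_integral_const[of "real (n + 3)"] by simp
  moreover have "S2_integral (grad_sq (radial phi)) = S2_integral (\<lambda>y. 2 * (lap (radial \<psi>) y + real (n + 3)))"
    unfolding S2_integral_alt grad ..
  ultimately show ?thesis
    unfolding energy_eq[OF smooth_phi] S2_integral_cmult by simp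
qed

end

section \<open>Choice of target axes and of the embedding into \<open>real ^ 5\<close>\<close>

lemma energy_isometry:
  fixes f :: "real ^ 3 \<Rightarrow> real ^ 'm" and \<iota> :: "real ^ 'm \<Rightarrow> real ^ 'k"
  assumes f: "smooth_on S2 f" and lin: "linear \<iota>" and iso: "\<And>y. norm (\<iota> y) = norm y"
  shows "energy (\<iota> \<circ> f) = energy f"
proof -
  have F: "Cinf punctured (radial f)" by (rule Cinf_radial[OF f])
  have bl: "bounded_linear \<iota>" using lin by (rule linear_conv_bounded_linear[THEN iffD1])
  have radial: "radial (\<iota> \<circ> f) = (\<lambda>y. \<iota> (radial f y))" by (auto simp: radial_def)
  have "Cinf punctured (radial (\<iota> \<circ> f))"
    unfolding radial by (rule Cinf_linear_compose[OF bl punctured(1) F])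
  then have sm: "smooth_on S2 (\<iota> \<circ> f)" by (rule smooth_onI_radial) (rule radial_S2)
  have "grad_sq (radial (\<iota> \<circ> f)) y = grad_sq (radial f) y" if "y \<in> S2" for y
  proof -
    have y: "y \<in> punctured" using that by auto
    show ?thesis
      unfolding grad_sq_def radial dderiv_bounded_linear[OF bl Cinf_differentiable[OF F y]]
      by (simp add: iso power2_norm_eq_inner[symmetric])
  qed
  then show ?thesis
    unfolding energy_eq[OF sm] energy_eq[OF f] using S2_integral_cong by metis
qed

theorem corollary3p20:
  fixes n d :: nat
  assumes "n = 3 \<or> n = 4"
    and "CARD('m::finite) = n + 1"
    and "d \<ge> 3"
  shows "\<exists>\<phi> :: real ^ 3 \<Rightarrow> real ^ 'm.
           harmonic_map \<phi> \<and> \<not> full_map \<phi> \<and> has_twistor_degree \<phi> d \<and>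
           (\<exists>v. jacobi_field \<phi> v \<and> \<not> integrable_jacobi_field \<phi> v)"
proof -
  have card: "4 \<le> CARD('m)" "CARD('m) \<le> 5" using assms(1,2) by auto
  obtain T :: "'m set" where T: "card T = 4" "finite T"
    using obtain_subset_with_card_n[OF card(1)] by (metis finite)
  then obtain g where g: "bij_betw g {0..<4::nat} T"
    using ex_bij_betw_nat_finite by metis
  have dist: "g i = g j \<longleftrightarrow> i = j" if "i < 4" "j < 4" for i j
    using bij_betw_imp_inj_on[OF g] that by (auto simp: inj_on_def)
  define e where "e i = (axis (g i) 1 :: real ^ 'm)" for i
  have e: "e i \<bullet> e j = (if i = j then 1 else 0)" if "i < 4" "j < 4" for i j
    using dist[OF that] by (simp add: e_def inner_axis_axis)
  \<comment> \<open>Four coordinate axes exist since the target has dimension at least 4;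
    \<open>d \<ge> 3\<close> makes the degree \<open>(d - 3) + 3\<close> equal to \<open>d\<close>
    despite truncated subtraction.\<close>
  interpret rational_example "d - 3" "e 0" "e 1" "e 2" "e 3"
    by unfold_locales (simp_all add: e)
  \<comment> \<open>The target has dimension at most 5, which provides the isometric embedding
    demanded by the twistor degree.\<close>
  have "dim (UNIV :: (real ^ 'm) set) \<le> dim (UNIV :: (real ^ 5) set)"
    using card(2) by (simp add: dim_UNIV)
  then obtain \<iota> :: "real ^ 'm \<Rightarrow> real ^ 5" where \<iota>: "linear \<iota>" "\<And>y. norm (\<iota> y) = norm y"
    using isometry_subset_subspace[OF subspace_UNIV subspace_UNIV] by (metis UNIV_I)
  have "energy (\<iota> \<circ> phi) = 4 * pi * real d"
    using energy_isometry[OF smooth_phi \<iota>] energy_phi assms(3) by simp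
  then have "has_twistor_degree phi d"
    unfolding has_twistor_degree_def using \<iota> by blast
  then show ?thesis
    using harmonic_phi not_full_phi jacobi_nrm not_integrable_nrm by blast
qed

end
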